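(* Let $\lambda\in\mathcal{P}^k$ and $1\le r\le k$, and put $\widetilde{h}_r=h_0+h_1+\dots+h_r$ (with $h_0=1$). Then \[ \widetilde{g}^{(k)}_{\lambda}\,\widetilde{h}_r=\sum_{\mu} g^{(k)}_{\mu}, \] where the sum runs (each $\mu$ once) over all $\mu\in\mathcal{P}^k$ such that $\mu\le\kappa$ (strong order) for some $\kappa\in\mathcal{P}^k$ such that $\kappa/\lambda$ is a weak strip of size $r$.
   Context: Fix a positive integer $k$. Let $I=\mathbb{Z}/(k+1)\mathbb{Z}=\{0,1,\dots,k\}$ and let $W=\tilde S_{k+1}$ be the affine symmetric group with Coxeter generators $s_i$ ($i\in I$), relations $s_i^2=1$, $s_is_{i+1}s_i=s_{i+1}s_is_{i+1}$, and $s_is_j=s_js_i$ when $i-j\not\equiv 0,\pm1 \pmod{k+1}$. Let $l$ be the length function, $\le$ the strong (Bruhat) order, and $\le_L$ the left weak order: $u\le_L v$ iff $l(vu^{-1})+l(u)=l(v)$. Let $W^\circ\subset W$ be the set of affine Grassmannian elements, i.e. $w$ with $ws_i>w$ for all $i\in\{1,\dots,k\}$. For $A\subsetneq I$, $d_A=s_{i_1}\cdots s_{i_m}$ where $A=\{i_1,\dots,i_m\}$ and the word $i_1\cdots i_m$ is cyclically decreasing (distinct letters, and no $j$ occurs to the left of $j+1$, indices mod $k+1$); this is independent of the choice of word. $\mathcal{P}^k$ is the set of partitions $\lambda$ with $\lambda_1\le k$. The residue of the cell in row $i$, column $j$ is $j-i \bmod (k+1)$. For $\lambda\in\mathcal{P}^k$,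 $w_\lambda=s_{i_1}\cdots s_{i_l}$ where $(i_1,\dots,i_l)$ are the residues of the cells of $\lambda$ read from the shortest row to the longest, each row from right to left; $\lambda\mapsto w_\lambda$ is a bijection $\mathcal{P}^k\to W^\circ$, and $\mathcal P^k$ carries the strong order $\mu\le\lambda\iff w_\mu\le w_\lambda$. For $\lambda,\kappa\in\mathcal{P}^k$, $\kappa/\lambda$ is a weak strip of size $r$ if $w_\kappa=d_Aw_\lambda\ge_L w_\lambda$ for some $A\subsetneq I$ with $|A|=r$. Demazure action: for $s=s_i$, $\phi_s(x)=sx$ if $sx>x$ and $\phi_s(x)=x$ otherwise; for $x=t_1\cdots t_n$ reduced, $x*y=\phi_{t_1}\cdots\phi_{t_n}(y)$. Let $h_r$ be the complete homogeneous symmetric functions and $\Lambda^{(k)}=\mathbb{Z}[h_1,\dots,h_k]$. The $K$-$k$-Schur functions $\{g^{(k)}_w\}_{w\in W^\circ}$ are the family (a basis of $\Lambda^{(k)}$) determined by $g^{(k)}_e=1$ and, for $w\in W^\circ$ and $1\le r\le k$, $h_r\,g^{(k)}_w=\sum (-1)^{r+l(w)-l(d_A*w)} g^{(k)}_{d_A*w}$, summed over $A\subsetneq I$ with $|A|=r$ and $d_A*w\in W^\circ$. Write $g^{(k)}_\lambda=g^{(k)}_{w_\lambda}$ and $\widetilde{g}^{(k)}_{\lambda}=\sum_{\mu\in\mathcal{P}^k,\ \mu\le\lambda} g^{(k)}_{\mu}$. *)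

theory Defs
  imports "HOL-Library.Multiset" "HOL-Algebra.Group"
begin

section \<open>The affine symmetric group\<close>

text \<open>
  The group is given by its Coxeter presentation. A word over \<open>I = {0, \<dots>, k}\<close> (indices modulo
  \<open>k + 1\<close>) is a list, and a group element is a class of words. As the generators are involutions,
  it makes no difference whether one presents a group or a monoid. For \<open>k = 1\<close> one has
  \<open>i + 1 = i - 1\<close> in \<open>I\<close> and, as usual for the affine symmetric group on two letters (the
  infinite dihedral group), there is no braid relation.
\<close>

abbreviation coxeter_words :: "nat \<Rightarrow> nat list set" where
  "coxeter_words k \<equiv> lists {..k}"

definition succ_mod :: "nat \<Rightarrow> nat \<Rightarrow> nat" where
  "succ_mod k i = (i + 1) mod (k + 1)"

definition coxeter_relators :: "nat \<Rightarrow> (nat list \<times> nat list) set" where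
  "coxeter_relators k =
     {([i, i], []) | i. i \<le> k} \<union>
     {([i, succ_mod k i, i], [succ_mod k i, i, succ_mod k i]) | i. i \<le> k \<and> 2 \<le> k} \<union>
     {([i, j], [j, i]) | i j. i \<le> k \<and> j \<le> k \<and> i \<noteq> j \<and> j \<noteq> succ_mod k i \<and> i \<noteq> succ_mod k j}"

inductive coxeter_eq :: "nat \<Rightarrow> nat list \<Rightarrow> nat list \<Rightarrow> bool" for k where
  relator: "(u, v) \<in> coxeter_relators k \<Longrightarrow> x \<in> coxeter_words k \<Longrightarrow> y \<in> coxeter_words k
      \<Longrightarrow> coxeter_eq k (x @ u @ y) (x @ v @ y)"
| refl: "x \<in> coxeter_words k \<Longrightarrow> coxeter_eq k x x"
| sym: "coxeter_eq k x y \<Longrightarrow> coxeter_eq k y x"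
| trans: "coxeter_eq k x y \<Longrightarrow> coxeter_eq k y z \<Longrightarrow> coxeter_eq k x z"

type_synonym affine_perm = "nat list set"

definition word_class :: "nat \<Rightarrow> nat list \<Rightarrow> affine_perm" where
  "word_class k x = {y. coxeter_eq k x y}"

definition affine_sym :: "nat \<Rightarrow> affine_perm monoid" where
  "affine_sym k =
     \<lparr>carrier = word_class k ` coxeter_words k,
      monoid.mult = (\<lambda>u v. \<Union>x\<in>u. \<Union>y\<in>v. word_class k (x @ y)),
      one = word_class k []\<rparr>"

abbreviation simple_refl :: "nat \<Rightarrow> nat \<Rightarrow> affine_perm" where
  "simple_refl k i \<equiv> word_class k [i]"

definition cox_length :: "affine_perm \<Rightarrow> nat" where
  "cox_length w = (LEAST n. \<exists>x\<in>w. length x = n)"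

definition reflections :: "nat \<Rightarrow> affine_perm set" where
  "reflections k =
     {v \<otimes>\<^bsub>affine_sym k\<^esub> simple_refl k i \<otimes>\<^bsub>affine_sym k\<^esub> inv\<^bsub>affine_sym k\<^esub> v | v i.
        v \<in> carrier (affine_sym k) \<and> i \<le> k}"

definition strong_le :: "nat \<Rightarrow> affine_perm \<Rightarrow> affine_perm \<Rightarrow> bool" where
  "strong_le k = (\<lambda>u v. u \<in> carrier (affine_sym k) \<and>
     (\<exists>t\<in>reflections k. v = t \<otimes>\<^bsub>affine_sym k\<^esub> u \<and> cox_length u < cox_length v))\<^sup>*\<^sup>*"

definition strong_less :: "nat \<Rightarrow> affine_perm \<Rightarrow> affine_perm \<Rightarrow> bool" where
  "strong_less k u v \<longleftrightarrow> strong_le k u v \<and> u \<noteq> v"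

definition left_weak_le :: "nat \<Rightarrow> affine_perm \<Rightarrow> affine_perm \<Rightarrow> bool" where
  "left_weak_le k u v \<longleftrightarrow>
     cox_length (v \<otimes>\<^bsub>affine_sym k\<^esub> inv\<^bsub>affine_sym k\<^esub> u) + cox_length u = cox_length v"

definition affine_grassmannian :: "nat \<Rightarrow> affine_perm set" where
  "affine_grassmannian k =
     {w \<in> carrier (affine_sym k).
        \<forall>i\<in>{1..k}. strong_less k w (w \<otimes>\<^bsub>affine_sym k\<^esub> simple_refl k i)}"

definition cyclically_decreasing :: "nat \<Rightarrow> nat list \<Rightarrow> bool" where
  "cyclically_decreasing k x \<longleftrightarrow>
     x \<in> coxeter_words k \<and> distinct x \<and>
     (\<forall>a b. a < b \<and> b < length x \<longrightarrow> x ! b \<noteq> succ_mod k (x ! a))"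

text \<open>Only meaningful for proper subsets \<open>A\<close> of \<open>I\<close>; the element does not depend on the chosen word.\<close>

definition cyc_elem :: "nat \<Rightarrow> nat set \<Rightarrow> affine_perm" where
  "cyc_elem k A = word_class k (SOME x. cyclically_decreasing k x \<and> set x = A)"

definition demazure_step :: "nat \<Rightarrow> nat \<Rightarrow> affine_perm \<Rightarrow> affine_perm" where
  "demazure_step k i x =
     (if strong_less k x (simple_refl k i \<otimes>\<^bsub>affine_sym k\<^esub> x)
      then simple_refl k i \<otimes>\<^bsub>affine_sym k\<^esub> x else x)"

definition reduced_word :: "affine_perm \<Rightarrow> nat list \<Rightarrow> bool" where
  "reduced_word w x \<longleftrightarrow> x \<in> w \<and> length x = cox_length w"

text \<open>The result does not depend on the chosen reduced word.\<close>

definition demazure :: "nat \<Rightarrow> affine_perm \<Rightarrow> affine_perm \<Rightarrow> affine_perm" where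
  "demazure k x y = foldr (demazure_step k) (SOME t. reduced_word x t) y"


section \<open>Bounded partitions\<close>

definition bounded_partitions :: "nat \<Rightarrow> nat list set" where
  "bounded_partitions k = {l. sorted_wrt (\<ge>) l \<and> (\<forall>a\<in>set l. 1 \<le> a \<and> a \<le> k)}"

text \<open>Rows and columns are numbered from \<open>0\<close> here, which does not affect \<open>j - i\<close>.\<close>

definition residue :: "nat \<Rightarrow> nat \<Rightarrow> nat \<Rightarrow> nat" where
  "residue k i j = nat ((int j - int i) mod int (k + 1))"

definition residue_word :: "nat \<Rightarrow> nat list \<Rightarrow> nat list" where
  "residue_word k l =
     concat (map (\<lambda>i. map (\<lambda>j. residue k i j) (rev [0..<l ! i])) (rev [0..<length l]))"

definition part_elem :: "nat \<Rightarrow> nat list \<Rightarrow> affine_perm" where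
  "part_elem k l = word_class k (residue_word k l)"

definition part_le :: "nat \<Rightarrow> nat list \<Rightarrow> nat list \<Rightarrow> bool" where
  "part_le k m l \<longleftrightarrow> strong_le k (part_elem k m) (part_elem k l)"

definition weak_strip :: "nat \<Rightarrow> nat \<Rightarrow> nat list \<Rightarrow> nat list \<Rightarrow> bool" where
  "weak_strip k r \<kappa> l \<longleftrightarrow>
     (\<exists>A. A \<subset> {..k} \<and> card A = r \<and>
        part_elem k \<kappa> = cyc_elem k A \<otimes>\<^bsub>affine_sym k\<^esub> part_elem k l \<and>
        left_weak_le k (part_elem k l) (part_elem k \<kappa>))"


section \<open>Symmetric functions\<close>

text \<open>
  Symmetric functions live in the ring of formal power series over the integers in variables
  \<open>x\<^sub>0, x\<^sub>1, \<dots>\<close>. A monomial is a multiset of variable indices, and a series is the family of its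
  coefficients.
\<close>

typedef power_series = "UNIV :: (nat multiset \<Rightarrow> int) set"
  morphisms coefficient Series ..

setup_lifting type_definition_power_series

lemma finite_submultisets: "finite {A. A \<subseteq># (M :: 'a multiset)}"
proof (induction M)
  case empty
  then show ?case by simp
next
  case (add x M)
  have "{A. A \<subseteq># add_mset x M} \<subseteq> {A. A \<subseteq># M} \<union> add_mset x ` {A. A \<subseteq># M}"
  proof
    fix A assume A: "A \<in> {A. A \<subseteq># add_mset x M}"
    show "A \<in> {A. A \<subseteq># M} \<union> add_mset x ` {A. A \<subseteq># M}"
    proof (cases "x \<in># A")
      case True
      then obtain B where "A = add_mset x B" by (metis insert_DiffM)
      with A show ?thesis by auto
    next
      case False
      with A have "A \<subseteq># M"
        by (metis (no_types, lifting) diff_single_trivial mem_Collect_eq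
            subset_eq_diff_conv add_mset_add_single)
      then show ?thesis by simp
    qed
  qed
  with add show ?case by (meson finite_UnI finite_imageI finite_subset)
qed

instantiation power_series :: comm_ring_1
begin

lift_definition zero_power_series :: power_series is "\<lambda>_. 0" .
lift_definition one_power_series :: power_series is "\<lambda>M. if M = {#} then 1 else 0" .
lift_definition plus_power_series :: "power_series \<Rightarrow> power_series \<Rightarrow> power_series"
  is "\<lambda>f g M. f M + g M" .
lift_definition uminus_power_series :: "power_series \<Rightarrow> power_series"
  is "\<lambda>f M. - f M" .
lift_definition minus_power_series :: "power_series \<Rightarrow> power_series \<Rightarrow> power_series"
  is "\<lambda>f g M. f M - g M" .
lift_definition times_power_series :: "power_series \<Rightarrow> power_series \<Rightarrow> power_series"
  is "\<lambda>f g M. \<Sum>A | A \<subseteq># M. f A * g (M - A)" .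

instance
proof
  fix a b c :: power_series
  show "a * b * c = a * (b * c)"
  proof (transfer, rule ext)
    fix a b c :: "nat multiset \<Rightarrow> int" and M
    have "(\<Sum>A | A \<subseteq># M. (\<Sum>B | B \<subseteq># A. a B * b (A - B)) * c (M - A))
        = (\<Sum>(A, B)\<in>(SIGMA A:{A. A \<subseteq># M}. {B. B \<subseteq># A}). a B * b (A - B) * c (M - A))"
      by (simp add: sum_distrib_right sum.Sigma finite_submultisets)
    also have "\<dots> = (\<Sum>(B, C)\<in>(SIGMA B:{B. B \<subseteq># M}. {C. C \<subseteq># M - B}).
        a B * (b C * c (M - B - C)))"
      by (rule sum.reindex_bij_witness[where
            i = "\<lambda>(B, C). (B + C, B)" and j = "\<lambda>(A, B). (B, A - B)"])
        (auto simp: mset_subset_eq_exists_conv ac_simps)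
    also have "\<dots> = (\<Sum>B | B \<subseteq># M. a B * (\<Sum>C | C \<subseteq># M - B. b C * c (M - B - C)))"
      by (simp add: sum_distrib_left sum.Sigma finite_submultisets)
    finally show "(\<Sum>A | A \<subseteq># M. (\<Sum>B | B \<subseteq># A. a B * b (A - B)) * c (M - A))
        = (\<Sum>B | B \<subseteq># M. a B * (\<Sum>C | C \<subseteq># M - B. b C * c (M - B - C)))" .
  qed
  show "a * b = b * a"
  proof (transfer, rule ext)
    fix a b :: "nat multiset \<Rightarrow> int" and M
    show "(\<Sum>A | A \<subseteq># M. a A * b (M - A)) = (\<Sum>A | A \<subseteq># M. b A * a (M - A))"
      by (rule sum.reindex_bij_witness[where i = "\<lambda>A. M - A" and j = "\<lambda>A. M - A"])
        (auto simp: mset_subset_eq_exists_conv ac_simps)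
  qed
  show "1 * a = a"
  proof (transfer, rule ext)
    fix a :: "nat multiset \<Rightarrow> int" and M
    have "(\<Sum>A | A \<subseteq># M. (if A = {#} then 1 else 0) * a (M - A))
        = (\<Sum>A | A \<subseteq># M. if A = {#} then a M else 0)"
      by (rule sum.cong) auto
    also have "\<dots> = a M" by (simp add: finite_submultisets)
    finally show "(\<Sum>A | A \<subseteq># M. (if A = {#} then 1 else 0) * a (M - A)) = a M" .
  qed
  show "(a + b) * c = a * c + b * c"
    by transfer (auto simp: distrib_right sum.distrib)
  show "a + b + c = a + (b + c)" by transfer (simp add: add.assoc)
  show "a + b = b + a" by transfer (simp add: add.commute)
  show "0 + a = a" by transfer simp
  show "- a + a = 0" by transfer simp
  show "a - b = a + - b" by transfer simp
  show "(0 :: power_series) \<noteq> 1" by transfer (metis zero_neq_one)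
qed

end

text \<open>The complete homogeneous symmetric function of degree \<open>r\<close>: the sum of all monomials of
  degree \<open>r\<close>; in particular \<open>hsym 0 = 1\<close>.\<close>

lift_definition hsym :: "nat \<Rightarrow> power_series" is "\<lambda>r M. if size M = r then 1 else 0" .

text \<open>The subring \<open>\<int>[h\<^sub>1, \<dots>, h\<^sub>k]\<close>.\<close>

inductive_set Lambda_k :: "nat \<Rightarrow> power_series set" for k where
  one: "1 \<in> Lambda_k k"
| hsym: "1 \<le> r \<Longrightarrow> r \<le> k \<Longrightarrow> hsym r \<in> Lambda_k k"
| diff: "a \<in> Lambda_k k \<Longrightarrow> b \<in> Lambda_k k \<Longrightarrow> a - b \<in> Lambda_k k"
| mult: "a \<in> Lambda_k k \<Longrightarrow> b \<in> Lambda_k k \<Longrightarrow> a * b \<in> Lambda_k k"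

definition htilde :: "nat \<Rightarrow> power_series" where
  "htilde r = (\<Sum>i\<le>r. hsym i)"


section \<open>K-k-Schur functions\<close>

text \<open>
  The family is characterised by its value at the identity and the Pieri rule, so it is rendered
  as a predicate on families \<open>g\<close>. The values of \<open>g\<close> outside the affine Grassmannian elements are
  irrelevant. The length of a Demazure product \<open>d\<^sub>A * w\<close> is at most \<open>r + l(w)\<close>, so the
  subtraction in the exponent does not truncate.
\<close>

definition K_k_Schur :: "nat \<Rightarrow> (affine_perm \<Rightarrow> power_series) \<Rightarrow> bool" where
  "K_k_Schur k g \<longleftrightarrow>
     (\<forall>w\<in>affine_grassmannian k. g w \<in> Lambda_k k) \<and>
     g \<one>\<^bsub>affine_sym k\<^esub> = 1 \<and>
     (\<forall>w\<in>affine_grassmannian k. \<forall>r\<in>{1..k}.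
        hsym r * g w =
          (\<Sum>A | A \<subset> {..k} \<and> card A = r \<and> demazure k (cyc_elem k A) w \<in> affine_grassmannian k.
             (- 1) ^ (r + cox_length w - cox_length (demazure k (cyc_elem k A) w))
               * g (demazure k (cyc_elem k A) w)))"

definition g_part :: "nat \<Rightarrow> (affine_perm \<Rightarrow> power_series) \<Rightarrow> nat list \<Rightarrow> power_series" where
  "g_part k g l = g (part_elem k l)"

definition g_tilde :: "nat \<Rightarrow> (affine_perm \<Rightarrow> power_series) \<Rightarrow> nat list \<Rightarrow> power_series" where
  "g_tilde k g l = (\<Sum>\<mu> | \<mu> \<in> bounded_partitions k \<and> part_le k \<mu> l. g_part k g \<mu>)"

end

theory Submission
  imports Defs
begin

text \<open>
  The group acts faithfully on the integers, the generator \<open>s\<^sub>i\<close> exchanging \<open>z\<close> and \<open>z + 1\<close> for all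
  \<open>z\<close> congruent to \<open>i\<close>, and length, descents and strong exchange are read off this action. Below an
  element of the strong order, the sum of the standard basis of the 0-Hecke algebra with
  \<open>T\<^sub>s\<^sup>2 = - T\<^sub>s\<close> is the product of the idempotents \<open>1 + T\<^sub>s\<close>. So the sum over all \<open>B \<subseteq> A\<close> of the
  coefficients of the products of \<open>T\<close> along \<open>d\<^sub>B\<close> with the lower ideal of \<open>w\<^sub>\<lambda>\<close> is the indicator of
  \<open>u \<le> d\<^sub>A * w\<^sub>\<lambda>\<close>. Dividing \<open>u\<close> by \<open>w\<^sub>\<lambda>\<close> from the right turns this condition into \<open>u' \<le> d\<^sub>A\<close>, which holds
  precisely for the \<open>A\<close> above one fixed set; hence by Moebius inversion the coefficient of \<open>u\<close> in the
  product is \<open>1\<close> if \<open>u \<le> d\<^sub>A * w\<^sub>\<lambda>\<close> for some \<open>A\<close> of size at most \<open>r\<close>, and \<open>0\<close> otherwise. Below the element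
  \<open>d\<^sub>A * w\<^sub>\<lambda>\<close>, the Grassmannian elements are those below a weak strip of size at most \<open>r\<close>, and weak strips
  extend to any size up to \<open>k\<close>.
\<close>

text \<open>Two mismatches shape the proof. The Pieri rule keeps only those \<open>A\<close> for
  which \<open>d_A * w\<close> is Grassmannian, with \<open>w\<close> Grassmannian too, whereas the
  idempotents act on the whole lower ideal. This is harmless because a Demazure product with a
  non-Grassmannian element is never Grassmannian: at a Grassmannian \<open>u\<close> no term is
  lost. Moreover, \<open>h_0 + ... + h_r\<close> produces sets of size at most \<open>r\<close>, but
  weak strips have size exactly \<open>r\<close>; hence the need to extend strips. The truncation at
  \<open>r\<close> is compatible with the inversion because, for fixed \<open>u\<close>, the sum
  over all subsets of \<open>B\<close> is the indicator of \<open>A0 \<subseteq> B\<close>; so the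
  coefficient of a single \<open>B\<close> is the indicator of \<open>B = A0\<close>, and the sizes
  up to \<open>r\<close> merely ask for \<open>card A0 \<le> r\<close>. As the group is given by a
  presentation, faithfulness of the action must come before any use of it. It turns classes of words
  into functions, and inequalities between values of a function and of its inverse then do the work
  of a root system. The same functions, read as abaci of period \<open>N = k + 1\<close>, give the
  bijection with bounded partitions and the combinatorics of strips.\<close>

abbreviation pinv :: "('a \<Rightarrow> 'b) \<Rightarrow> 'b \<Rightarrow> 'a" where
  "pinv \<equiv> inv_into UNIV"

section \<open>The generators as periodic permutations of the integers\<close>

locale affine_action =
  fixes k :: nat
  assumes k_pos: "1 \<le> k"
begin

definition N :: int where "N = int k + 1"

lemma N_ge2: "2 \<le> N"
  using k_pos by (simp add: N_def)

definition cg :: "int \<Rightarrow> int \<Rightarrow> bool" where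
  "cg x y \<longleftrightarrow> N dvd (x - y)"

lemma cg_refl [simp]: "cg x x"
  by (simp add: cg_def)

lemma cg_sym: "cg x y \<Longrightarrow> cg y x"
  by (metis cg_def dvd_minus_iff minus_diff_eq)

lemma cg_trans: "cg x y \<Longrightarrow> cg y z \<Longrightarrow> cg x z"
  unfolding cg_def using dvd_add by fastforce

lemma cg_add: "cg x y \<Longrightarrow> cg (x + c) (y + c)"
  by (simp add: cg_def)

lemma cg_eq: "cg x y \<Longrightarrow> cg x z \<longleftrightarrow> cg y z" "cg x y \<Longrightarrow> cg z x \<longleftrightarrow> cg z y"
  using cg_sym cg_trans by blast+

lemma cg_near: "cg x y \<Longrightarrow> \<bar>x - y\<bar> < N \<Longrightarrow> x = y"
  unfolding cg_def using zdvd_imp_le[of N "\<bar>x - y\<bar>"] by (cases "x = y") auto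

lemma cg_E:
  assumes "cg x y" obtains c where "x = y + c * N"
  using assms unfolding cg_def by (metis dvd_def mult.commute diff_add_cancel add.commute)

lemma cg_mult [simp]: "cg (x + c * N) y \<longleftrightarrow> cg x y" "cg x (y + c * N) \<longleftrightarrow> cg x y"
  unfolding cg_def
  by (metis add_diff_eq diff_add_eq dvd_add_times_triv_right_iff mult.commute)
     (smt (verit) cg_def dvd_add_times_triv_right_iff)

lemma cg_off:
  assumes "cg x y" "c \<noteq> 0" "\<bar>c\<bar> < N" shows "\<not> cg (x + c) y" "\<not> cg y (x + c)"
  using assms cg_near[of "x + c" x] cg_trans[of "x + c" y x] cg_sym by auto

lemma cg_nat: "i \<le> k \<Longrightarrow> j \<le> k \<Longrightarrow> cg (int i) (int j) \<longleftrightarrow> i = j"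
  using cg_near[of "int i" "int j"] by (auto simp: N_def)

definition sg :: "int \<Rightarrow> int \<Rightarrow> int" where
  "sg i z = (if cg z i then z + 1 else if cg z (i + 1) then z - 1 else z)"

lemma sg_cong: "cg i j \<Longrightarrow> sg i = sg j"
  using cg_eq(2)[of i j] cg_eq(2)[OF cg_add[of i j 1]] by (auto simp: sg_def)

lemma sg_up: "cg z i \<Longrightarrow> sg i z = z + 1"
  by (simp add: sg_def)

lemma sg_down: "cg z (i + 1) \<Longrightarrow> sg i z = z - 1"
  using cg_off[of z "i + 1" 1] cg_add[of z i 1] N_ge2 by (auto simp: sg_def)

lemma sg_fix: "\<not> cg z i \<Longrightarrow> \<not> cg z (i + 1) \<Longrightarrow> sg i z = z"
  by (simp add: sg_def)

lemma sg_sg [simp]: "sg i (sg i z) = z"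
proof -
  consider "cg z i" | "cg z (i + 1)" | "\<not> cg z i" "\<not> cg z (i + 1)" by blast
  then show ?thesis
  proof cases
    case 1 then show ?thesis using cg_add[of z i 1] by (simp add: sg_up sg_down)
  next
    case 2 then show ?thesis using cg_add[of z "i + 1" "-1"] by (simp add: sg_up sg_down)
  qed (simp add: sg_fix)
qed

lemma sg_comp_sg [simp]: "sg i \<circ> sg i = id"
  by auto

lemma sg_comp_sg2 [simp]: "sg i \<circ> (sg i \<circ> f) = f"
  by auto

lemma inv_sg [simp]: "pinv (sg i) = sg i"
  by (simp add: inv_unique_comp)

lemma sg_period: "sg i (z + c * N) = sg i z + c * N"
  by (simp add: sg_def)

text \<open>The pairs of residues moved by the two generators are disjoint.\<close>

lemma sg_commute:
  assumes "\<not> cg i j" "\<not> cg i (j + 1)" "\<not> cg j (i + 1)"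
  shows "sg i (sg j z) = sg j (sg i z)"
proof -
  have a: "\<not> cg j i" "\<not> cg (i+1) (j+1)" "\<not> cg (i+1) j" "\<not> cg (j+1) i" "\<not> cg (j+1) (i+1)"
    using assms cg_sym by (blast, auto simp: cg_def dest: cg_sym[unfolded cg_def])
  consider "cg z i" | "cg z (i + 1)" | "cg z j" | "cg z (j+1)" |
    "\<not> cg z i" "\<not> cg z (i + 1)" "\<not> cg z j" "\<not> cg z (j+1)" by blast
  then show ?thesis
  proof cases
    case 1
    note c = 1 cg_add[OF 1, of 1]
    show ?thesis using c assms a by (simp add: sg_def cg_eq(1)[OF c(1)] cg_eq(1)[OF c(2)])
  next
    case 2
    have c: "cg z (i + 1)" "cg (z - 1) i" using 2 cg_add[OF 2, of "-1"] by auto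
    have "\<not> cg z i" using cg_off[OF c(1), of "-1"] N_ge2 c(2) cg_off(1)[OF c(2), of 1] by auto
    then show ?thesis using c assms a by (simp add: sg_def cg_eq(1)[OF c(1)] cg_eq(1)[OF c(2)])
  next
    case 3
    note c = 3 cg_add[OF 3, of 1]
    show ?thesis using c assms a by (simp add: sg_def cg_eq(1)[OF c(1)] cg_eq(1)[OF c(2)])
  next
    case 4
    have c: "cg z (j + 1)" "cg (z - 1) j" using 4 cg_add[OF 4, of "-1"] by auto
    have "\<not> cg z j" using cg_off(1)[OF c(2), of 1] N_ge2 by auto
    then show ?thesis using c assms a by (simp add: sg_def cg_eq(1)[OF c(1)] cg_eq(1)[OF c(2)])
  qed (simp add: sg_fix)
qed

text \<open>For \<open>N \<ge> 3\<close> the residues \<open>i\<close>, \<open>i + 1\<close>,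
  \<open>i + 2\<close> are distinct, and both sides exchange the outer two.\<close>

lemma sg_braid:
  assumes "3 \<le> N"
  shows "sg i (sg (i+1) (sg i z)) = sg (i+1) (sg i (sg (i+1) z))"
proof -
  consider "cg z i" | "cg z (i + 1)" | "cg z (i+2)" |
    "\<not> cg z i" "\<not> cg z (i + 1)" "\<not> cg z (i+2)" by blast
  then show ?thesis
  proof cases
    case 1
    have f: "cg (z+1) (i+1)" "cg (z+2) (i+2)" using 1 by (auto intro: cg_add)
    have "\<not> cg z (i+1)" "\<not> cg z (i+2)" "\<not> cg (z+2) i" "\<not> cg (z+2) (i+1)"
      using cg_off[OF f(1), of "-1"] cg_off[OF f(2), of "-2"] cg_off[OF 1, of 2] cg_off[OF f(1), of 1] assms
      by (auto simp: add.commute)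
    then show ?thesis using 1 f sg_up[of "z+1" "i+1"] by (simp add: sg_up sg_fix add.commute)
  next
    case 2
    have f: "cg (z-1) i" "cg (z+1) (i+2)" using cg_add[OF 2, of "-1"] cg_add[OF 2, of 1] by (auto simp: add.commute)
    have "\<not> cg (z-1) (i+1)" "\<not> cg (z-1) (i+2)" "\<not> cg (z+1) i" "\<not> cg (z+1) (i+1)"
      using cg_off[OF f(1), of 2] cg_off[OF 2, of "-1"] cg_off[OF f(2), of "-2"] cg_off[OF 2, of 1] assms
      by (auto simp: add.commute)
    then have "sg (i+1) (z-1) = z-1" "sg i (z+1) = z+1"
      using f by (auto simp: sg_def add.commute)
    moreover have "sg i z = z-1" "sg i (z-1) = z" "sg (i+1) z = z+1" "sg (i+1) (z+1) = z"
      using 2 f sg_down[of z i] sg_up[of "z-1" i] sg_up[of z "i+1"] sg_down[of "z+1" "i+1"] by (auto simp: add.commute)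
    ultimately show ?thesis by simp
  next
    case 3
    have f: "cg (z-1) (i+1)" "cg (z-2) i" using cg_add[OF 3, of "-1"] cg_add[OF 3, of "-2"] by (auto simp: add.commute)
    have "\<not> cg z i" "\<not> cg z (i+1)" "\<not> cg (z-2) (i+1)" "\<not> cg (z-2) (i+2)"
      using cg_off[OF f(2), of 2] cg_off[OF f(1), of 1] cg_off[OF f(1), of "-1"] cg_off[OF 3, of "-2"] assms by auto
    then have "sg i z = z" "sg (i+1) (z-2) = z-2"
      by (auto simp: sg_def add.commute)
    moreover have "sg (i+1) z = z-1" "sg i (z-1) = z-2"
      using 3 f sg_down[of z "i+1"] sg_down[of "z-1" i] by (auto simp: add.commute)
    ultimately show ?thesis by simp
  qed (simp add: sg_def add.commute)
qed

lemma cg_succ: "i \<le> k \<Longrightarrow> cg (int (succ_mod k i)) (int i + 1)"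
  using dvd_minus_iff[of "int k + 1" "int k + 1"]
  unfolding succ_mod_def cg_def N_def
  by (cases "i = k") (auto simp del: dvd_minus_iff)

lemma succ_mod_le [simp]: "succ_mod k i \<le> k"
  by (simp add: succ_mod_def less_Suc_eq_le[symmetric])

lemma cg_succ_iff: "i \<le> k \<Longrightarrow> j \<le> k \<Longrightarrow> j = succ_mod k i \<longleftrightarrow> cg (int j) (int i + 1)"
  using cg_succ[of i] cg_nat[of j "succ_mod k i"] cg_sym cg_trans by (metis succ_mod_le)

definition act :: "nat list \<Rightarrow> int \<Rightarrow> int" where
  "act x = foldr (\<lambda>i f. sg (int i) \<circ> f) x id"

lemma act_simps [simp]: "act [] = id" "act (i # x) = sg (int i) \<circ> act x"
  by (simp_all add: act_def)

lemma act_append: "act (x @ y) = act x \<circ> act y"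
  by (induction x) auto

lemma act_snoc: "act (x @ [i]) = act x \<circ> sg (int i)"
  by (simp add: act_append)

lemma act_period: "act x (z + c * N) = act x z + c * N"
  by (induction x) (auto simp: sg_period)

lemma act_rev: "act x \<circ> act (rev x) = id" "act (rev x) \<circ> act x = id"
proof -
  have "act x \<circ> act (rev x) = id" for x
  proof (induction x)
    case (Cons i x)
    have "act (i # x) \<circ> act (rev (i # x)) = sg (int i) \<circ> (act x \<circ> act (rev x)) \<circ> sg (int i)"
      by (simp add: act_snoc o_assoc)
    also have "\<dots> = id" unfolding Cons.IH by simp
    finally show ?case .
  qed simp
  from this[of x] this[of "rev x"] show "act x \<circ> act (rev x) = id" "act (rev x) \<circ> act x = id"
    by auto
qed

lemma bij_act: "bij (act x)"
  using act_rev o_bij by blast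

lemma inv_act: "pinv (act x) = act (rev x)"
  using act_rev inv_unique_comp by blast

lemma act_coxeter_eq: "coxeter_eq k x y \<Longrightarrow> act x = act y"
proof (induction rule: coxeter_eq.induct)
  case (relator u v x y)
  from relator(1) have "act u = act v"
    unfolding coxeter_relators_def
  proof (elim UnE CollectE exE conjE)
    fix i assume "(u, v) = ([i, succ_mod k i, i], [succ_mod k i, i, succ_mod k i])"
      "i \<le> k" "2 \<le> k"
    then show ?thesis using sg_braid[of "int i"] sg_cong[OF cg_succ[of i]]
      by (auto simp: N_def)
  next
    fix i j assume "(u, v) = ([i, j], [j, i])" "i \<le> k" "j \<le> k" "i \<noteq> j" "j \<noteq> succ_mod k i" "i \<noteq> succ_mod k j"
    then show ?thesis using sg_commute[of "int i" "int j"] cg_nat[of i j]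
      cg_succ_iff[of i j] cg_succ_iff[of j i] by auto
  qed auto
  then show ?case by (simp add: act_append)
qed auto

section \<open>Word calculus and faithfulness of the action\<close>

lemma coxeter_eq_words: "coxeter_eq k x y \<Longrightarrow> x \<in> coxeter_words k \<and> y \<in> coxeter_words k"
  by (induction rule: coxeter_eq.induct) (auto simp: coxeter_relators_def)

lemma coxeter_eq_append:
  assumes "coxeter_eq k x y" "u \<in> coxeter_words k" "v \<in> coxeter_words k"
  shows "coxeter_eq k (u @ x @ v) (u @ y @ v)"
  using assms
proof (induction rule: coxeter_eq.induct)
  case (relator a b x y)
  then show ?case using coxeter_eq.relator[of a b k "u @ x" "y @ v"] by simp
next
  case (refl x) then show ?case by (auto intro!: coxeter_eq.refl)
qed (blast intro: coxeter_eq.sym coxeter_eq.trans)+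

lemma coxeter_eq_Cons: "coxeter_eq k x y \<Longrightarrow> i \<le> k \<Longrightarrow> coxeter_eq k (i # x) (i # y)"
  using coxeter_eq_append[of x y "[i]" "[]"] by simp

lemma coxeter_eq_prefix:
  assumes "(u, v) \<in> coxeter_relators k" "y \<in> coxeter_words k"
  shows "coxeter_eq k (u @ y) (v @ y)"
  using coxeter_eq.relator[OF assms(1), of "[]"] assms(2) by simp

lemma coxeter_eq_square: "i \<le> k \<Longrightarrow> y \<in> coxeter_words k \<Longrightarrow> coxeter_eq k (i # i # y) y"
  using coxeter_eq_prefix[of "[i, i]" "[]" y] by (auto simp: coxeter_relators_def)

lemma coxeter_eq_swap:
  assumes "i \<le> k" "j \<le> k" "i \<noteq> j" "j \<noteq> succ_mod k i" "i \<noteq> succ_mod k j" "y \<in> coxeter_words k"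
  shows "coxeter_eq k (i # j # y) (j # i # y)"
  using coxeter_eq_prefix[of "[i, j]" "[j, i]" y] assms by (auto simp: coxeter_relators_def)

lemma coxeter_eq_braid:
  assumes "i \<le> k" "2 \<le> k" "y \<in> coxeter_words k"
  shows "coxeter_eq k (i # succ_mod k i # i # y) (succ_mod k i # i # succ_mod k i # y)"
  using coxeter_eq_prefix[of "[i, succ_mod k i, i]" "[succ_mod k i, i, succ_mod k i]" y] assms
  by (auto simp: coxeter_relators_def)

text \<open>An elementary substitute for the rank two argument of Coxeter group theory: the first letter \<open>j\<close>
  of \<open>x\<close> either commutes with \<open>i\<close> or involves just one further point of the line, and the relative
  position of the three preimages decides which relation to apply.\<close>

lemma presentation_exchange:
  assumes "x \<in> coxeter_words k" "i \<le> k" "cg z (int i)" "act (rev x) z > act (rev x) (z + 1)"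
  shows "\<exists>y. coxeter_eq k x (i # y) \<and> length y < length x"
  using assms
proof (induction "length x" arbitrary: x i z rule: less_induct)
  case less
  have IH: "\<exists>y. coxeter_eq k x' (i # y) \<and> length y < length x' \<and> y \<in> coxeter_words k"
    if "length x' < length x" "x' \<in> coxeter_words k" "i \<le> k" "cg z (int i)"
      "act (rev x') z > act (rev x') (z + 1)" for x' i z
    using less.hyps[OF that] coxeter_eq_words by fastforce
  show ?case
  proof (cases x)
    case Nil then show ?thesis using less.prems by simp
  next
    case (Cons j x')
    have w: "j \<le> k" "x' \<in> coxeter_words k" "length x' < length x" using less.prems Cons by auto
    define p where "p = act (rev x')"
    have px: "act (rev x) y = p (sg (int j) y)" for y by (simp add: Cons act_snoc p_def)
    have gt: "p (sg (int j) z) > p (sg (int j) (z + 1))" using less.prems(4) px by simp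
    have per: "p (y + c * N) = p y + c * N" for y c by (simp add: p_def act_period)
    \<comment> \<open>If \<open>x'\<close> can be rewritten to start with \<open>j\<close>, then
      \<open>j # x'\<close> cancels to a shorter word with the same action, and the induction
      hypothesis applies to it.\<close>
    have cancel: ?thesis
      if y: "coxeter_eq k x' (j # y)" "length y < length x'" "y \<in> coxeter_words k" for y
    proof -
      have "coxeter_eq k x (j # j # y)" using y w Cons by (simp add: coxeter_eq_Cons)
      then have e: "coxeter_eq k x y" using coxeter_eq_square[OF w(1) y(3)] coxeter_eq.trans by blast
      have "act (rev y) = act (rev x)" using act_coxeter_eq[OF e] inv_act by metis
      then obtain y' where "coxeter_eq k y (i # y')" "length y' < length y"
        using IH[of y i z] y w less.prems(2-4) by auto
      then show ?thesis using e coxeter_eq.trans y w by fastforce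
    qed
    consider (same) "j = i" | (two) "j \<noteq> i" "N = 2"
      | (right) "N \<ge> 3" "j = succ_mod k i" "j \<noteq> i" | (left) "N \<ge> 3" "i = succ_mod k j" "j \<noteq> i"
      | (comm) "j \<noteq> i" "j \<noteq> succ_mod k i" "i \<noteq> succ_mod k j"
      using N_ge2 by fastforce
    then show ?thesis
    proof cases
      case same
      then show ?thesis using Cons less.prems(1) coxeter_eq.refl by (metis length_Cons lessI)
    next
      case comm
      note c = less.prems(3) cg_add[OF less.prems(3), of 1]
      have a: "\<not> cg (int i) (int j)" "\<not> cg (int j) (int i + 1)" "\<not> cg (int i) (int j + 1)"
        using comm cg_nat[of i j] cg_succ_iff[of i j] cg_succ_iff[of j i] less.prems(2) w by auto
      then have "\<not> cg (int i + 1) (int j)" "\<not> cg (int i + 1) (int j + 1)"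
        using cg_sym by (blast, simp add: cg_def)
      with a have n: "\<not> cg z (int j)" "\<not> cg z (int j + 1)" "\<not> cg (z+1) (int j)" "\<not> cg (z+1) (int j+1)"
        by (auto simp: cg_eq(1)[OF c(1)] cg_eq(1)[OF c(2)])
      then have "p z > p (z+1)" using gt by (simp add: sg_fix)
      then obtain y where y: "coxeter_eq k x' (i # y)" "length y < length x'" "y \<in> coxeter_words k"
        using IH[OF w(3,2) less.prems(2,3)] by (auto simp: p_def)
      have "coxeter_eq k x (j # i # y)" using y w Cons by (simp add: coxeter_eq_Cons)
      moreover have "coxeter_eq k (j # i # y) (i # j # y)"
        using coxeter_eq_swap comm w less.prems y by metis
      ultimately have "coxeter_eq k x (i # j # y)" by (rule coxeter_eq.trans)
      then show ?thesis using y Cons by auto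
    next
      \<comment> \<open>The infinite dihedral group has no braid relation; instead, period
        \<open>2\<close> turns the inversion of \<open>x\<close> at \<open>z\<close> into one of
        \<open>p\<close> at \<open>z + 1\<close>, so that \<open>j\<close> cancels.\<close>
      case two
      have k1: "k = 1" using two by (simp add: N_def)
      then have "j = succ_mod k i" using two less.prems(2) w(1)
        by (auto simp: succ_mod_def le_Suc_eq)
      then have cj: "cg (z+1) (int j)" using cg_succ[OF less.prems(2)] cg_add[OF less.prems(3), of 1] cg_sym cg_trans
        by blast
      moreover have "cg (z+1-2) (int j)" using cj two(2) cg_mult(1)[of "z+1" "-1" "int j"] by simp
      ultimately have "sg (int j) (z+1) = z+2" "sg (int j) z = z - 1"
        using sg_up[of "z+1" "int j"] sg_down[of z "int j"] cg_add[of "z-1" "int j" 1] by auto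
      then have "p (z-1) > p (z+2)" using gt by simp
      moreover have "p (z+2) = p z + 2" "p (z+1) = p (z-1) + 2"
        using per[of z 1] per[of "z-1" 1] two(2) by (auto simp: add.commute)
      ultimately have "p (z+1) > p (z+1+1)" by (simp add: add.commute)
      then obtain y where y: "coxeter_eq k x' (j # y)" "length y < length x'" "y \<in> coxeter_words k"
        using IH[OF w(3,2,1) cj] by (auto simp: p_def)
      from cancel[OF y] show ?thesis .
    next
      case right
      have cj: "cg (z+1) (int j)"
        using right(2) cg_succ[OF less.prems(2)] cg_add[OF less.prems(3), of 1] cg_sym cg_trans by blast
      have "\<not> cg z (int j)" "\<not> cg z (int j + 1)"
        using cg_off[OF cj, of "-1"] cg_off[OF cg_add[OF cj, of 1], of "-2"] right(1) by auto
      then have "p z > p (z+2)" using gt cj by (simp add: sg_up sg_fix add.commute)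
      \<comment> \<open>Either \<open>j\<close> cancels (second case), or \<open>x'\<close> starts
        with \<open>i\<close> and an inversion at \<open>j\<close> remains after its removal, so
        \<open>x\<close> starts with \<open>j i j\<close> and the braid relation brings
        \<open>i\<close> to the front.\<close>
      then consider "p z > p (z+1)" | "p (z+1) > p (z+2)" by linarith
      then show ?thesis
      proof cases
        case 1
        obtain y where y: "coxeter_eq k x' (i # y)" "length y < length x'" "y \<in> coxeter_words k"
          using IH[OF w(3,2) less.prems(2,3)] 1 by (auto simp: p_def)
        have "act (rev y) v = p (sg (int i) v)" for v
        proof -
          have "p = act (rev (i # y))" unfolding p_def using act_coxeter_eq[OF y(1)] inv_act by metis
          then show ?thesis by (simp add: act_snoc)
        qed
        moreover have "sg (int i) (z+1) = z" using sg_down[of "z+1"] cg_add[OF less.prems(3)] by simp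
        moreover have "sg (int i) (z+2) = z+2"
          using sg_fix[of "z+2" "int i"] cg_off[OF less.prems(3), of 2]
             cg_off[OF cg_add[OF less.prems(3), of 1], of 1] right(1) by (auto simp: add.commute)
        ultimately have "act (rev y) (z+1) > act (rev y) (z+1+1)"
          using \<open>p z > p (z+2)\<close> by (simp add: add.commute)
        then obtain y' where y': "coxeter_eq k y (j # y')" "length y' < length y" "y' \<in> coxeter_words k"
          using IH[of y j "z+1"] y w cj by auto
        have "coxeter_eq k x (j # i # y)" using y w Cons by (simp add: coxeter_eq_Cons)
        moreover have "coxeter_eq k (j # i # y) (j # i # j # y')"
          using y' w less.prems(2) by (simp add: coxeter_eq_Cons)
        moreover have "coxeter_eq k (j # i # j # y') (i # j # i # y')"
          using coxeter_eq.sym[OF coxeter_eq_braid[of i y']] less.prems(2) y' right by (simp add: N_def)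
        ultimately have "coxeter_eq k x (i # j # i # y')" using coxeter_eq.trans by blast
        then show ?thesis using y y' Cons by (intro exI[of _ "j # i # y'"]) auto
      next
        case 2
        obtain y where y: "coxeter_eq k x' (j # y)" "length y < length x'" "y \<in> coxeter_words k"
          using IH[OF w(3,2,1) cj] 2 by (auto simp: p_def add.commute)
        from cancel[OF y] show ?thesis .
      qed
    next
      case left
      have cj1: "cg z (int j + 1)"
        using left(2) cg_succ[OF w(1)] less.prems(3) cg_sym cg_trans by blast
      then have cj: "cg (z-1) (int j)" using cg_add[of z "int j + 1" "-1"] by simp
      have "\<not> cg (z+1) (int j)" "\<not> cg (z+1) (int j + 1)"
        using cg_off[OF cj, of 2] cg_off[OF cj1, of 1] left(1) by (auto simp: add.commute)
      then have gt2: "p (z-1) > p (z+1)" using gt cj1 by (simp add: sg_down sg_fix)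
      then consider "p z > p (z+1)" | "p (z-1) > p z" by linarith
      then show ?thesis
      proof cases
        case 1
        obtain y where y: "coxeter_eq k x' (i # y)" "length y < length x'" "y \<in> coxeter_words k"
          using IH[OF w(3,2) less.prems(2,3)] 1 by (auto simp: p_def)
        have "act (rev y) v = p (sg (int i) v)" for v
        proof -
          have "p = act (rev (i # y))" unfolding p_def using act_coxeter_eq[OF y(1)] inv_act by metis
          then show ?thesis by (simp add: act_snoc)
        qed
        moreover have "sg (int i) z = z+1" using sg_up less.prems(3) by simp
        moreover have "sg (int i) (z-1) = z-1"
          using sg_fix[of "z-1" "int i"] cg_off[OF less.prems(3), of "-1"]
             cg_off[OF cg_add[OF less.prems(3), of 1], of "-2"] left(1) by (auto simp: add.commute)
        ultimately have "act (rev y) (z-1) > act (rev y) (z-1+1)" using gt2 by simp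
        then obtain y' where y': "coxeter_eq k y (j # y')" "length y' < length y" "y' \<in> coxeter_words k"
          using IH[of y j "z-1"] y w cj by auto
        have "coxeter_eq k x (j # i # y)" using y w Cons by (simp add: coxeter_eq_Cons)
        moreover have "coxeter_eq k (j # i # y) (j # i # j # y')"
          using y' w less.prems(2) by (simp add: coxeter_eq_Cons)
        moreover have "coxeter_eq k (j # i # j # y') (i # j # i # y')"
          using coxeter_eq_braid[of j y'] w y' left by (simp add: N_def)
        ultimately have "coxeter_eq k x (i # j # i # y')" using coxeter_eq.trans by blast
        then show ?thesis using y y' Cons by (intro exI[of _ "j # i # y'"]) auto
      next
        case 2
        obtain y where y: "coxeter_eq k x' (j # y)" "length y < length x'" "y \<in> coxeter_words k"
          using IH[OF w(3,2,1) cj] 2 by (auto simp: p_def add.commute)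
        from cancel[OF y] show ?thesis .
      qed
    qed
  qed
qed

text \<open>If \<open>i # x'\<close> acts trivially, then \<open>x'\<close> acts as the generator
  \<open>i\<close>, which inverts \<open>i\<close> and \<open>i + 1\<close>. The exchange moves a
  second \<open>i\<close> to the front of \<open>x'\<close>, and the two cancel.\<close>

lemma act_faithful_Nil:
  assumes "x \<in> coxeter_words k" "act x = id" shows "coxeter_eq k x []"
  using assms
proof (induction "length x" arbitrary: x rule: less_induct)
  case less
  show ?case
  proof (cases x)
    case Nil then show ?thesis by (simp add: coxeter_eq.refl)
  next
    case (Cons i x')
    then have w: "i \<le> k" "x' \<in> coxeter_words k" using less.prems by auto
    have "act x' = sg (int i)" using less.prems(2) Cons by (metis act_simps(2) sg_comp_sg2 comp_id)
    then have "act (rev x') = sg (int i)" using inv_act[of x'] by simp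
    then have "act (rev x') (int i) > act (rev x') (int i + 1)"
      using sg_up[of "int i" "int i"] sg_down[of "int i + 1" "int i"] by simp
    then obtain y where y: "coxeter_eq k x' (i # y)" "length y < length x'"
      using presentation_exchange[of x' i "int i"] w by auto
    have yw: "y \<in> coxeter_words k" using coxeter_eq_words[OF y(1)] by auto
    have "coxeter_eq k x (i # i # y)" using y w Cons by (simp add: coxeter_eq_Cons)
    then have e: "coxeter_eq k x y" using coxeter_eq_square[OF w(1) yw] coxeter_eq.trans by blast
    then have "coxeter_eq k y []"
      using less.hyps[of y] y yw Cons act_coxeter_eq[OF e] less.prems by auto
    with e show ?thesis by (rule coxeter_eq.trans)
  qed
qed

lemma coxeter_eq_rev: "x \<in> coxeter_words k \<Longrightarrow> coxeter_eq k (x @ rev x) []"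
proof (induction x)
  case Nil then show ?case by (simp add: coxeter_eq.refl)
next
  case (Cons i x)
  then have "coxeter_eq k ([i] @ (x @ rev x) @ [i]) ([i] @ [] @ [i])"
    by (intro coxeter_eq_append) auto
  moreover have "coxeter_eq k [i, i] []" using coxeter_eq_square[of i "[]"] Cons by simp
  ultimately show ?case using coxeter_eq.trans by fastforce
qed

lemma act_faithful:
  assumes "x \<in> coxeter_words k" "y \<in> coxeter_words k"
  shows "act x = act y \<longleftrightarrow> coxeter_eq k x y"
proof
  assume a: "act x = act y"
  have w: "rev x \<in> coxeter_words k" "rev y \<in> coxeter_words k" using assms by auto
  have "act (x @ rev y) = id" using a act_rev by (simp add: act_append)
  then have "coxeter_eq k (x @ rev y) []" using act_faithful_Nil assms w by simp
  then have "coxeter_eq k ([] @ (x @ rev y) @ y) ([] @ [] @ y)"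
    using assms by (intro coxeter_eq_append) auto
  moreover have "coxeter_eq k (x @ (rev y @ y) @ []) (x @ [] @ [])"
    using coxeter_eq_rev[OF w(2)] assms by (intro coxeter_eq_append) auto
  ultimately show "coxeter_eq k x y" by simp (rule coxeter_eq.trans[OF coxeter_eq.sym])
qed (rule act_coxeter_eq)

section \<open>Length and strong order\<close>

definition aff :: "(int \<Rightarrow> int) set" where
  "aff = act ` coxeter_words k"

text \<open>By faithfulness these are precisely the word classes, so group elements can be handled
  as functions.\<close>

definition words_of :: "(int \<Rightarrow> int) \<Rightarrow> affine_perm" where
  "words_of f = {x \<in> coxeter_words k. act x = f}"

lemma act_in_aff [simp]: "x \<in> coxeter_words k \<Longrightarrow> act x \<in> aff"
  by (simp add: aff_def)

lemma aff_E:
  assumes "f \<in> aff" obtains x where "x \<in> coxeter_words k" "act x = f"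
  using assms by (auto simp: aff_def)

lemma word_class_act:
  assumes "x \<in> coxeter_words k" shows "word_class k x = words_of (act x)"
proof -
  have "coxeter_eq k x y \<longleftrightarrow> y \<in> coxeter_words k \<and> act y = act x" for y
    using act_faithful[OF assms, of y] coxeter_eq_words[of x y] by metis
  then show ?thesis by (simp add: word_class_def words_of_def)
qed

lemma words_of_inj: "f \<in> aff \<Longrightarrow> g \<in> aff \<Longrightarrow> words_of f = words_of g \<longleftrightarrow> f = g"
  unfolding words_of_def by (auto elim!: aff_E)

lemma id_aff [simp]: "id \<in> aff"
  using act_in_aff[of "[]"] by simp

lemma comp_aff [simp]: "f \<in> aff \<Longrightarrow> g \<in> aff \<Longrightarrow> f \<circ> g \<in> aff"
  by (elim aff_E) (metis act_append act_in_aff append_in_lists_conv)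

lemma pinv_aff [simp]: "f \<in> aff \<Longrightarrow> pinv f \<in> aff"
  by (elim aff_E) (metis act_in_aff inv_act lists_eq_set mem_Collect_eq set_rev)

definition letter :: "int \<Rightarrow> nat" where
  "letter z = nat (z mod N)"

lemma letter_le [simp]: "letter z \<le> k"
  using N_ge2 pos_mod_bound[of N z] by (simp add: letter_def N_def nat_le_iff)

lemma cg_letter: "cg z (int (letter z))"
  using N_ge2 by (simp add: letter_def cg_def)

lemma letter_cong: "cg y z \<longleftrightarrow> letter y = letter z"
  using cg_letter cg_nat[of "letter y" "letter z"] cg_sym cg_trans letter_le by metis

lemma letter_int [simp]: "i \<le> k \<Longrightarrow> letter (int i) = i"
  by (simp add: letter_def N_def)

lemma sg_letter: "sg (int (letter z)) = sg z"
  using sg_cong cg_letter by metis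

lemma sg_aff [simp]: "sg z \<in> aff"
  using act_in_aff[of "[letter z]"] by (simp add: sg_letter)

lemma bij_aff: "f \<in> aff \<Longrightarrow> bij f"
  using bij_act by (auto elim: aff_E)

lemma aff_eq_iff [simp]: "f \<in> aff \<Longrightarrow> f x = f y \<longleftrightarrow> x = y"
  using bij_aff bij_is_inj injD by metis

lemma pinv_comp [simp]:
  "f \<in> aff \<Longrightarrow> pinv f \<circ> f = id" "f \<in> aff \<Longrightarrow> f \<circ> pinv f = id"
  "f \<in> aff \<Longrightarrow> pinv f (f x) = x" "f \<in> aff \<Longrightarrow> f (pinv f x) = x"
  using bij_aff[of f] by (auto simp: bij_is_inj bij_is_surj surj_f_inv_f)

lemma pinv_pinv [simp]: "f \<in> aff \<Longrightarrow> pinv (pinv f) = f"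
  using bij_aff inv_inv_eq by blast

lemma pinv_o: "f \<in> aff \<Longrightarrow> g \<in> aff \<Longrightarrow> pinv (f \<circ> g) = pinv g \<circ> pinv f"
  using bij_aff o_inv_distrib by blast

lemma aff_period: "f \<in> aff \<Longrightarrow> f (z + c * N) = f z + c * N"
  using act_period by (auto elim: aff_E)

lemma aff_cg [simp]:
  assumes "f \<in> aff" shows "cg (f x) (f y) \<longleftrightarrow> cg x y"
proof -
  have *: "cg (g x) (g y)" if "g \<in> aff" "cg x y" for g x y
    using cg_E[OF that(2)] aff_period[OF that(1)] by (metis cg_mult(1) cg_refl)
  show ?thesis using *[of f x y] *[of "pinv f" "f x" "f y"] assms by auto
qed

lemma carrier_affine_sym: "carrier (affine_sym k) = words_of ` aff"
  by (auto simp: affine_sym_def aff_def word_class_act)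

lemma mult_words_of:
  assumes "f \<in> aff" "g \<in> aff"
  shows "words_of f \<otimes>\<^bsub>affine_sym k\<^esub> words_of g = words_of (f \<circ> g)"
proof -
  have "word_class k (x @ y) = words_of (f \<circ> g)" if "x \<in> words_of f" "y \<in> words_of g" for x y
    using that by (auto simp: words_of_def word_class_act act_append)
  moreover have "words_of f \<noteq> {}" "words_of g \<noteq> {}" using assms by (auto simp: words_of_def elim!: aff_E)
  ultimately show ?thesis by (auto simp: affine_sym_def)
qed

lemma one_words_of: "\<one>\<^bsub>affine_sym k\<^esub> = words_of id"
  by (simp add: affine_sym_def word_class_act)

lemma group_affine_sym: "group (affine_sym k)"
proof (rule groupI)
  fix x assume "x \<in> carrier (affine_sym k)"
  then obtain f where f: "f \<in> aff" "x = words_of f" by (auto simp: carrier_affine_sym)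
  then show "\<exists>y\<in>carrier (affine_sym k). y \<otimes>\<^bsub>affine_sym k\<^esub> x = \<one>\<^bsub>affine_sym k\<^esub>"
    by (intro bexI[of _ "words_of (pinv f)"]) (auto simp: carrier_affine_sym mult_words_of one_words_of)
qed (auto simp: carrier_affine_sym mult_words_of one_words_of o_assoc)

lemma inv_words_of: "f \<in> aff \<Longrightarrow> inv\<^bsub>affine_sym k\<^esub> words_of f = words_of (pinv f)"
  by (rule group.inv_equality[OF group_affine_sym]) (auto simp: carrier_affine_sym mult_words_of one_words_of)

lemma simple_refl_words_of: "i \<le> k \<Longrightarrow> simple_refl k i = words_of (sg (int i))"
  by (simp add: word_class_act)

definition len :: "(int \<Rightarrow> int) \<Rightarrow> nat" where
  "len f = cox_length (words_of f)"

lemma reduced_exists: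
  assumes "f \<in> aff" shows "\<exists>x\<in>coxeter_words k. act x = f \<and> length x = len f"
proof -
  from assms obtain x where "x \<in> coxeter_words k" "act x = f" by (rule aff_E)
  then have "\<exists>m. \<exists>x\<in>words_of f. length x = m" by (auto simp: words_of_def)
  then have "\<exists>x\<in>words_of f. length x = len f" unfolding len_def cox_length_def by (rule LeastI_ex)
  then show ?thesis by (auto simp: words_of_def)
qed

lemma reduced_E:
  assumes "f \<in> aff" obtains x where "x \<in> coxeter_words k" "act x = f" "length x = len f"
  using reduced_exists[OF assms] by blast

lemma len_act_le: "x \<in> coxeter_words k \<Longrightarrow> len (act x) \<le> length x"
  unfolding len_def cox_length_def by (rule Least_le) (auto simp: words_of_def)

lemma len_id [simp]: "len id = 0"
  using len_act_le[of "[]"] by simp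

lemma len_comp_le:
  assumes "f \<in> aff" "g \<in> aff" shows "len (f \<circ> g) \<le> len f + len g"
proof -
  obtain x where "x \<in> coxeter_words k" "act x = f" "length x = len f" using assms(1) by (rule reduced_E)
  moreover obtain y where "y \<in> coxeter_words k" "act y = g" "length y = len g" using assms(2) by (rule reduced_E)
  ultimately show ?thesis using len_act_le[of "x @ y"] by (auto simp: act_append)
qed

lemma len_sg_le: "len (sg z) \<le> 1"
  using len_act_le[of "[letter z]"] by (simp add: sg_letter)

lemma len_pinv [simp]:
  assumes "f \<in> aff" shows "len (pinv f) = len f"
proof -
  have *: "len (pinv g) \<le> len g" if g: "g \<in> aff" for g
  proof -
    obtain x where "x \<in> coxeter_words k" "act x = g" "length x = len g"
      using g by (rule reduced_E)
    then show ?thesis using len_act_le[of "rev x"] inv_act[of x] by (auto simp: in_lists_conv_set)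
  qed
  show ?thesis using *[OF assms] *[of "pinv f"] assms by simp
qed

lemma len_desc_aux:
  assumes "f \<in> aff" "pinv f z > pinv f (z + 1)" shows "len (sg z \<circ> f) < len f"
proof -
  obtain x where x: "x \<in> coxeter_words k" "act x = f" "length x = len f"
    using assms(1) by (rule reduced_E)
  have "act (rev x) z > act (rev x) (z + 1)" using assms(2) x inv_act by metis
  then obtain y where y: "coxeter_eq k x (letter z # y)" "length y < length x"
    using presentation_exchange[OF x(1) letter_le cg_letter] by blast
  have "f = sg z \<circ> act y" using act_coxeter_eq[OF y(1)] x by (simp add: sg_letter)
  then have "sg z \<circ> f = act y" by simp
  then show ?thesis using y x len_act_le[of y] coxeter_eq_words[OF y(1)] by simp
qed

text \<open>If \<open>pinv f\<close> increases at \<open>z\<close>, then the inverse of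
  \<open>sg z \<circ> f\<close> decreases there, and the previous estimate for that element shows
  that the length went up.\<close>

lemma len_down:
  assumes "f \<in> aff" shows "len (sg z \<circ> f) < len f \<longleftrightarrow> pinv f z > pinv f (z + 1)"
proof
  assume a: "len (sg z \<circ> f) < len f"
  show "pinv f z > pinv f (z + 1)"
  proof (rule ccontr)
    assume "\<not> pinv f (z + 1) < pinv f z"
    moreover have "pinv f z \<noteq> pinv f (z + 1)" using assms by simp
    ultimately have "pinv f z < pinv f (z + 1)" by simp
    then have "pinv (sg z \<circ> f) (z + 1) < pinv (sg z \<circ> f) z"
      using assms by (simp add: pinv_o sg_up sg_down)
    from len_desc_aux[OF _ this] assms a show False by simp
  qed
qed (rule len_desc_aux[OF assms])

lemma len_up:
  assumes "f \<in> aff" shows "len f < len (sg z \<circ> f) \<longleftrightarrow> pinv f z < pinv f (z + 1)"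
  using len_down[of "sg z \<circ> f" z] assms by (simp add: pinv_o sg_up sg_down)

lemma len_sg_neq: "f \<in> aff \<Longrightarrow> len (sg z \<circ> f) \<noteq> len f"
  using len_up[of f z] len_down[of f z] aff_eq_iff[of "pinv f" z "z+1"] by auto

lemma len_sg_cases:
  assumes "f \<in> aff" shows "len (sg z \<circ> f) = len f + 1 \<or> len f = len (sg z \<circ> f) + 1"
proof -
  have "len (sg z \<circ> f) \<le> len f + 1" using len_comp_le[of "sg z" f] len_sg_le[of z] assms by simp
  moreover have "len f \<le> len (sg z \<circ> f) + 1"
    using len_comp_le[of "sg z" "sg z \<circ> f"] len_sg_le[of z] assms by simp
  ultimately show ?thesis using len_sg_neq[OF assms, of z] by linarith
qed

lemma len_up_right:
  assumes "f \<in> aff" shows "len f < len (f \<circ> sg z) \<longleftrightarrow> f z < f (z + 1)"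
  using len_up[of "pinv f" z] len_pinv[of "f \<circ> sg z"] assms by (simp add: pinv_o)

lemma len_right_cases:
  assumes "f \<in> aff" shows "len (f \<circ> sg z) = len f + 1 \<or> len f = len (f \<circ> sg z) + 1"
proof -
  have e: "len (f \<circ> sg z) = len (sg z \<circ> pinv f)" using len_pinv[of "f \<circ> sg z"] assms by (simp add: pinv_o)
  show ?thesis using len_sg_cases[of "pinv f" z] assms e by simp
qed

section \<open>Reflections and the strong exchange property\<close>

text \<open>For incongruent \<open>a\<close> and \<open>b\<close> this is the periodic
  transposition; for congruent ones it merely shifts one residue class.\<close>

definition transp :: "int \<Rightarrow> int \<Rightarrow> int \<Rightarrow> int" where
  "transp a b z = (if cg z a then z + (b - a) else if cg z b then z - (b - a) else z)"

lemma transp_sym: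
  assumes "\<not> cg a b" shows "transp a b = transp b a"
proof -
  have "\<not> (cg z a \<and> cg z b)" for z using assms cg_sym cg_trans by blast
  then show ?thesis by (intro ext) (auto simp: transp_def)
qed

lemma sg_transp: "sg z = transp z (z + 1)"
  by (rule ext) (simp add: sg_def transp_def)

lemma cg_Suc: "\<not> cg z (z + 1)"
  using cg_off(2)[of z z 1] N_ge2 by simp

lemma transp_conj:
  assumes "v \<in> aff" shows "v \<circ> transp a b = transp (v a) (v b) \<circ> v"
proof
  fix z
  have shift: "v (z + (c - d)) = v z + (v c - v d)" if zd: "cg z d" for z c d
  proof -
    obtain m where m: "z = d + m * N" using zd by (rule cg_E)
    then have "z + (c - d) = c + m * N" by simp
    then have "v (z + (c - d)) = v c + m * N" "v z = v d + m * N" using m aff_period[OF assms] by metis+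
    then show ?thesis by simp
  qed
  show "(v \<circ> transp a b) z = (transp (v a) (v b) \<circ> v) z"
    using shift[of z a b] shift[of z b a] assms by (auto simp: transp_def algebra_simps)
qed

definition is_refl :: "(int \<Rightarrow> int) \<Rightarrow> bool" where
  "is_refl t \<longleftrightarrow> (\<exists>v\<in>aff. \<exists>z. t = v \<circ> sg z \<circ> pinv v)"

lemma is_refl_aff [simp]: "is_refl t \<Longrightarrow> t \<in> aff"
  by (auto simp: is_refl_def)

lemma is_refl_conj:
  assumes "is_refl t" "g \<in> aff" shows "is_refl (g \<circ> t \<circ> pinv g)"
proof -
  from assms(1) obtain v z where v: "v \<in> aff" "t = v \<circ> sg z \<circ> pinv v" by (auto simp: is_refl_def)
  have "g \<circ> t \<circ> pinv g = (g \<circ> v) \<circ> sg z \<circ> pinv (g \<circ> v)"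
    using v assms(2) by (simp add: pinv_o o_assoc)
  then show ?thesis using v assms unfolding is_refl_def by (metis comp_aff)
qed

lemma is_refl_sg: "is_refl (sg z)"
  unfolding is_refl_def by (metis id_aff comp_id id_comp inv_id)

lemma is_refl_transp:
  assumes "is_refl t" obtains a b where "a < b" "\<not> cg a b" "t = transp a b"
proof -
  from assms obtain v z where v: "v \<in> aff" "t = v \<circ> sg z \<circ> pinv v" by (auto simp: is_refl_def)
  have "t = transp (v z) (v (z + 1)) \<circ> (v \<circ> pinv v)"
    using v transp_conj[of v z "z + 1"] by (metis comp_assoc sg_transp)
  then have t: "t = transp (v z) (v (z + 1))" using v by simp
  have "\<not> cg (v z) (v (z + 1))" using v cg_Suc by simp
  then show ?thesis using that[of "v z" "v (z+1)"] that[of "v (z+1)" "v z"] t transp_sym cg_sym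
    by (metis cg_refl linorder_neqE_linordered_idom)
qed

lemma is_refl_square: "is_refl t \<Longrightarrow> t \<circ> t = id"
proof -
  assume "is_refl t"
  then obtain v z where v: "v \<in> aff" "t = v \<circ> sg z \<circ> pinv v" by (auto simp: is_refl_def)
  have "t \<circ> t = v \<circ> (sg z \<circ> ((pinv v \<circ> v) \<circ> (sg z \<circ> pinv v)))" using v(2) by (simp add: o_assoc)
  also have "\<dots> = v \<circ> pinv v" using v(1) by (simp del: comp_assoc)
  finally show ?thesis using v(1) by simp
qed

lemma pinv_is_refl [simp]: "is_refl t \<Longrightarrow> pinv t = t"
  using inv_unique_comp is_refl_square by blast

text \<open>Being injective and moving points by at most one, a generator can reverse
  \<open>a < b\<close> only by exchanging them as neighbours.\<close>

lemma sg_mono: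
  assumes "a < b" "\<not> (cg a i \<and> b = a + 1)" shows "sg i a < sg i b"
proof -
  have 1: "a \<noteq> b - 1" if "cg b (i + 1)" "\<not> cg a i" using cg_add[OF that(1), of "-1"] that(2) by auto
  have 2: "b \<noteq> a + 1" if "cg a i" using assms that by simp
  have 3: "b \<noteq> a + 2" if "cg a i" "cg b (i + 1)"
    using cg_off(1)[OF cg_add[OF that(1), of 1], of 1] that N_ge2 by (auto simp: add.commute)
  show ?thesis using 1 2 3 assms(1) by (auto simp: sg_def)
qed

text \<open>The pair \<open>a < b\<close> is carried through the letters of the word; it gets
  inverted at a letter that exchanges it as neighbours, and deleting that letter multiplies by the
  reflection.\<close>

lemma strong_exchange:
  assumes "x \<in> coxeter_words k" "a < b" "\<not> cg a b" "pinv (act x) a > pinv (act x) b"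
  shows "\<exists>y\<in>coxeter_words k. length y < length x \<and> act y = transp a b \<circ> act x"
  using assms
proof (induction x arbitrary: a b rule: list.induct)
  case Nil then show ?case by simp
next
  case (Cons i x)
  have w: "x \<in> coxeter_words k" "i \<le> k" using Cons.prems(1) by auto
  have p: "pinv (act (i # x)) = pinv (act x) \<circ> sg (int i)"
    using w by (simp add: pinv_o)
  show ?case
  proof (cases "cg a (int i) \<and> b = a + 1")
    case True
    then have "transp a b = sg (int i)" using sg_transp sg_cong by metis
    then show ?thesis using w by (intro bexI[of _ x]) auto
  next
    case False
    then have "sg (int i) a < sg (int i) b" using sg_mono Cons.prems by blast
    then obtain y where y: "y \<in> coxeter_words k" "length y < length x"
      "act y = transp (sg (int i) a) (sg (int i) b) \<circ> act x"
      using Cons.IH[OF w(1), of "sg (int i) a" "sg (int i) b"] Cons.prems(2-4) unfolding p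
      by (auto simp del: act_simps simp: comp_def)
    have "act (i # y) = sg (int i) \<circ> transp (sg (int i) a) (sg (int i) b) \<circ> act x"
      using y by (simp add: o_assoc)
    also have "\<dots> = transp a b \<circ> act (i # x)" by (simp add: transp_conj o_assoc)
    finally show ?thesis using y w by (intro bexI[of _ "i # y"]) auto
  qed
qed

lemma len_transp_down:
  assumes "f \<in> aff" "a < b" "\<not> cg a b" "pinv f a > pinv f b"
  shows "len (transp a b \<circ> f) < len f"
proof -
  obtain x where x: "x \<in> coxeter_words k" "act x = f" "length x = len f"
    using assms(1) by (rule reduced_E)
  then show ?thesis using strong_exchange[of x a b] assms len_act_le by force
qed

lemma len_transp_up:
  assumes "f \<in> aff" "a < b" "\<not> cg a b" "is_refl (transp a b)"
  shows "len f < len (transp a b \<circ> f) \<longleftrightarrow> pinv f a < pinv f b"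
proof -
  have r: "transp a b a = b" "transp a b b = a" using assms(3) cg_sym by (auto simp: transp_def)
  have "pinv (transp a b \<circ> f) = pinv f \<circ> transp a b" using assms by (simp add: pinv_o)
  then have "len f < len (transp a b \<circ> f)" if "pinv f a < pinv f b"
    using len_transp_down[of "transp a b \<circ> f" a b] that assms r is_refl_square[OF assms(4)] by (simp add: o_assoc)
  moreover have "pinv f a \<noteq> pinv f b" using assms by simp
  ultimately show ?thesis using len_transp_down[OF assms(1-3)] by fastforce
qed

section \<open>Strong order and lifting\<close>

definition bruhat_step :: "(int \<Rightarrow> int) \<Rightarrow> (int \<Rightarrow> int) \<Rightarrow> bool" where
  "bruhat_step f g \<longleftrightarrow> f \<in> aff \<and> (\<exists>t. is_refl t \<and> g = t \<circ> f) \<and> len f < len g"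

definition bruhat_le :: "(int \<Rightarrow> int) \<Rightarrow> (int \<Rightarrow> int) \<Rightarrow> bool" where
  "bruhat_le = bruhat_step\<^sup>*\<^sup>*"

lemma bruhat_step_aff: "bruhat_step f g \<Longrightarrow> f \<in> aff \<and> g \<in> aff"
  by (auto simp: bruhat_step_def)

lemma bruhat_le_refl [simp]: "bruhat_le f f"
  by (simp add: bruhat_le_def)

lemma bruhat_le_trans: "bruhat_le f g \<Longrightarrow> bruhat_le g h \<Longrightarrow> bruhat_le f h"
  by (simp add: bruhat_le_def)

lemma bruhat_step_le: "bruhat_step f g \<Longrightarrow> bruhat_le f g"
  by (auto simp: bruhat_le_def)

lemma bruhat_le_aff: "bruhat_le f g \<Longrightarrow> g \<in> aff \<Longrightarrow> f \<in> aff"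
  unfolding bruhat_le_def by (induction rule: converse_rtranclp_induct) (auto simp: bruhat_step_aff)

lemma bruhat_le_len: "bruhat_le f g \<Longrightarrow> f = g \<or> len f < len g"
  unfolding bruhat_le_def by (induction rule: rtranclp_induct) (auto simp: bruhat_step_def)

lemma bruhat_le_antisym: "bruhat_le f g \<Longrightarrow> bruhat_le g f \<Longrightarrow> f = g"
  using bruhat_le_len[of f g] bruhat_le_len[of g f] by auto

lemma bruhat_le_id_iff: "f \<in> aff \<Longrightarrow> bruhat_le f id \<longleftrightarrow> f = id"
  using bruhat_le_len[of f id] by auto

lemma bruhat_le_sg: "f \<in> aff \<Longrightarrow> len f < len (sg z \<circ> f) \<Longrightarrow> bruhat_le f (sg z \<circ> f)"
  using is_refl_sg by (intro bruhat_step_le) (auto simp: bruhat_step_def)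

lemma bruhat_le_sg': "f \<in> aff \<Longrightarrow> len (sg z \<circ> f) < len f \<Longrightarrow> bruhat_le (sg z \<circ> f) f"
  using bruhat_le_sg[of "sg z \<circ> f" z] by simp

text \<open>A reflection on the left of \<open>f\<close> is a conjugate reflection on its right, so
  left and right versions of the order agree.\<close>

lemma bruhat_step_pinv:
  assumes "bruhat_step f g" shows "bruhat_step (pinv f) (pinv g)"
proof -
  obtain t where t: "is_refl t" "g = t \<circ> f" and f: "f \<in> aff" "len f < len g"
    using assms by (auto simp: bruhat_step_def)
  have "pinv g = (pinv f \<circ> t \<circ> f) \<circ> pinv f"
    using t f by (simp add: pinv_o comp_assoc)
  moreover have "is_refl (pinv f \<circ> t \<circ> f)" using is_refl_conj[OF t(1), of "pinv f"] f by simp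
  ultimately show ?thesis using f t unfolding bruhat_step_def by (metis comp_aff is_refl_aff len_pinv pinv_aff)
qed

lemma bruhat_le_right:
  assumes "f \<in> aff" "len f < len (f \<circ> sg z)" shows "bruhat_le f (f \<circ> sg z)"
proof -
  have "bruhat_step (pinv f) (sg z \<circ> pinv f)" using assms len_pinv[of "f \<circ> sg z"] is_refl_sg
    by (auto simp: bruhat_step_def pinv_o)
  from bruhat_step_pinv[OF this] assms show ?thesis by (simp add: bruhat_step_le pinv_o)
qed

text \<open>Conjugation by \<open>sg z\<close> turns the reflection in \<open>a < b\<close> into the
  one in \<open>sg z a < sg z b\<close>, the order being kept since the reflection is not
  \<open>sg z\<close> itself. The length test then compares the same two values of
  \<open>pinv f\<close> as before.\<close>

lemma bruhat_step_sg:
  assumes "bruhat_step f g" "g \<noteq> sg z \<circ> f" shows "bruhat_step (sg z \<circ> f) (sg z \<circ> g)"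
proof -
  obtain t where t: "is_refl t" "g = t \<circ> f" and f: "f \<in> aff" "len f < len g"
    using assms by (auto simp: bruhat_step_def)
  obtain a b where ab: "a < b" "\<not> cg a b" "t = transp a b" using is_refl_transp[OF t(1)] .
  have "\<not> (cg a z \<and> b = a + 1)" using ab assms(2) t(2) sg_transp sg_cong by metis
  then have lt: "sg z a < sg z b" using sg_mono ab by blast
  have r: "transp (sg z a) (sg z b) = sg z \<circ> t \<circ> sg z"
  proof -
    have "transp (sg z a) (sg z b) \<circ> sg z = sg z \<circ> t" using transp_conj[of "sg z" a b] ab(3) by simp
    then have "transp (sg z a) (sg z b) \<circ> (sg z \<circ> sg z) = sg z \<circ> t \<circ> sg z" by (simp only: o_assoc)
    then show ?thesis by simp
  qed
  have ir: "is_refl (transp (sg z a) (sg z b))" unfolding r using is_refl_conj[OF t(1), of "sg z"] by simp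
  have e: "sg z \<circ> g = transp (sg z a) (sg z b) \<circ> (sg z \<circ> f)"
    unfolding r t(2) by (simp add: fun_eq_iff)
  have "pinv f a < pinv f b" using len_transp_up[of f a b] t f ab by simp
  then have "len (sg z \<circ> f) < len (sg z \<circ> g)"
    unfolding e using len_transp_up[OF _ lt _ ir, of "sg z \<circ> f"] f ab by (simp add: pinv_o)
  then show ?thesis using e ir f by (auto simp: bruhat_step_def)
qed

text \<open>The lifting property in a form that is preserved along a chain of reflections.\<close>

lemma bruhat_le_sg_lift:
  assumes "bruhat_le f g" shows "bruhat_le (sg z \<circ> f) (sg z \<circ> g) \<or> bruhat_le f (sg z \<circ> g) \<and> bruhat_le (sg z \<circ> f) g"
  using assms unfolding bruhat_le_def
proof (induction rule: rtranclp_induct)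
  case base then show ?case by simp
next
  case (step g h)
  show ?case
  proof (cases "h = sg z \<circ> g")
    case True
    then have "g = sg z \<circ> h" by simp
    then show ?thesis using step True by (metis rtranclp.rtrancl_into_rtrancl)
  next
    case False
    then have "bruhat_step (sg z \<circ> g) (sg z \<circ> h)" using bruhat_step_sg step by blast
    then show ?thesis using step by (metis rtranclp.rtrancl_into_rtrancl)
  qed
qed

section \<open>Demazure action and the subword property\<close>

definition dem_step :: "nat \<Rightarrow> (int \<Rightarrow> int) \<Rightarrow> int \<Rightarrow> int" where
  "dem_step i f = (if len f < len (sg (int i) \<circ> f) then sg (int i) \<circ> f else f)"

lemma dem_step_aff [simp]: "f \<in> aff \<Longrightarrow> dem_step i f \<in> aff"
  by (simp add: dem_step_def)

text \<open>Both directions come from lifting. The criterion is symmetric in \<open>f\<close> and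
  its product with the generator and makes no length distinction, so it iterates along arbitrary
  words.\<close>

lemma bruhat_le_dem_step_iff:
  assumes "f \<in> aff" "g \<in> aff"
  shows "bruhat_le f (dem_step i g) \<longleftrightarrow> bruhat_le f g \<or> bruhat_le (sg (int i) \<circ> f) g"
proof -
  let ?s = "sg (int i)"
  show ?thesis
  proof (cases "len g < len (?s \<circ> g)")
    case True
    have g: "bruhat_le g (?s \<circ> g)" using True assms bruhat_le_sg by blast
    have "bruhat_le f (?s \<circ> g)" if "bruhat_le (?s \<circ> f) g"
      using bruhat_le_sg_lift[OF that, of "int i"] g by (auto intro: bruhat_le_trans)
    moreover have "bruhat_le f g \<or> bruhat_le (?s \<circ> f) g" if "bruhat_le f (?s \<circ> g)"
      using bruhat_le_sg_lift[OF that, of "int i"] by auto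
    ultimately show ?thesis using True g by (auto simp: dem_step_def intro: bruhat_le_trans)
  next
    case False
    then have "len (?s \<circ> g) < len g" using len_sg_neq[OF assms(2), of "int i"] by simp
    then have g: "bruhat_le (?s \<circ> g) g" using assms bruhat_le_sg' by blast
    have "bruhat_le f g" if "bruhat_le (?s \<circ> f) g"
      using bruhat_le_sg_lift[OF that, of "int i"] g by (auto intro: bruhat_le_trans)
    then show ?thesis using False by (auto simp: dem_step_def)
  qed
qed

definition dem_word :: "nat list \<Rightarrow> (int \<Rightarrow> int) \<Rightarrow> int \<Rightarrow> int" where
  "dem_word t f = foldr dem_step t f"

lemma dem_word_simps [simp]: "dem_word [] f = f" "dem_word (i # t) f = dem_step i (dem_word t f)"
  by (simp_all add: dem_word_def)

lemma dem_word_append: "dem_word (s @ t) f = dem_word s (dem_word t f)"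
  by (simp add: dem_word_def)

lemma dem_word_aff [simp]: "f \<in> aff \<Longrightarrow> dem_word t f \<in> aff"
  by (induction t) auto

lemma subseqs_words: "t \<in> coxeter_words k \<Longrightarrow> y \<in> set (subseqs t) \<Longrightarrow> y \<in> coxeter_words k"
  by (induction t arbitrary: y rule: list.induct) (auto simp: Let_def in_lists_conv_set)

lemma bruhat_le_dem_word_iff:
  assumes "t \<in> coxeter_words k" "f \<in> aff" "g \<in> aff"
  shows "bruhat_le f (dem_word t g) \<longleftrightarrow> (\<exists>y\<in>set (subseqs t). \<exists>h. bruhat_le h g \<and> f = act y \<circ> h)"
  using assms
proof (induction t arbitrary: f rule: list.induct)
  case Nil then show ?case by auto
next
  case (Cons i t)
  have e: "sg (int i) \<circ> f = act y \<circ> h \<longleftrightarrow> f = act (i # y) \<circ> h" for y h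
    by (metis act_simps(2) comp_assoc sg_comp_sg2)
  have "bruhat_le f (dem_word (i # t) g) \<longleftrightarrow> bruhat_le f (dem_word t g) \<or> bruhat_le (sg (int i) \<circ> f) (dem_word t g)"
    using Cons.prems by (simp add: bruhat_le_dem_step_iff)
  also have "\<dots> \<longleftrightarrow> (\<exists>y\<in>set (subseqs t). \<exists>h. bruhat_le h g \<and> f = act y \<circ> h) \<or>
     (\<exists>y\<in>set (subseqs t). \<exists>h. bruhat_le h g \<and> sg (int i) \<circ> f = act y \<circ> h)"
    using Cons.IH[of f] Cons.IH[of "sg (int i) \<circ> f"] Cons.prems by (simp del: comp_apply)
  also have "\<dots> \<longleftrightarrow> (\<exists>y\<in>set (subseqs (i # t)). \<exists>h. bruhat_le h g \<and> f = act y \<circ> h)"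
    unfolding e by (simp add: Let_def bex_Un del: act_simps) blast
  finally show ?case .
qed

lemma dem_word_reduced:
  assumes "t \<in> coxeter_words k" "length t = len (act t)" shows "dem_word t id = act t"
  using assms
proof (induction t rule: list.induct)
  case Nil then show ?case by simp
next
  case (Cons i t)
  have t: "t \<in> coxeter_words k" using Cons.prems by simp
  have "len (act (i # t)) \<le> 1 + len (act t)"
    using len_comp_le[of "sg (int i)" "act t"] len_sg_le[of "int i"] t by simp
  moreover have l: "len (act (i # t)) = Suc (length t)" using Cons.prems(2) by (simp del: act_simps)
  ultimately have "length t = len (act t)" using len_act_le[OF t] by simp
  then show ?case using Cons.IH[OF t] l by (simp add: dem_step_def)
qed

lemma bruhat_le_act_iff:
  assumes "t \<in> coxeter_words k" "length t = len (act t)" "f \<in> aff"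
  shows "bruhat_le f (act t) \<longleftrightarrow> (\<exists>y\<in>set (subseqs t). f = act y)"
proof -
  have "bruhat_le h id \<longleftrightarrow> h = id" for h using bruhat_le_aff[of h id] bruhat_le_id_iff by auto
  then show ?thesis using bruhat_le_dem_word_iff[OF assms(1,3) id_aff] dem_word_reduced[OF assms(1,2)] by simp
qed

lemma bruhat_le_dem_word_id_iff:
  assumes "t \<in> coxeter_words k" "f \<in> aff"
  shows "bruhat_le f (dem_word t id) \<longleftrightarrow> (\<exists>y\<in>set (subseqs t). f = act y)"
proof -
  have "bruhat_le h id \<longleftrightarrow> h = id" for h using bruhat_le_aff[of h id] bruhat_le_id_iff by auto
  then show ?thesis using bruhat_le_dem_word_iff[OF assms id_aff] by simp
qed

lemma dem_word_mono:
  assumes "t \<in> coxeter_words k" "g \<in> aff" "bruhat_le f g" shows "bruhat_le (dem_word t f) (dem_word t g)"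
proof -
  have "f \<in> aff" using assms bruhat_le_aff by blast
  then show ?thesis
    using bruhat_le_dem_word_iff[OF assms(1), of "dem_word t f" f] bruhat_le_dem_word_iff[OF assms(1), of "dem_word t f" g] assms bruhat_le_trans
    by (metis dem_word_aff bruhat_le_refl)
qed

lemma dem_word_ge: "t \<in> coxeter_words k \<Longrightarrow> g \<in> aff \<Longrightarrow> y \<in> set (subseqs t) \<Longrightarrow> bruhat_le h g \<Longrightarrow> bruhat_le (act y \<circ> h) (dem_word t g)"
  using bruhat_le_dem_word_iff[of t "act y \<circ> h" g] subseqs_words[of t y] bruhat_le_aff[of h g] by auto

text \<open>A Demazure product is determined by its lower ideal, which depends on the word only
  through the products of its subwords. This makes the choice of a reduced word in
  \<open>demazure\<close> harmless.\<close>

lemma dem_word_cong: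
  assumes "s \<in> coxeter_words k" "t \<in> coxeter_words k" "g \<in> aff"
    "act ` set (subseqs s) = act ` set (subseqs t)"
  shows "dem_word s g = dem_word t g"
proof -
  have *: "(\<exists>y\<in>set (subseqs s). P (act y)) \<longleftrightarrow> (\<exists>y\<in>set (subseqs t). P (act y))" for P
    using assms(4) by (metis (mono_tags, lifting) image_iff)
  have "bruhat_le f (dem_word s g) \<longleftrightarrow> bruhat_le f (dem_word t g)" if "f \<in> aff" for f
    unfolding bruhat_le_dem_word_iff[OF assms(1) that assms(3)] bruhat_le_dem_word_iff[OF assms(2) that assms(3)] by (rule *)
  then show ?thesis using bruhat_le_antisym assms by (meson dem_word_aff bruhat_le_refl)
qed

text \<open>Demazure multiplication on the left and division on the right by the same element are adjoint.\<close>

lemma dem_word_right_division: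
  assumes "s \<in> coxeter_words k" "f \<in> aff"
  shows "\<exists>f'\<in>aff. \<forall>t\<in>coxeter_words k. bruhat_le f (dem_word (t @ s) id) \<longleftrightarrow> bruhat_le f' (dem_word t id)"
  using assms
proof (induction s arbitrary: f rule: rev_induct)
  case Nil then show ?case by auto
next
  case (snoc j s)
  let ?s = "sg (int j)"
  \<comment> \<open>The smaller of \<open>f\<close> and \<open>f \<circ> ?s\<close>: it lies below
    \<open>dem_word x id\<close> iff one of the two does.\<close>
  define f' where "f' = (if len f < len (f \<circ> ?s) then f else f \<circ> ?s)"
  have a: "f' \<in> aff" using snoc.prems by (simp add: f'_def)
  have l: "bruhat_le f' f \<and> bruhat_le f' (f \<circ> ?s)"
  proof (cases "len f < len (f \<circ> ?s)")
    case True then show ?thesis using bruhat_le_right snoc.prems by (simp add: f'_def)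
  next
    case False
    have "len (f \<circ> ?s) < len f" using False len_right_cases[of f "int j"] snoc.prems by force
    then have "bruhat_le (f \<circ> ?s) (f \<circ> ?s \<circ> ?s)" using bruhat_le_right[of "f \<circ> ?s" "int j"] snoc.prems by (simp add: comp_assoc)
    then show ?thesis using False by (simp add: f'_def comp_assoc)
  qed
  have "bruhat_le f (dem_word (x @ [j]) id) \<longleftrightarrow> bruhat_le f' (dem_word x id)" if x: "x \<in> coxeter_words k" for x
  proof -
    have xj: "x @ [j] \<in> coxeter_words k" using x snoc.prems by simp
    have "set (subseqs (x @ [j])) = set (subseqs x) \<union> (\<lambda>y. y @ [j]) ` set (subseqs x)"
      by (induction x) (auto simp: Let_def)
    then have "bruhat_le f (dem_word (x @ [j]) id) \<longleftrightarrow> (\<exists>y\<in>set (subseqs x). f = act y \<or> f = act y \<circ> ?s)"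
      unfolding bruhat_le_dem_word_id_iff[OF xj snoc.prems(2)] by (simp add: act_snoc bex_Un) blast
    also have "\<dots> \<longleftrightarrow> (\<exists>y\<in>set (subseqs x). f = act y \<or> f \<circ> ?s = act y)"
      by (metis comp_assoc comp_id sg_comp_sg)
    also have "\<dots> \<longleftrightarrow> bruhat_le f (dem_word x id) \<or> bruhat_le (f \<circ> ?s) (dem_word x id)"
      using bruhat_le_dem_word_id_iff[OF x] snoc.prems by auto
    also have "\<dots> \<longleftrightarrow> bruhat_le f' (dem_word x id)" using l bruhat_le_trans by (metis f'_def)
    finally show ?thesis .
  qed
  note * = this
  obtain f'' where f'': "f'' \<in> aff" "\<forall>t\<in>coxeter_words k. bruhat_le f' (dem_word (t @ s) id) \<longleftrightarrow> bruhat_le f'' (dem_word t id)"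
    using snoc.IH[OF _ a] snoc.prems(1) by (metis append_in_lists_conv)
  have "bruhat_le f (dem_word (t @ s @ [j]) id) \<longleftrightarrow> bruhat_le f'' (dem_word t id)" if "t \<in> coxeter_words k" for t
    using *[of "t @ s"] f''(2) that snoc.prems by simp
  then have "\<forall>t\<in>coxeter_words k. bruhat_le f (dem_word (t @ s @ [j]) id) \<longleftrightarrow> bruhat_le f'' (dem_word t id)" by blast
  then show ?case by (rule bexI[OF _ f''(1)])
qed

section \<open>Demazure products and cyclically decreasing elements\<close>

lemma reflections_words_of: "reflections k = words_of ` {t. is_refl t}"
proof
  show "reflections k \<subseteq> words_of ` {t. is_refl t}"
  proof
    fix x assume "x \<in> reflections k"
    then obtain v i where v: "v \<in> carrier (affine_sym k)" "i \<le> k"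
      "x = v \<otimes>\<^bsub>affine_sym k\<^esub> simple_refl k i \<otimes>\<^bsub>affine_sym k\<^esub> inv\<^bsub>affine_sym k\<^esub> v"
      unfolding reflections_def by blast
    then obtain f where f: "f \<in> aff" "v = words_of f" by (auto simp: carrier_affine_sym)
    have "x = words_of (f \<circ> sg (int i) \<circ> pinv f)"
      using v f by (simp add: simple_refl_words_of inv_words_of mult_words_of)
    moreover have "is_refl (f \<circ> sg (int i) \<circ> pinv f)" using f unfolding is_refl_def by blast
    ultimately show "x \<in> words_of ` {t. is_refl t}" by blast
  qed
next
  show "words_of ` {t. is_refl t} \<subseteq> reflections k"
  proof (intro image_subsetI)
    fix t assume "t \<in> {t. is_refl t}"
    then obtain v z where v: "v \<in> aff" "t = v \<circ> sg z \<circ> pinv v"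
      unfolding is_refl_def mem_Collect_eq by blast
    have "words_of t = words_of v \<otimes>\<^bsub>affine_sym k\<^esub> simple_refl k (letter z) \<otimes>\<^bsub>affine_sym k\<^esub> inv\<^bsub>affine_sym k\<^esub> (words_of v)"
      using v by (simp add: simple_refl_words_of inv_words_of mult_words_of sg_letter)
    moreover have "words_of v \<in> carrier (affine_sym k)" using v by (simp add: carrier_affine_sym)
    ultimately show "words_of t \<in> reflections k"
      unfolding reflections_def mem_Collect_eq
      by (intro exI[of _ "words_of v"] exI[of _ "letter z"] conjI letter_le)
  qed
qed

lemma strong_le_words_of:
  assumes "f \<in> aff" "g \<in> aff" shows "strong_le k (words_of f) (words_of g) \<longleftrightarrow> bruhat_le f g"
proof -
  define R where "R = (\<lambda>u v. u \<in> carrier (affine_sym k) \<and>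
     (\<exists>t\<in>reflections k. v = t \<otimes>\<^bsub>affine_sym k\<^esub> u \<and> cox_length u < cox_length v))"
  have R_iff: "R (words_of f) V \<longleftrightarrow> (\<exists>g. bruhat_step f g \<and> V = words_of g)" if f: "f \<in> aff" for f V
  proof
    assume "R (words_of f) V"
    then obtain t where "is_refl t" "V = words_of t \<otimes>\<^bsub>affine_sym k\<^esub> words_of f" "cox_length (words_of f) < cox_length V"
      by (auto simp: R_def reflections_words_of)
    then show "\<exists>g. bruhat_step f g \<and> V = words_of g"
      using f by (intro exI[of _ "t \<circ> f"]) (auto simp: bruhat_step_def mult_words_of len_def)
  next
    assume "\<exists>g. bruhat_step f g \<and> V = words_of g"
    then obtain t where "is_refl t" "V = words_of (t \<circ> f)" "len f < len (t \<circ> f)" by (auto simp: bruhat_step_def)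
    then show "R (words_of f) V"
      using f unfolding R_def reflections_words_of by (auto simp: carrier_affine_sym mult_words_of len_def)
  qed
  have "\<exists>g. V = words_of g \<and> bruhat_le f g \<and> g \<in> aff" if "R\<^sup>*\<^sup>* (words_of f) V" for V
    using that
  proof (induction rule: rtranclp_induct)
    case base then show ?case using assms by auto
  next
    case (step V V')
    then obtain g where g: "V = words_of g" "bruhat_le f g" "g \<in> aff" by blast
    then obtain g' where "bruhat_step g g'" "V' = words_of g'" using step.hyps(2) R_iff by blast
    then show ?case using g bruhat_step_aff bruhat_step_le bruhat_le_trans by blast
  qed
  then have 1: "bruhat_le f g" if "R\<^sup>*\<^sup>* (words_of f) (words_of g)" using that assms words_of_inj by metis
  have 2: "R\<^sup>*\<^sup>* (words_of f) (words_of g)" if "bruhat_le f g"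
    using that unfolding bruhat_le_def
  proof (induction rule: rtranclp_induct)
    case (step g h)
    then have "R (words_of g) (words_of h)" using R_iff bruhat_step_aff by blast
    then show ?case using step by simp
  qed simp
  show ?thesis using 1 2 unfolding strong_le_def R_def by blast
qed

lemma strong_less_left:
  assumes "f \<in> aff" shows "strong_less k (words_of f) (words_of (sg z \<circ> f)) \<longleftrightarrow> len f < len (sg z \<circ> f)"
  using assms bruhat_le_sg[of f z] bruhat_le_len[of f "sg z \<circ> f"] len_sg_neq[of f z]
  by (auto simp: strong_less_def strong_le_words_of words_of_inj)

lemma strong_less_right:
  assumes "f \<in> aff" shows "strong_less k (words_of f) (words_of (f \<circ> sg z)) \<longleftrightarrow> len f < len (f \<circ> sg z)"
  using assms bruhat_le_right[of f z] bruhat_le_len[of f "f \<circ> sg z"]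
  by (auto simp: strong_less_def strong_le_words_of words_of_inj)

text \<open>Right multiplication by generator \<open>i\<close> lengthens iff \<open>f\<close>
  increases at \<open>i\<close>; so these are the \<open>f\<close> that increase on the window
  \<open>1, ..., N\<close>.\<close>

definition Gr :: "(int \<Rightarrow> int) set" where
  "Gr = {f \<in> aff. \<forall>j\<in>{1..int k}. f j < f (j + 1)}"

lemma affine_grassmannian_words_of: "affine_grassmannian k = words_of ` Gr"
proof -
  have "words_of f \<in> affine_grassmannian k \<longleftrightarrow> f \<in> Gr" if f: "f \<in> aff" for f
  proof -
    have "words_of f \<in> affine_grassmannian k \<longleftrightarrow> (\<forall>i\<in>{1..k}. f (int i) < f (int i + 1))"
      using f unfolding affine_grassmannian_def
      by (auto simp: carrier_affine_sym simple_refl_words_of mult_words_of strong_less_right len_up_right)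
    also have "\<dots> \<longleftrightarrow> (\<forall>j\<in>{1..int k}. f j < f (j + 1))"
    proof safe
      fix j assume *: "\<forall>i\<in>{1..k}. f (int i) < f (int i + 1)" "j \<in> {1..int k}"
      then have "nat j \<in> {1..k}" "int (nat j) = j" by auto
      with *(1) show "f j < f (j + 1)" by metis
    qed auto
    finally show ?thesis using f by (simp add: Gr_def)
  qed
  moreover have "affine_grassmannian k \<subseteq> words_of ` aff" "Gr \<subseteq> aff"
    by (auto simp: affine_grassmannian_def carrier_affine_sym Gr_def)
  ultimately show ?thesis by blast
qed

lemma Gr_aff [simp]: "f \<in> Gr \<Longrightarrow> f \<in> aff"
  by (simp add: Gr_def)

lemma GrD: "f \<in> Gr \<Longrightarrow> 1 \<le> j \<Longrightarrow> j \<le> int k \<Longrightarrow> f j < f (j + 1)"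
  by (simp add: Gr_def del: Gr_aff)

lemma GrI: "f \<in> aff \<Longrightarrow> (\<And>j. 1 \<le> j \<Longrightarrow> j \<le> int k \<Longrightarrow> f j < f (j + 1)) \<Longrightarrow> f \<in> Gr"
  by (simp add: Gr_def del: Gr_aff)

lemma words_of_Gr_iff: "f \<in> aff \<Longrightarrow> words_of f \<in> affine_grassmannian k \<longleftrightarrow> f \<in> Gr"
  unfolding affine_grassmannian_words_of using words_of_inj Gr_aff by blast

lemma demazure_step_words_of:
  "i \<le> k \<Longrightarrow> f \<in> aff \<Longrightarrow> demazure_step k i (words_of f) = words_of (dem_step i f)"
  by (simp add: demazure_step_def dem_step_def simple_refl_words_of mult_words_of strong_less_left)

lemma foldr_demazure_words_of:
  "t \<in> coxeter_words k \<Longrightarrow> f \<in> aff \<Longrightarrow> foldr (demazure_step k) t (words_of f) = words_of (dem_word t f)"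
  by (induction t rule: list.induct) (auto simp: demazure_step_words_of)

lemma demazure_words_of_reduced:
  assumes "f \<in> aff" "g \<in> aff"
  obtains t where "t \<in> coxeter_words k" "act t = f" "length t = len f"
    "demazure k (words_of f) (words_of g) = words_of (dem_word t g)"
proof -
  define t where "t = (SOME t. reduced_word (words_of f) t)"
  obtain x where "x \<in> coxeter_words k" "act x = f" "length x = len f" using assms(1) by (rule reduced_E)
  then have "reduced_word (words_of f) x" by (simp add: reduced_word_def words_of_def len_def)
  then have "reduced_word (words_of f) t" unfolding t_def by (rule someI)
  then have "t \<in> coxeter_words k" "act t = f" "length t = len f"
    by (auto simp: reduced_word_def words_of_def len_def)
  with that assms foldr_demazure_words_of[of t g] show ?thesis by (simp add: demazure_def t_def)
qed

section \<open>Cyclically decreasing words\<close>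

lemma cyc_iff: "cyclically_decreasing k x \<longleftrightarrow>
    x \<in> coxeter_words k \<and> distinct x \<and> sorted_wrt (\<lambda>a b. b \<noteq> succ_mod k a) x"
  unfolding cyclically_decreasing_def sorted_wrt_iff_nth_less by blast

lemma cyc_Nil [simp]: "cyclically_decreasing k []"
  by (simp add: cyc_iff)

lemma succ_mod_letter: "i \<le> k \<Longrightarrow> succ_mod k i = letter (int i + 1)"
  using cg_succ[of i] letter_cong[of "int (succ_mod k i)" "int i + 1"] by simp

lemma cyc_Cons: "cyclically_decreasing k (i # x) \<longleftrightarrow>
    i \<le> k \<and> i \<notin> set x \<and> letter (int i + 1) \<notin> set x \<and> cyclically_decreasing k x"
  unfolding cyc_iff by (auto simp: succ_mod_letter)

lemma cyc_words: "cyclically_decreasing k x \<Longrightarrow> x \<in> coxeter_words k"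
  by (simp add: cyc_iff)

lemma cyc_distinct: "cyclically_decreasing k x \<Longrightarrow> distinct x"
  by (simp add: cyc_iff)

lemma set_subseqs_subset: "y \<in> set (subseqs x) \<Longrightarrow> set y \<subseteq> set x"
  by (metis PowI Pow_iff image_eqI subseqs_powset)

lemma cyc_subseqs: "cyclically_decreasing k x \<Longrightarrow> y \<in> set (subseqs x) \<Longrightarrow> cyclically_decreasing k y"
proof (induction x arbitrary: y rule: list.induct)
  case (Cons i x)
  have "y \<in> set (subseqs x) \<or> (\<exists>y'\<in>set (subseqs x). y = i # y')"
    using Cons.prems(2) by (auto simp: Let_def)
  then show ?case
  proof
    assume "\<exists>y'\<in>set (subseqs x). y = i # y'"
    then obtain y' where y': "y' \<in> set (subseqs x)" "y = i # y'" by blast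
    moreover have "cyclically_decreasing k x" using Cons.prems(1) by (simp add: cyc_Cons)
    ultimately show ?thesis using Cons.IH Cons.prems(1) set_subseqs_subset[OF y'(1)] unfolding y'(2) cyc_Cons by blast
  qed (use Cons in \<open>auto simp: cyc_Cons\<close>)
qed simp

lemma letter_add [simp]: "letter (z + c * N) = letter z"
  using letter_cong cg_mult by (metis cg_refl)

lemma letter_eq_iff: "i \<le> k \<Longrightarrow> letter z = i \<longleftrightarrow> cg z (int i)"
  using letter_cong[of z "int i"] by simp

lemma letter_shift: "letter y = letter z \<Longrightarrow> letter (y + c) = letter (z + c)"
  using letter_cong cg_add by metis

lemma letter_Suc: "letter (z + 1) \<noteq> letter z"
  using letter_cong cg_Suc by metis

lemma cyc_proper:
  assumes "cyclically_decreasing k x" shows "set x \<subset> {..k}"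
proof (cases x)
  case Nil then show ?thesis by auto
next
  case (Cons i y)
  have "letter (int i + 1) \<notin> set x" using assms Cons letter_Suc[of "int i"] by (auto simp: cyc_Cons)
  moreover have "set x \<subseteq> {..k}" using cyc_words[OF assms] by (auto simp: in_lists_conv_set)
  ultimately show ?thesis using letter_le by blast
qed

lemma cyc_exists:
  assumes "A \<subset> {..k}" shows "\<exists>x. cyclically_decreasing k x \<and> set x = A"
proof -
  obtain c where c: "c \<le> k" "c \<notin> A" using assms by auto
  \<comment> \<open>All letters except \<open>c\<close>, in the order
    \<open>c + k, ..., c + 1\<close> modulo \<open>N\<close>; starting behind a missing letter makes
    the word cyclically decreasing, and the wanted word is a subsequence.\<close>
  define x where "x = map (\<lambda>j. letter (int c + int j)) (rev [1..<k+1])"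
  have cg: "letter (int c + int a) = letter (int c + int b + d) \<Longrightarrow> N dvd int a - int b - d" for a b d
    unfolding letter_cong[symmetric] cg_def by (simp add: algebra_simps)
  have nd: "\<not> N dvd z" if "0 < \<bar>z\<bar>" "\<bar>z\<bar> < N" for z
    using zdvd_imp_le[of N "\<bar>z\<bar>"] that by auto
  have "distinct x" unfolding x_def
    unfolding distinct_map
  proof (intro conjI inj_onI)
    fix a b assume ab: "a \<in> set (rev [1..<k+1])" "b \<in> set (rev [1..<k+1])"
      "letter (int c + int a) = letter (int c + int b)"
    then have "N dvd int a - int b" using cg[of a b 0] by simp
    moreover have "\<bar>int a - int b\<bar> < N" using ab by (auto simp: N_def)
    ultimately show "a = b" using nd[of "int a - int b"] by auto
  qed simp
  moreover have "sorted_wrt (\<lambda>a b. b \<noteq> succ_mod k a) x"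
    unfolding x_def sorted_wrt_map sorted_wrt_rev
  proof (rule sorted_wrt_mono_rel[OF _ sorted_wrt_upt])
    fix a b assume ab: "a \<in> set [1..<k+1]" "b \<in> set [1..<k+1]" "a < b"
    show "letter (int c + int a) \<noteq> succ_mod k (letter (int c + int b))"
    proof
      assume "letter (int c + int a) = succ_mod k (letter (int c + int b))"
      then have "letter (int c + int a) = letter (int c + int b + 1)"
        using succ_mod_letter[of "letter (int c + int b)"] letter_shift[of "int (letter (int c + int b))" "int c + int b" 1]
        by simp
      then show False using cg[of a b 1] nd[of "int a - int b - 1"] ab by (auto simp: N_def)
    qed
  qed
  moreover have "x \<in> coxeter_words k" by (auto simp: x_def)
  ultimately have cx: "cyclically_decreasing k x" by (simp add: cyc_iff)
  have "A \<subseteq> set x"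
  proof
    fix a assume a: "a \<in> A"
    then have ak: "a \<le> k" "a \<noteq> c" using assms c by auto
    define j where "j = nat ((int a - int c) mod N)"
    have b: "0 \<le> (int a - int c) mod N" "(int a - int c) mod N < N" using N_ge2 by auto
    have "\<bar>int a - int c\<bar> < N" using ak c by (auto simp: N_def)
    then have "(int a - int c) mod N \<noteq> 0" using nd[of "int a - int c"] ak by auto
    then have "0 < (int a - int c) mod N" using b by simp
    then have "j \<in> {1..<k+1}" using b by (simp add: j_def N_def) linarith
    moreover have "letter (int c + int j) = a"
      using b ak by (simp add: letter_eq_iff j_def cg_def mod_eq_dvd_iff[symmetric] mod_simps)
    ultimately show "a \<in> set x" unfolding x_def set_map set_rev set_upt
      by (metis image_eqI)
  qed
  then obtain y where "y \<in> set (subseqs x)" "set y = A" using subseqs_powset[of x] by (metis PowI imageE)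
  then show ?thesis using cyc_subseqs[OF cx] by blast
qed

text \<open>A maximal run \<open>a, ..., a + m - 1\<close> of letters contributes
  \<open>s_{a+m-1} ... s_a\<close>, a cycle sending \<open>a\<close> to \<open>a + m\<close> and
  lowering \<open>a + 1, ..., a + m\<close> by one. The formula refers only to the set of letters,
  which gives independence of the word.\<close>

lemma
  assumes "cyclically_decreasing k x"
  shows act_cyc_down: "letter (z - 1) \<in> set x \<Longrightarrow> act x z = z - 1"
    and act_cyc_up: "letter (z - 1) \<notin> set x \<Longrightarrow> \<forall>j<m. letter (z + int j) \<in> set x \<Longrightarrow>
      letter (z + int m) \<notin> set x \<Longrightarrow> act x z = z + int m"
proof -
  have "(letter (z - 1) \<in> set x \<longrightarrow> act x z = z - 1) \<and>
    (letter (z - 1) \<notin> set x \<and> (\<forall>j<m. letter (z + int j) \<in> set x) \<and> letter (z + int m) \<notin> set x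
       \<longrightarrow> act x z = z + int m)"
    using assms
  proof (induction x arbitrary: m rule: list.induct)
    case Nil
    then show ?case by auto
  next
    case (Cons i x)
    have c: "i \<le> k" "i \<notin> set x" "letter (int i + 1) \<notin> set x" "cyclically_decreasing k x"
      using Cons.prems by (auto simp: cyc_Cons)
    note IH = Cons.IH[OF c(4)]
    have next_i: "letter (y + 1) = letter (int i + 1)" if "letter y = i" for y
      using letter_shift[of y "int i" 1] that c(1) by simp
    have nin: "letter (int i + 1) \<notin> set (i # x)" using c letter_Suc[of "int i"] by auto
    show ?case
    proof (intro conjI impI)
      assume a: "letter (z - 1) \<in> set (i # x)"
      show "act (i # x) z = z - 1"
      proof (cases "letter (z - 1) = i")
        case True
        then have z: "letter z = letter (int i + 1)" using next_i[of "z - 1"] by simp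
        then have "act x z = z" using IH[of 0] True c by simp
        moreover have "cg z (int i + 1)" using z letter_cong by blast
        ultimately show ?thesis by (simp add: sg_down)
      next
        case False
        then have m: "letter (z - 1) \<in> set x" using a by simp
        have "\<not> cg (z - 1) (int i)" using False c letter_eq_iff by blast
        moreover have "\<not> cg (z - 1) (int i + 1)" using m c letter_cong by metis
        ultimately show ?thesis using IH m by (simp add: sg_fix)
      qed
    next
      assume a: "letter (z - 1) \<notin> set (i # x) \<and> (\<forall>j<m. letter (z + int j) \<in> set (i # x)) \<and>
        letter (z + int m) \<notin> set (i # x)"
      \<comment> \<open>The letter following \<open>i\<close> does not occur, so \<open>i\<close>
        can only close a run.\<close>
      have last: "Suc j = m" if j: "j < m" "letter (z + int j) = i" for j
      proof (rule ccontr)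
        assume "Suc j \<noteq> m"
        then have "letter (z + int (Suc j)) \<in> set (i # x)" using a j by (meson Suc_lessI)
        moreover have "letter (z + int (Suc j)) = letter (int i + 1)" using next_i[OF j(2)] by (simp add: algebra_simps)
        ultimately show False using nin by simp
      qed
      show "act (i # x) z = z + int m"
      proof (cases "\<exists>j<m. letter (z + int j) = i")
        case True
        then obtain j where j: "j < m" "letter (z + int j) = i" by blast
        then have m: "m = Suc j" using last by simp
        have "letter (z + int j') \<in> set x" if "j' < j" for j'
          using a last[of j'] that m by (metis Suc_inject less_SucI nat_neq_iff set_ConsD)
        then have "act x z = z + int j" using IH[of j] a j c by auto
        moreover have "cg (z + int j) (int i)" using j c letter_eq_iff by blast
        ultimately show ?thesis using m by (simp add: sg_up)
      next
        case False
        then have "act x z = z + int m" using IH[of m] a by auto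
        moreover have "\<not> cg (z + int m) (int i)" using a c letter_eq_iff by auto
        moreover have "\<not> cg (z + int m) (int i + 1)"
        proof
          assume "cg (z + int m) (int i + 1)"
          then have "letter (z + int m - 1) = i"
            using cg_add[of "z + int m" "int i + 1" "-1"] c letter_eq_iff by simp
          then show False using a False by (cases m) auto
        qed
        ultimately show ?thesis by (simp add: sg_fix)
      qed
    qed
  qed
  then show "letter (z - 1) \<in> set x \<Longrightarrow> act x z = z - 1"
    "letter (z - 1) \<notin> set x \<Longrightarrow> \<forall>j<m. letter (z + int j) \<in> set x \<Longrightarrow>
      letter (z + int m) \<notin> set x \<Longrightarrow> act x z = z + int m" by blast+
qed

lemma letter_reach: "c \<le> k \<Longrightarrow> letter (z + int (nat ((int c - z) mod N))) = c"
  using N_ge2 by (simp add: letter_eq_iff cg_def mod_eq_dvd_iff[symmetric] mod_simps)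

lemma run_exists:
  assumes "A \<subset> {..k}"
  obtains m where "\<forall>j<m. letter (z + int j) \<in> A" "letter (z + int m) \<notin> A"
proof -
  obtain c where c: "c \<le> k" "c \<notin> A" using assms by auto
  then have ex: "\<exists>m. letter (z + int m) \<notin> A" using letter_reach by metis
  have "letter (z + int (LEAST m. letter (z + int m) \<notin> A)) \<notin> A" using ex by (rule LeastI_ex)
  with not_less_Least[of _ "\<lambda>m. letter (z + int m) \<notin> A"] that show ?thesis by blast
qed

lemma act_cyc_unique:
  assumes "cyclically_decreasing k x" "cyclically_decreasing k y" "set x = set y"
  shows "act x = act y"
proof
  fix z
  show "act x z = act y z"
  proof (cases "letter (z - 1) \<in> set x")
    case True then show ?thesis using act_cyc_down assms by metis
  next
    case False
    obtain m where "\<forall>j<m. letter (z + int j) \<in> set x" "letter (z + int m) \<notin> set x"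
      using run_exists[OF cyc_proper[OF assms(1)]] .
    then show ?thesis using act_cyc_up[of x z m] act_cyc_up[of y z m] assms False by simp
  qed
qed

lemma act_cyc_ge:
  assumes "cyclically_decreasing k x" shows "act x z \<ge> z - 1"
    and "letter (z - 1) \<notin> set x \<Longrightarrow> act x z \<ge> z"
proof -
  obtain m where "\<forall>j<m. letter (z + int j) \<in> set x" "letter (z + int m) \<notin> set x"
    using run_exists[OF cyc_proper[OF assms]] .
  then have *: "act x z = z + int m" if "letter (z - 1) \<notin> set x"
    using act_cyc_up assms that by blast
  then show "letter (z - 1) \<notin> set x \<Longrightarrow> act x z \<ge> z" by simp
  show "act x z \<ge> z - 1" using * act_cyc_down[OF assms, of z] by (cases "letter (z - 1) \<in> set x") auto
qed

text \<open>The set is recovered as the residues of those \<open>z\<close> with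
  \<open>act x (z + 1) = z\<close>.\<close>

lemma act_cyc_inj:
  assumes "cyclically_decreasing k x" "cyclically_decreasing k y" "act x = act y"
  shows "set x = set y"
proof -
  have *: "letter z \<in> set w \<longleftrightarrow> act w (z + 1) = z" if "cyclically_decreasing k w" for w z
  proof (cases "letter z \<in> set w")
    case True then show ?thesis using act_cyc_down[OF that, of "z + 1"] by simp
  next
    case False then show ?thesis using act_cyc_ge(2)[OF that, of "z + 1"] by simp
  qed
  have "i \<in> set x \<longleftrightarrow> i \<in> set y" if "i \<le> k" for i
    using *[OF assms(1), of "int i"] *[OF assms(2), of "int i"] assms(3) that by simp
  moreover have "set x \<subseteq> {..k}" "set y \<subseteq> {..k}" using cyc_proper assms by blast+
  ultimately show ?thesis by blast
qed

text \<open>Neither \<open>i\<close> nor \<open>i + 1\<close> occurs in \<open>x\<close>, so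
  \<open>i + 1\<close> is fixed by \<open>act x\<close>; as no point drops by more than one, the
  preimage of \<open>i\<close> lies before \<open>i + 1\<close>.\<close>

lemma len_cyc_Cons:
  assumes "cyclically_decreasing k (i # x)" shows "len (act x) < len (sg (int i) \<circ> act x)"
proof -
  have c: "i \<le> k" "i \<notin> set x" "letter (int i + 1) \<notin> set x" "cyclically_decreasing k x"
    using assms by (auto simp: cyc_Cons)
  have aff: "act x \<in> aff" using cyc_words[OF c(4)] by simp
  have "act x (int i + 1) = int i + 1" using act_cyc_up[OF c(4), of "int i + 1" 0] c by simp
  then have 1: "pinv (act x) (int i + 1) = int i + 1" using aff by (metis pinv_comp(3))
  define z where "z = pinv (act x) (int i)"
  have z: "act x z = int i" using aff by (simp add: z_def)
  then have "z \<le> int i + 1" using act_cyc_ge(1)[OF c(4), of z] by simp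
  moreover have "z \<noteq> int i + 1" using z \<open>act x (int i + 1) = int i + 1\<close> by auto
  ultimately show ?thesis using len_up[OF aff, of "int i"] 1 by (simp add: z_def)
qed

lemma cyc_reduced:
  assumes "cyclically_decreasing k x" shows "len (act x) = length x"
proof -
  have "len (act x) = length x \<and> cyclically_decreasing k x" using assms
  proof (induction x rule: list.induct)
    case Nil then show ?case using len_id by (simp add: id_def)
  next
    case (Cons i x)
    have c: "cyclically_decreasing k x" "act x \<in> aff" using Cons.prems cyc_words by (auto simp: cyc_Cons)
    have "len (sg (int i) \<circ> act x) = len (act x) + 1"
      using len_cyc_Cons[OF Cons.prems] len_sg_cases[OF c(2), of "int i"] by linarith
    then have "len (act (i # x)) = length (i # x)" using Cons.IH c by simp
    then show ?case using Cons.prems by blast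
  qed
  then show ?thesis by blast
qed

definition cyc_word :: "nat set \<Rightarrow> nat list" where
  "cyc_word A = (SOME x. cyclically_decreasing k x \<and> set x = A)"

definition cyc_perm :: "nat set \<Rightarrow> int \<Rightarrow> int" where
  "cyc_perm A = act (cyc_word A)"

lemma cyc_word:
  assumes "A \<subset> {..k}" shows "cyclically_decreasing k (cyc_word A)" "set (cyc_word A) = A"
  using someI_ex[OF cyc_exists[OF assms]] by (auto simp: cyc_word_def)

lemma cyc_word_words [simp]: "A \<subset> {..k} \<Longrightarrow> cyc_word A \<in> coxeter_words k"
  using cyc_word cyc_words by blast

lemma cyc_perm_aff [simp]: "A \<subset> {..k} \<Longrightarrow> cyc_perm A \<in> aff"
  by (simp add: cyc_perm_def)

lemma length_cyc_word: "A \<subset> {..k} \<Longrightarrow> length (cyc_word A) = card A"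
  using cyc_word[of A] cyc_distinct distinct_card by metis

lemma len_cyc_perm: "A \<subset> {..k} \<Longrightarrow> len (cyc_perm A) = card A"
  using cyc_word cyc_reduced length_cyc_word by (simp add: cyc_perm_def)

lemma cyc_elem_words_of: "A \<subset> {..k} \<Longrightarrow> cyc_elem k A = words_of (cyc_perm A)"
  by (simp add: cyc_elem_def cyc_word_def[symmetric] cyc_perm_def word_class_act)

lemma act_cyc_cyc_perm: "cyclically_decreasing k y \<Longrightarrow> act y = cyc_perm (set y)"
  unfolding cyc_perm_def using cyc_word cyc_proper by (intro act_cyc_unique) auto

lemma cyc_perm_inj: "A \<subset> {..k} \<Longrightarrow> B \<subset> {..k} \<Longrightarrow> cyc_perm A = cyc_perm B \<longleftrightarrow> A = B"
  using act_cyc_inj[of "cyc_word A" "cyc_word B"] cyc_word by (auto simp: cyc_perm_def)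

lemma act_subseqs_cyc:
  assumes "cyclically_decreasing k x" shows "act ` set (subseqs x) = cyc_perm ` Pow (set x)"
proof -
  have "act ` set (subseqs x) = (\<lambda>y. cyc_perm (set y)) ` set (subseqs x)"
    using act_cyc_cyc_perm cyc_subseqs[OF assms] by (intro image_cong) auto
  also have "\<dots> = cyc_perm ` Pow (set x)" using subseqs_powset[of x] by (simp add: image_image[symmetric])
  finally show ?thesis .
qed

lemma dem_word_cyc:
  assumes "cyclically_decreasing k y" "g \<in> aff" shows "dem_word y g = dem_word (cyc_word (set y)) g"
  using assms cyc_word[OF cyc_proper[OF assms(1)]] by (intro dem_word_cong) (auto simp: cyc_words act_subseqs_cyc)

text \<open>Subwords of cyclically decreasing words are cyclically decreasing, so the interval below
  \<open>d_A\<close> is Boolean.\<close>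

lemma bruhat_le_cyc_perm_iff:
  assumes "f \<in> aff" "A \<subset> {..k}" shows "bruhat_le f (cyc_perm A) \<longleftrightarrow> (\<exists>C\<subseteq>A. f = cyc_perm C)"
proof -
  have "bruhat_le f (cyc_perm A) \<longleftrightarrow> f \<in> act ` set (subseqs (cyc_word A))"
    using bruhat_le_act_iff[of "cyc_word A" f] assms cyc_word[OF assms(2)] cyc_reduced[of "cyc_word A"] by (auto simp: cyc_perm_def)
  also have "\<dots> \<longleftrightarrow> f \<in> cyc_perm ` Pow A" using act_subseqs_cyc cyc_word assms by simp
  finally show ?thesis by auto
qed

text \<open>The reduced word chosen inside \<open>demazure\<close> and \<open>cyc_word A\<close>
  have the same subword products, namely the elements below \<open>d_A\<close>.\<close>

lemma demazure_cyc_elem: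
  assumes "A \<subset> {..k}" "g \<in> aff"
  shows "demazure k (cyc_elem k A) (words_of g) = words_of (dem_word (cyc_word A) g)"
proof -
  obtain t where t: "t \<in> coxeter_words k" "act t = cyc_perm A" "length t = len (cyc_perm A)"
    "demazure k (words_of (cyc_perm A)) (words_of g) = words_of (dem_word t g)"
    using demazure_words_of_reduced[OF cyc_perm_aff[OF assms(1)] assms(2)] .
  have r: "length (cyc_word A) = len (act (cyc_word A))" using cyc_word[OF assms(1)] cyc_reduced by metis
  have "f \<in> act ` set (subseqs t) \<longleftrightarrow> f \<in> act ` set (subseqs (cyc_word A))" for f
  proof (cases "f \<in> aff")
    case True
    then show ?thesis using bruhat_le_act_iff[of t f] bruhat_le_act_iff[of "cyc_word A" f] t r assms by (auto simp: cyc_perm_def)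
  next
    case False
    then show ?thesis using subseqs_words[OF t(1)] subseqs_words[OF cyc_word_words[OF assms(1)]] by auto
  qed
  then have "act ` set (subseqs t) = act ` set (subseqs (cyc_word A))" by blast
  then have "dem_word t g = dem_word (cyc_word A) g" using dem_word_cong[of t "cyc_word A" g] t assms by simp
  then show ?thesis using t(4) assms by (simp add: cyc_elem_words_of)
qed

text \<open>After right division the condition reads \<open>f' \<le> d_B\<close>, that is,
  \<open>f' = d_C\<close> for some \<open>C \<subseteq> B\<close>. As \<open>f'\<close> determines
  \<open>C\<close>, either one \<open>C\<close> serves for all \<open>B\<close>, or
  \<open>f'\<close> is not of this form and no \<open>B\<close> qualifies.\<close>

lemma principal_filter:
  assumes "lam \<in> aff" "f \<in> aff"
  shows "(\<exists>A\<subset>{..k}. \<forall>B\<subset>{..k}. bruhat_le f (dem_word (cyc_word B) lam) \<longleftrightarrow> A \<subseteq> B) \<or> (\<forall>B\<subset>{..k}. \<not> bruhat_le f (dem_word (cyc_word B) lam))"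
proof -
  obtain s where s: "s \<in> coxeter_words k" "act s = lam" "length s = len lam" using assms(1) by (rule reduced_E)
  then have "dem_word s id = lam" using dem_word_reduced by metis
  moreover obtain f' where f': "f' \<in> aff" "\<forall>t\<in>coxeter_words k. bruhat_le f (dem_word (t @ s) id) \<longleftrightarrow> bruhat_le f' (dem_word t id)"
    using dem_word_right_division[OF s(1) assms(2)] by blast
  ultimately have *: "bruhat_le f (dem_word (cyc_word B) lam) \<longleftrightarrow> (\<exists>C\<subseteq>B. f' = cyc_perm C)" if B: "B \<subset> {..k}" for B
  proof -
    have "dem_word (cyc_word B) id = cyc_perm B" using dem_word_reduced[of "cyc_word B"] B cyc_word[OF B] cyc_reduced by (simp add: cyc_perm_def)
    then show ?thesis using f' B bruhat_le_cyc_perm_iff[of f' B] \<open>dem_word s id = lam\<close> by (simp add: dem_word_append[symmetric])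
        (metis cyc_word_words dem_word_append)
  qed
  show ?thesis
  proof (cases "\<exists>A\<subset>{..k}. f' = cyc_perm A")
    case True
    then obtain A where A: "A \<subset> {..k}" "f' = cyc_perm A" by blast
    then have "bruhat_le f (dem_word (cyc_word B) lam) \<longleftrightarrow> A \<subseteq> B" if "B \<subset> {..k}" for B
      using *[OF that] that cyc_perm_inj by (metis order.strict_trans1 psubset_subset_trans)
    then show ?thesis using A by blast
  next
    case False
    then show ?thesis using * by (metis psubset_subset_trans order.strict_trans1)
  qed
qed

section \<open>The 0-Hecke calculation and Moebius inversion\<close>

lemma finite_bruhat_le:
  assumes "g \<in> aff" shows "finite {f. bruhat_le f g}"
proof -
  obtain s where s: "s \<in> coxeter_words k" "act s = g" "length s = len g" using assms by (rule reduced_E)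
  then have "{f. bruhat_le f g} \<subseteq> act ` set (subseqs s)" using bruhat_le_act_iff[OF s(1)] bruhat_le_aff[of _ g] assms by auto
  then show ?thesis by (rule finite_subset) simp
qed

text \<open>The coefficient at \<open>u\<close> of the sum over \<open>w \<le> lam\<close> of the products of the generators of the
  0-Hecke algebra with \<open>T\<^sub>s\<^sup>2 = - T\<^sub>s\<close> along \<open>t\<close> with \<open>T\<^sub>w\<close>. Its factors satisfy
  \<open>(1 + T\<^sub>s)\<^sup>2 = 1 + T\<^sub>s\<close>, and a product of these is the sum over a lower Bruhat interval.\<close>

definition hecke_coeff :: "(int \<Rightarrow> int) \<Rightarrow> nat list \<Rightarrow> (int \<Rightarrow> int) \<Rightarrow> int" where
  "hecke_coeff lam t u = (\<Sum>w | bruhat_le w lam \<and> dem_word t w = u. (- 1) ^ (length t + len w + len u))"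

lemma hecke_coeff_Nil: "lam \<in> aff \<Longrightarrow> hecke_coeff lam [] u = of_bool (bruhat_le u lam)"
proof -
  have "{w. bruhat_le w lam \<and> dem_word [] w = u} = (if bruhat_le u lam then {u} else {})" by auto
  then show ?thesis by (simp add: hecke_coeff_def mult_2[symmetric])
qed

text \<open>Left multiplication by \<open>T_i\<close>: a Demazure step arrives at \<open>u\<close>
  only if \<open>i\<close> is a left descent of \<open>u\<close>, and then from \<open>u\<close> or
  from \<open>sg (int i) \<circ> u\<close>. Staying at \<open>u\<close> adds a letter but no length,
  whence the minus sign.\<close>

lemma hecke_coeff_Cons:
  assumes "lam \<in> aff" "u \<in> aff"
  shows "hecke_coeff lam (i # t) u = (if len (sg (int i) \<circ> u) < len u
    then hecke_coeff lam t (sg (int i) \<circ> u) - hecke_coeff lam t u else 0)"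
proof -
  let ?s = "sg (int i)"
  have dem_step: "dem_step i v = u \<longleftrightarrow> len (?s \<circ> u) < len u \<and> (v = u \<or> v = ?s \<circ> u)" if "v \<in> aff" for v
  proof -
    have "v = ?s \<circ> u \<longleftrightarrow> ?s \<circ> v = u" by auto
    then show ?thesis using len_sg_neq[OF that, of "int i"] len_sg_neq[OF assms(2), of "int i"]
      by (auto simp: dem_step_def)
  qed
  have aff: "bruhat_le w lam \<Longrightarrow> dem_word t w \<in> aff" for w using assms bruhat_le_aff by simp
  show ?thesis
  proof (cases "len (?s \<circ> u) < len u")
    case False
    then have "{w. bruhat_le w lam \<and> dem_word (i # t) w = u} = {}" using dem_step aff by auto
    then show ?thesis using False by (simp only: hecke_coeff_def) simp
  next
    case True
    then have l: "len u = len (?s \<circ> u) + 1" using len_sg_cases[OF assms(2), of "int i"] by linarith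
    have e: "{w. bruhat_le w lam \<and> dem_word (i # t) w = u} =
        {w. bruhat_le w lam \<and> dem_word t w = ?s \<circ> u} \<union> {w. bruhat_le w lam \<and> dem_word t w = u}"
      using dem_step aff True by auto
    have ne: "?s \<circ> u \<noteq> u" using l by auto
    have fin: "finite {w. bruhat_le w lam \<and> P w}" for P
      using finite_bruhat_le[OF assms(1)] by (rule rev_finite_subset) auto
    have "hecke_coeff lam (i # t) u =
        (\<Sum>w | bruhat_le w lam \<and> dem_word t w = ?s \<circ> u. (- 1) ^ (length (i # t) + len w + len u)) +
        (\<Sum>w | bruhat_le w lam \<and> dem_word t w = u. (- 1) ^ (length (i # t) + len w + len u))"
      unfolding hecke_coeff_def e by (rule sum.union_disjoint) (use fin ne in auto)
    then show ?thesis using True by (simp add: hecke_coeff_def l sum_negf)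
  qed
qed

text \<open>The factor \<open>1 + T_i\<close> replaces the coefficient at \<open>u\<close> by the
  one at the shorter of \<open>u\<close> and its product with the generator; on the indicator of a
  lower ideal this is exactly a Demazure step.\<close>

lemma sum_subseqs_hecke_coeff:
  assumes "t \<in> coxeter_words k" "lam \<in> aff" "u \<in> aff"
  shows "(\<Sum>y\<leftarrow>subseqs t. hecke_coeff lam y u) = of_bool (bruhat_le u (dem_word t lam))"
  using assms
proof (induction t arbitrary: u rule: list.induct)
  case Nil then show ?case by (simp add: hecke_coeff_Nil)
next
  case (Cons i t)
  let ?s = "sg (int i)" and ?S = "\<lambda>u. \<Sum>y\<leftarrow>subseqs t. hecke_coeff lam y u"
  have t: "t \<in> coxeter_words k" "i \<le> k" using Cons.prems(1) by auto
  note IH = Cons.IH[OF t(1) assms(2)]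
  have "(\<Sum>y\<leftarrow>subseqs (i # t). hecke_coeff lam y u) =
      (\<Sum>y\<leftarrow>subseqs t. hecke_coeff lam (i # y) u) + ?S u"
    by (simp add: Let_def o_def)
  also have "(\<Sum>y\<leftarrow>subseqs t. hecke_coeff lam (i # y) u) =
      (if len (?s \<circ> u) < len u then ?S (?s \<circ> u) - ?S u else 0)"
    using Cons.prems by (simp add: hecke_coeff_Cons sum_list_subtractf)
  also have "\<dots> + ?S u = (if len (?s \<circ> u) < len u then ?S (?s \<circ> u) else ?S u)" by simp
  also have "\<dots> = of_bool (bruhat_le (if len (?s \<circ> u) < len u then ?s \<circ> u else u) (dem_word t lam))"
    using IH[of u] IH[of "?s \<circ> u"] Cons.prems(3) by (simp del: comp_apply)
  also have "\<dots> = of_bool (bruhat_le u (dem_word (i # t) lam))"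
  proof -
    have "bruhat_le (?s \<circ> u) u" if "len (?s \<circ> u) < len u" using bruhat_le_sg' that Cons.prems(3) by blast
    moreover have "bruhat_le u (?s \<circ> u)" if "\<not> len (?s \<circ> u) < len u"
      using bruhat_le_sg len_sg_neq[of u "int i"] that Cons.prems(3) by (meson linorder_neqE_nat)
    ultimately have "bruhat_le u (dem_word (i # t) lam) \<longleftrightarrow> bruhat_le (if len (?s \<circ> u) < len u then ?s \<circ> u else u) (dem_word t lam)"
      using bruhat_le_dem_step_iff[of u "dem_word t lam" i] Cons.prems bruhat_le_trans by (auto simp del: comp_apply)
    then show ?thesis by (simp del: dem_word_simps)
  qed
  finally show ?case .
qed

text \<open>Subsequences of \<open>cyc_word B\<close> correspond to subsets of \<open>B\<close>; the
  length and the Demazure action of each are those of the standard word of its subset.\<close>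

lemma sum_Pow_hecke_coeff:
  assumes "B \<subset> {..k}" "lam \<in> aff" "u \<in> aff"
  shows "(\<Sum>C\<in>Pow B. hecke_coeff lam (cyc_word C) u) = of_bool (bruhat_le u (dem_word (cyc_word B) lam))"
proof -
  note c = cyc_word[OF assms(1)]
  have h: "hecke_coeff lam y u = hecke_coeff lam (cyc_word (set y)) u" if "y \<in> set (subseqs (cyc_word B))" for y
  proof -
    have y: "cyclically_decreasing k y" using cyc_subseqs c that by blast
    have "length y = length (cyc_word (set y))"
      using length_cyc_word[OF cyc_proper[OF y]] distinct_card[OF cyc_distinct[OF y]] by simp
    moreover have "dem_word y w = dem_word (cyc_word (set y)) w" if "bruhat_le w lam" for w
      using dem_word_cyc[OF y] bruhat_le_aff[OF that assms(2)] by simp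
    then have "{w. bruhat_le w lam \<and> dem_word y w = u} = {w. bruhat_le w lam \<and> dem_word (cyc_word (set y)) w = u}" by auto
    ultimately show ?thesis by (simp add: hecke_coeff_def)
  qed
  have d: "distinct (map set (subseqs (cyc_word B)))" using distinct_set_subseqs c cyc_distinct by blast
  have "(\<Sum>C\<in>Pow B. hecke_coeff lam (cyc_word C) u) =
      (\<Sum>C\<leftarrow>map set (subseqs (cyc_word B)). hecke_coeff lam (cyc_word C) u)"
    using sum_list_distinct_conv_sum_set[OF d, of "\<lambda>C. hecke_coeff lam (cyc_word C) u"]
      subseqs_powset[of "cyc_word B"] c by (simp del: map_map)
  also have "\<dots> = (\<Sum>y\<leftarrow>subseqs (cyc_word B). hecke_coeff lam y u)"
    using h by (auto intro!: arg_cong[where f = sum_list] simp: o_def)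
  finally show ?thesis using sum_subseqs_hecke_coeff assms by simp
qed

lemma sum_card_hecke_coeff:
  assumes "lam \<in> aff" "u \<in> aff"
  shows "(\<Sum>C | C \<subset> {..k} \<and> card C \<le> r. hecke_coeff lam (cyc_word C) u) =
    of_bool (\<exists>A\<subset>{..k}. card A \<le> r \<and> bruhat_le u (dem_word (cyc_word A) lam))"
proof -
  have fin: "finite B" if "B \<subset> {..k}" for B using that finite_subset by blast
  have fins: "finite {C. C \<subset> {..k} \<and> P C}" for P by (rule finite_subset[of _ "Pow {..k}"]) auto
  note S = sum_Pow_hecke_coeff[OF _ assms]
  \<comment> \<open>\<open>A0\<close> is the least admissible set, or \<open>None\<close> if no set
    is admissible. The coefficients of proper subsets are known by induction, so the sum over
    \<open>Pow B\<close> isolates the one of \<open>B\<close>.\<close>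
  have mob: "hecke_coeff lam (cyc_word B) u = of_bool (A0 = Some B)"
    if A0: "\<And>B. B \<subset> {..k} \<Longrightarrow> bruhat_le u (dem_word (cyc_word B) lam) \<longleftrightarrow> (\<exists>A. A0 = Some A \<and> A \<subseteq> B)" and B: "B \<subset> {..k}" for A0 B
    using fin[OF B] B
  proof (induction B rule: finite_psubset_induct)
    case (psubset B)
    have p: "Pow B = insert B {C. C \<subset> B}" by auto
    have f: "finite {C. C \<subset> B}" using psubset.hyps by (rule_tac finite_subset[of _ "Pow B"]) auto
    have "of_bool (\<exists>A. A0 = Some A \<and> A \<subseteq> B) = (\<Sum>C\<in>Pow B. hecke_coeff lam (cyc_word C) u)"
      using S[OF psubset.prems] A0[OF psubset.prems] by simp
    also have "\<dots> = hecke_coeff lam (cyc_word B) u + (\<Sum>C | C \<subset> B. hecke_coeff lam (cyc_word C) u)"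
      unfolding p using f by simp
    also have "(\<Sum>C | C \<subset> B. hecke_coeff lam (cyc_word C) u) = (\<Sum>C | C \<subset> B. of_bool (A0 = Some C))"
      using psubset by (intro sum.cong) auto
    also have "\<dots> = of_bool (\<exists>A. A0 = Some A \<and> A \<subset> B)"
    proof (cases A0)
      case (Some A)
      then have "(\<Sum>C | C \<subset> B. of_bool (A0 = Some C)) = (\<Sum>C | C \<subset> B. if C = A then 1 else 0 :: int)"
        by (intro sum.cong) auto
      then show ?thesis using f Some by simp
    qed simp
    finally show ?case by (cases A0) (auto simp: of_bool_def split: if_splits)
  qed
  from principal_filter[OF assms] show ?thesis
  proof
    assume "\<exists>A\<subset>{..k}. \<forall>B\<subset>{..k}. bruhat_le u (dem_word (cyc_word B) lam) \<longleftrightarrow> A \<subseteq> B"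
    then obtain A where A: "A \<subset> {..k}" "\<And>B. B \<subset> {..k} \<Longrightarrow> bruhat_le u (dem_word (cyc_word B) lam) \<longleftrightarrow> A \<subseteq> B" by blast
    have "(\<Sum>C | C \<subset> {..k} \<and> card C \<le> r. hecke_coeff lam (cyc_word C) u) =
        (\<Sum>C | C \<subset> {..k} \<and> card C \<le> r. if C = A then 1 else 0)"
      using mob[of "Some A"] A by (intro sum.cong) auto
    also have "\<dots> = of_bool (card A \<le> r)" using fins A by simp
    also have "card A \<le> r \<longleftrightarrow> (\<exists>B\<subset>{..k}. card B \<le> r \<and> bruhat_le u (dem_word (cyc_word B) lam))"
      using A fin by (meson card_mono order_refl order_trans)
    finally show ?thesis .
  next
    assume n: "\<forall>B\<subset>{..k}. \<not> bruhat_le u (dem_word (cyc_word B) lam)"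
    have "(\<Sum>C | C \<subset> {..k} \<and> card C \<le> r. hecke_coeff lam (cyc_word C) u) = 0"
      using mob[of None] n by (intro sum.neutral) auto
    then show ?thesis using n by auto
  qed
qed

section \<open>Affine Grassmannian elements and weak strips\<close>

text \<open>On the abacus with bead set \<open>f ` {..0}\<close>, the beads are the \<open>z\<close> with \<open>level f z < 0\<close>.\<close>

definition level :: "(int \<Rightarrow> int) \<Rightarrow> int \<Rightarrow> int" where
  "level f z = (pinv f z - 1) div N"

lemma N_pos: "0 < N"
  using N_ge2 by simp

lemma level_add [simp]: "f \<in> aff \<Longrightarrow> level f (z + c * N) = level f z + c"
  using aff_period[of "pinv f" z c] N_pos
  by (simp add: level_def) (metis add_diff_eq diff_add_eq div_mult_self1 add.commute less_irrefl)

lemma level_comp: "h \<in> aff \<Longrightarrow> f \<in> aff \<Longrightarrow> level (h \<circ> f) z = level f (pinv h z)"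
  by (simp add: level_def pinv_o)

lemma level_comp_act: "h \<in> aff \<Longrightarrow> f \<in> aff \<Longrightarrow> level (h \<circ> f) (h z) = level f z"
  by (simp add: level_comp)

lemma level_mono: "pinv f y \<le> pinv f z \<Longrightarrow> level f y \<le> level f z"
  unfolding level_def using N_pos by (intro zdiv_mono1) auto

lemma level_less: "level f y < level f z \<Longrightarrow> pinv f y < pinv f z"
  using level_mono[of f z y] by linarith

lemma level_up: "f \<in> aff \<Longrightarrow> level f z < level f (z + 1) \<Longrightarrow> len f < len (sg z \<circ> f)"
  by (simp add: len_up level_less)

text \<open>By \<open>sg_mono\<close>, a generator spoils monotonicity on the window only by
  exchanging consecutive values \<open>f j\<close> and \<open>f (j + 1)\<close>.\<close>

lemma sg_comp_Gr:
  assumes "f \<in> Gr"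
    and "\<And>j c. \<lbrakk>j \<in> {1..int k}; f j = z + c * N; f (j + 1) = z + 1 + c * N\<rbrakk> \<Longrightarrow> False"
  shows "sg z \<circ> f \<in> Gr"
proof -
  have "sg z (f j) < sg z (f (j + 1))" if j: "j \<in> {1..int k}" for j
  proof (rule sg_mono)
    show "f j < f (j + 1)" using GrD[OF assms(1)] j by simp
    show "\<not> (cg (f j) z \<and> f (j + 1) = f j + 1)"
    proof
      assume *: "cg (f j) z \<and> f (j + 1) = f j + 1"
      then obtain c where "f j = z + c * N" using cg_E by blast
      then show False using assms(2)[OF j, of c] * by simp
    qed
  qed
  then show ?thesis using assms(1) by (intro GrI) auto
qed

lemma level_window: "f \<in> aff \<Longrightarrow> j \<in> {1..N} \<Longrightarrow> level f (f j) = 0"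
  by (simp add: level_def)

text \<open>All values on the window have level \<open>0\<close>, so a strict rise of level keeps
  \<open>z\<close> and \<open>z + 1\<close> from being, up to a common translation, both window
  values.\<close>

lemma Gr_up:
  assumes "f \<in> Gr" "level f z < level f (z + 1)" shows "sg z \<circ> f \<in> Gr"
proof (rule sg_comp_Gr[OF assms(1)])
  fix j c assume *: "j \<in> {1..int k}" "f j = z + c * N" "f (j + 1) = z + 1 + c * N"
  have a: "f \<in> aff" using assms by simp
  have "j \<in> {1..N}" "j + 1 \<in> {1..N}" using *(1) by (auto simp: N_def)
  then have "level f (f j) = 0" "level f (f (j + 1)) = 0" using level_window[OF a] by blast+
  then show False using * assms level_add[OF a, of z c] level_add[OF a, of "z + 1" c] by simp
qed

text \<open>If the generator exchanged consecutive window values, it would lengthen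
  \<open>f\<close>.\<close>

lemma Gr_down:
  assumes "f \<in> Gr" "len (sg z \<circ> f) < len f" shows "sg z \<circ> f \<in> Gr"
proof (rule sg_comp_Gr[OF assms(1)])
  fix j c assume *: "j \<in> {1..int k}" "f j = z + c * N" "f (j + 1) = z + 1 + c * N"
  have a: "f \<in> aff" using assms by simp
  have "pinv f (f j) = j" "pinv f (f (j + 1)) = j + 1" using a by simp_all
  then have "pinv f z + c * N = j" "pinv f (z + 1) + c * N = j + 1"
    using * aff_period[of "pinv f" z c] aff_period[of "pinv f" "z + 1" c] a by simp_all
  then show False using assms(2) len_down[OF a, of z] by simp
qed

lemma bruhat_le_pinv: "bruhat_le f g \<Longrightarrow> bruhat_le (pinv f) (pinv g)"
  unfolding bruhat_le_def
  by (induction rule: rtranclp_induct) (auto intro: bruhat_step_pinv rtranclp.rtrancl_into_rtrancl)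

text \<open>For the inverses this concerns a left Demazure step; the ascent of \<open>u\<close> at
  \<open>j\<close> makes \<open>u\<close> the smaller of \<open>u\<close> and
  \<open>u \<circ> sg j\<close>.\<close>

lemma bruhat_le_right_cancel:
  assumes "u \<in> aff" "w \<in> aff" "u j < u (j + 1)" "w j < w (j + 1)" "bruhat_le u (w \<circ> sg j)"
  shows "bruhat_le u w"
proof -
  have "len (pinv w) < len (sg j \<circ> pinv w)" using assms len_up[of "pinv w" j] by (simp del: len_pinv)
  then have "dem_step (letter j) (pinv w) = sg j \<circ> pinv w" by (simp add: dem_step_def sg_letter)
  moreover have "bruhat_le (pinv u) (sg j \<circ> pinv w)" using bruhat_le_pinv[OF assms(5)] assms by (simp add: pinv_o)
  ultimately have "bruhat_le (pinv u) (pinv w) \<or> bruhat_le (sg j \<circ> pinv u) (pinv w)"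
    using bruhat_le_dem_step_iff[of "pinv u" "pinv w" "letter j"] assms by (simp add: sg_letter)
  moreover have "bruhat_le (pinv u) (sg j \<circ> pinv u)" using assms len_up[of "pinv u" j] by (intro bruhat_le_sg) auto
  ultimately have "bruhat_le (pinv u) (pinv w)" using bruhat_le_trans by blast
  then show ?thesis using bruhat_le_pinv[of "pinv u" "pinv w"] assms by simp
qed

text \<open>If the generator lengthens \<open>w\<close> although the level does not rise, then
  \<open>i\<close> and \<open>i + 1\<close> have equal level, and left multiplication equals right
  multiplication by some \<open>sg j\<close> with \<open>j\<close> in \<open>{1..k}\<close>. Such a
  factor puts no new Grassmannian element below.\<close>

lemma bruhat_le_dem_step_Gr:
  assumes "w \<in> Gr" "u \<in> Gr" "\<not> level w (int i) < level w (int i + 1)" "bruhat_le u (dem_step i w)"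
  shows "bruhat_le u w"
proof (cases "len w < len (sg (int i) \<circ> w)")
  case False then show ?thesis using assms by (simp add: dem_step_def)
next
  case True
  let ?z = "int i"
  have a: "w \<in> aff" "u \<in> aff" using assms by auto
  have lt: "pinv w ?z < pinv w (?z + 1)" using True a len_up by blast
  then have qe: "level w ?z = level w (?z + 1)" using level_mono[of w ?z "?z + 1"] assms(3) by simp
  \<comment> \<open>Translation by \<open>c * N\<close> moves the preimages of \<open>i\<close> and
    \<open>i + 1\<close> into the window; since \<open>w\<close> increases there and takes
    neighbouring values, they are neighbours themselves.\<close>
  define c j where "c = level w ?z" and "j = pinv w ?z - c * N"
  have "(pinv w ?z - 1) div N = c" "(pinv w (?z + 1) - 1) div N = c" using qe by (auto simp: level_def c_def)
  then have b: "c * N \<le> pinv w ?z - 1" "pinv w (?z + 1) - 1 < c * N + N"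
    using N_pos by (metis div_mult_mod_eq pos_mod_sign le_add_same_cancel1,
        metis div_mult_mod_eq pos_mod_bound add_strict_left_mono)
  have wj: "w j + c * N = ?z"
    using aff_period[OF a(1), of j c] a by (simp add: j_def)
  have j: "j \<in> {1..int k}" using b lt by (simp add: j_def N_def)
  define j' where "j' = pinv w (?z + 1) - c * N"
  have j': "w j' = w j + 1" "j < j'" "j' \<in> {1..int k + 1}"
    using aff_period[OF a(1), of j' c] a wj b lt by (auto simp: j_def j'_def N_def)
  have mono: "w x < w y" if "x < y" "1 \<le> x" "y \<le> int k + 1" for x y
    using that
  proof (induction "nat (y - x)" arbitrary: y rule: less_induct)
    case less
    show ?case
    proof (cases "y = x + 1")
      case True then show ?thesis using GrD[OF assms(1), of x] less.prems by simp
    next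
      case False
      then have "w x < w (y - 1)" using less by auto
      moreover have "w (y - 1) < w (y - 1 + 1)" using GrD[OF assms(1), of "y - 1"] less.prems False by simp
      ultimately show ?thesis by simp
    qed
  qed
  have "j' = j + 1"
  proof (rule ccontr)
    assume "j' \<noteq> j + 1"
    then have "j + 1 < j'" using j'(2) by simp
    then have "w j < w (j + 1)" "w (j + 1) < w j'" using mono[of j "j + 1"] mono[of "j + 1" j'] j j'(3) by auto
    then show False using j' by simp
  qed
  then have "w \<circ> sg j = sg (w j) \<circ> w" using transp_conj[OF a(1), of j "j + 1"] j' by (simp add: sg_transp)
  also have "sg (w j) = sg ?z" using wj sg_cong cg_mult(1)[of "w j" c "w j"] by (metis cg_refl)
  finally have "bruhat_le u (w \<circ> sg j)" using assms(4) True by (simp add: dem_step_def del: comp_apply)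
  then show ?thesis using bruhat_le_right_cancel[of u w j] a GrD[of _ j] assms(1,2) j by simp
qed

text \<open>If \<open>u\<close> is below the Demazure step but not below \<open>y\<close>, the
  generator shortens \<open>u\<close> and keeps it Grassmannian, so the hypothesis on
  \<open>w\<close> covers the shortened element.\<close>

lemma bruhat_le_dem_step_Gr_step:
  assumes "w \<in> Gr" "y \<in> aff" "\<And>u. u \<in> Gr \<Longrightarrow> bruhat_le u y \<Longrightarrow> bruhat_le u w" "u \<in> Gr" "bruhat_le u (dem_step i y)"
  shows "bruhat_le u (if level w (int i) < level w (int i + 1) then sg (int i) \<circ> w else w)"
proof -
  let ?s = "sg (int i)"
  have a: "w \<in> aff" "u \<in> aff" using assms by auto
  have "bruhat_le u (dem_step i w)"
  proof (cases "bruhat_le u y")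
    case True
    then show ?thesis using assms(3,4) bruhat_le_dem_step_iff a by blast
  next
    case False
    then have s: "bruhat_le (?s \<circ> u) y" using bruhat_le_dem_step_iff[OF a(2) assms(2)] assms(5) by blast
    then have "\<not> bruhat_le u (?s \<circ> u)" using False bruhat_le_trans by blast
    then have "len (?s \<circ> u) < len u" using bruhat_le_sg[OF a(2)] len_sg_neq[OF a(2)] by (meson linorder_neqE_nat)
    then have "bruhat_le (?s \<circ> u) w" using assms(3)[OF _ s] Gr_down assms(4) by blast
    then show ?thesis using bruhat_le_dem_step_iff a by blast
  qed
  then show ?thesis using bruhat_le_dem_step_Gr[OF assms(1,4)] level_up[OF a(1)] by (auto simp: dem_step_def)
qed

section \<open>Level conditions for weak strips\<close>

text \<open>In terms of runners: the first runner of every block of \<open>A\<close> is strictly ahead of all runners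
  that it passes, which makes \<open>d\<^sub>A f\<close> over \<open>f\<close> a weak strip.\<close>

definition good :: "(int \<Rightarrow> int) \<Rightarrow> nat set \<Rightarrow> bool" where
  "good f A \<longleftrightarrow> (\<forall>a m. letter (a - 1) \<notin> A \<longrightarrow> (\<forall>j<m. letter (a + int j) \<in> A) \<longrightarrow> 0 < m \<longrightarrow>
     level f a < level f (a + int m))"

lemma goodD:
  "good f A \<Longrightarrow> letter (a - 1) \<notin> A \<Longrightarrow> (\<And>j. j < m \<Longrightarrow> letter (a + int j) \<in> A) \<Longrightarrow> 0 < m \<Longrightarrow>
     level f a < level f (a + int m)"
  by (simp add: good_def)

lemma pinv_eqI: "f \<in> aff \<Longrightarrow> f x = y \<Longrightarrow> pinv f y = x"
  by auto

lemma act_cyc_fix: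
  "cyclically_decreasing k x \<Longrightarrow> letter (z - 1) \<notin> set x \<Longrightarrow> letter z \<notin> set x \<Longrightarrow> act x z = z"
  using act_cyc_up[of x z 0] by simp

text \<open>The letter \<open>i\<close> closes a run that starts at the preimage of \<open>i\<close>
  under \<open>act x\<close>, and only this run yields a new condition. For
  \<open>act x \<circ> f\<close> it says that the level rises strictly from \<open>i\<close> to
  \<open>i + 1\<close>.\<close>

lemma good_Cons:
  assumes "cyclically_decreasing k (i # x)" "f \<in> aff"
  shows "good f (set (i # x)) \<longleftrightarrow>
    good f (set x) \<and> level f (pinv (act x) (int i)) < level f (int i + 1)"
proof -
  have c: "i \<le> k" "i \<notin> set x" "letter (int i + 1) \<notin> set x" "cyclically_decreasing k x"
    using assms by (auto simp: cyc_Cons)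
  have aff: "act x \<in> aff" using c cyc_words by simp
  have next_i: "letter (y + 1) = letter (int i + 1)" if "letter y = i" for y
    using letter_shift[of y "int i" 1] that c(1) by simp
  have nin: "letter (int i + 1) \<notin> set (i # x)" using c letter_Suc[of "int i"] by auto
  show ?thesis
  proof (intro iffI conjI)
    assume g: "good f (set (i # x))"
    show "good f (set x)" unfolding good_def
    proof (intro allI impI)
      fix a m assume *: "letter (a - 1) \<notin> set x" "\<forall>j<m. letter (a + int j) \<in> set x" "0 < m"
      have "letter a \<in> set x" using *(2,3) by force
      then have "letter (a - 1) \<noteq> i" using next_i[of "a - 1"] c by auto
      then show "level f a < level f (a + int m)" using goodD[OF g, of a m] * by simp
    qed
    define a where "a = pinv (act x) (int i)"
    have a: "act x a = int i" using aff by (simp add: a_def)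
    have la: "letter (a - 1) \<notin> set x"
    proof
      assume *: "letter (a - 1) \<in> set x"
      then have "a - 1 = int i" using act_cyc_down[OF c(4) *] a by simp
      then show False using * c by simp
    qed
    obtain m where m: "\<forall>j<m. letter (a + int j) \<in> set x" "letter (a + int m) \<notin> set x"
      using run_exists[OF cyc_proper[OF c(4)]] .
    then have am: "a + int m = int i" using act_cyc_up[OF c(4) la m] a by simp
    have "letter (a - 1) \<noteq> i"
    proof
      assume "letter (a - 1) = i"
      then have l: "letter a = letter (int i + 1)" using next_i[of "a - 1"] by simp
      show False
      proof (cases "m = 0")
        case True then show False using am l letter_Suc[of "int i"] by simp
      next
        case False then have "letter a \<in> set x" using m(1) by force
        then show False using l c by simp
      qed
    qed
    moreover have "letter (a + int j) \<in> set (i # x)" if "j < Suc m" for j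
    proof (cases "j = m")
      case True then show ?thesis using am c by simp
    next
      case False then show ?thesis using m that by simp
    qed
    ultimately have "level f a < level f (a + int (Suc m))" using goodD[OF g, of a "Suc m"] la by simp
    moreover have "a + int (Suc m) = int i + 1" using am by simp
    ultimately show "level f (pinv (act x) (int i)) < level f (int i + 1)" unfolding a_def[symmetric] by metis
  next
    assume g: "good f (set x) \<and> level f (pinv (act x) (int i)) < level f (int i + 1)"
    show "good f (set (i # x))" unfolding good_def
    proof (intro allI impI)
      fix a m assume *: "letter (a - 1) \<notin> set (i # x)" "\<forall>j<m. letter (a + int j) \<in> set (i # x)" "0 < m"
      show "level f a < level f (a + int m)"
      proof (cases "\<exists>j<m. letter (a + int j) = i")
        case False
        then have "letter (a + int j) \<in> set x" if "j < m" for j using * that by auto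
        then show ?thesis using goodD[of f "set x" a m] g * by simp
      next
        case True
        have last: "Suc j = m" if j: "j < m" "letter (a + int j) = i" for j
        proof (rule ccontr)
          assume "Suc j \<noteq> m"
          then have "letter (a + int (Suc j)) \<in> set (i # x)" using * j by (meson Suc_lessI)
          moreover have "letter (a + int (Suc j)) = letter (int i + 1)"
            using next_i[OF j(2)] by (simp add: algebra_simps)
          ultimately show False using nin by simp
        qed
        from True obtain j where j: "j < m" "letter (a + int j) = i" by blast
        then have m: "m = Suc j" using last by simp
        have "letter (a + int j') \<in> set x" if "j' < j" for j'
        proof -
          have "letter (a + int j') \<noteq> i" using last[of j'] that m by auto
          moreover have "letter (a + int j') \<in> set (i # x)" using *(2) that m by simp
          ultimately show ?thesis by simp
        qed
        then have "act x a = a + int j" using act_cyc_up[OF c(4), of a j] * j c by simp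
        moreover obtain d where d: "a + int j = int i + d * N"
          using j(2) letter_eq_iff[OF c(1)] cg_E by metis
        ultimately have "act x (a + (- d) * N) = int i" using aff_period[OF aff, of a "- d"] by simp
        then have "pinv (act x) (int i) = a + (- d) * N" using pinv_eqI[OF aff] by blast
        then have "level f (a + (- d) * N) < level f (int i + 1)" using g by simp
        moreover have "int i + 1 = (a + int m) + (- d) * N" using d m by simp
        ultimately have "level f a + (- d) < level f (a + int m) + (- d)"
          using level_add[OF assms(2), of a "- d"] level_add[OF assms(2), of "a + int m" "- d"] by metis
        then show ?thesis by simp
      qed
    qed
  qed
qed

lemma act_cyc_Cons_Suc:
  assumes "cyclically_decreasing k (i # x)" shows "pinv (act x) (int i + 1) = int i + 1"
  using assms act_cyc_fix[of x "int i + 1"] cyc_words[of x] by (intro pinv_eqI) (auto simp: cyc_Cons)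

text \<open>Each letter acts at a strict rise of level, so by \<open>Gr_up\<close> and
  \<open>level_up\<close> the element grows in length and stays Grassmannian.\<close>

lemma good_weak_strip:
  assumes "cyclically_decreasing k x" "f \<in> Gr" "good f (set x)"
  shows "act x \<circ> f \<in> Gr \<and> len (act x \<circ> f) = length x + len f \<and> dem_word x f = act x \<circ> f"
  using assms
proof (induction x rule: list.induct)
  case Nil then show ?case by simp
next
  case (Cons i x)
  have c: "cyclically_decreasing k x" "act x \<in> aff" using Cons.prems cyc_words by (auto simp: cyc_Cons)
  have f: "f \<in> aff" using assms by simp
  have g: "good f (set x)" "level f (pinv (act x) (int i)) < level f (int i + 1)"
    using Cons.prems f good_Cons by blast+
  define h where "h = act x \<circ> f"
  have IH: "h \<in> Gr" "len h = length x + len f" "dem_word x f = h" using Cons.IH[OF c(1) Cons.prems(2) g(1)] unfolding h_def by blast+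
  have ha: "h \<in> aff" using IH by simp
  have "level h (int i) < level h (int i + 1)" unfolding h_def
    using g c f act_cyc_Cons_Suc[OF Cons.prems(1)] by (simp add: level_comp)
  then have "sg (int i) \<circ> h \<in> Gr" "len h < len (sg (int i) \<circ> h)" using Gr_up level_up IH ha by blast+
  moreover from this have "len (sg (int i) \<circ> h) = len h + 1" using len_sg_cases[OF ha, of "int i"] by linarith
  moreover have "act (i # x) \<circ> f = sg (int i) \<circ> h" by (simp add: h_def comp_assoc)
  ultimately have "act (i # x) \<circ> f \<in> Gr \<and> len (act (i # x) \<circ> f) = length (i # x) + len f \<and> dem_word (i # x) f = act (i # x) \<circ> f"
    using IH by (simp add: dem_step_def del: act_simps)
  then show ?case .
qed

text \<open>A greedy choice: reading \<open>t\<close> from the right, a letter is kept only where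
  the level rises strictly. A dropped letter adds no Grassmannian element to the lower
  ideal.\<close>

lemma demazure_le_weak_strip:
  assumes "cyclically_decreasing k t" "w \<in> Gr"
  shows "\<exists>y. cyclically_decreasing k y \<and> set y \<subseteq> set t \<and> good w (set y) \<and>
     (\<forall>u\<in>Gr. bruhat_le u (dem_word t w) \<longrightarrow> bruhat_le u (act y \<circ> w))"
  using assms(1)
proof (induction t rule: list.induct)
  case Nil
  have "good w (set [])" by (auto simp: good_def)
  then show ?case by (intro exI[of _ "[]"]) auto
next
  case (Cons i t)
  have t: "cyclically_decreasing k t" using Cons.prems by (simp add: cyc_Cons)
  then obtain y where y: "cyclically_decreasing k y" "set y \<subseteq> set t" "good w (set y)"
    "\<And>u. u \<in> Gr \<Longrightarrow> bruhat_le u (dem_word t w) \<Longrightarrow> bruhat_le u (act y \<circ> w)" using Cons.IH by blast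
  define v where "v = act y \<circ> w"
  have v: "v \<in> Gr" using good_weak_strip[OF y(1) assms(2) y(3)] by (simp add: v_def)
  have a: "w \<in> aff" "act y \<in> aff" using assms y cyc_words by auto
  have ci: "cyclically_decreasing k (i # y)" using Cons.prems y by (auto simp: cyc_Cons)
  have step: "bruhat_le u (if level v (int i) < level v (int i + 1) then sg (int i) \<circ> v else v)"
    if "u \<in> Gr" "bruhat_le u (dem_word (i # t) w)" for u
    using bruhat_le_dem_step_Gr_step[OF v, of "dem_word t w" u i] y(4) that a by (simp add: v_def del: comp_apply)
  show ?case
  proof (cases "level v (int i) < level v (int i + 1)")
    case True
    then have "level w (pinv (act y) (int i)) < level w (int i + 1)"
      using act_cyc_Cons_Suc[OF ci] a by (simp add: v_def level_comp)
    then have "good w (set (i # y))" using good_Cons[OF ci a(1)] y by blast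
    moreover have "act (i # y) \<circ> w = sg (int i) \<circ> v" by (simp add: v_def comp_assoc)
    ultimately show ?thesis using step True ci y(2) by (intro exI[of _ "i # y"]) (auto simp del: act_simps comp_apply)
  next
    case False
    then show ?thesis using step y by (intro exI[of _ y]) (auto simp: v_def simp del: comp_apply)
  qed
qed

text \<open>The new letter sits just behind the possibly empty run starting at \<open>a\<close> and
  joins it to the run that follows. The joined condition chains \<open>lt\<close> with the condition
  on the following run.\<close>

lemma good_insert:
  assumes "w \<in> aff" "good w C" "C \<subset> {..k}" "card C < k"
    and a: "letter (a - 1) \<notin> C" "\<And>j. j < m \<Longrightarrow> letter (a + int j) \<in> C" "letter (a + int m) \<notin> C"
    and lt: "level w a < level w (a + int m + 1)"
  shows "good w (insert (letter (a + int m)) C)"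
  unfolding good_def
proof (intro allI impI)
  define i where "i = letter (a + int m)"
  fix b m' assume b: "letter (b - 1) \<notin> insert (letter (a + int m)) C"
    "\<forall>j<m'. letter (b + int j) \<in> insert (letter (a + int m)) C" "0 < m'"
  note b = b[folded i_def]
  show "level w b < level w (b + int m')"
  proof (cases "\<exists>j<m'. letter (b + int j) = i")
    case False
    then show ?thesis using goodD[OF assms(2), of b m'] b by auto
  next
    case True
    then obtain j where j: "j < m'" "letter (b + int j) = i" by blast
    have fin: "finite C" using assms(3) finite_subset by blast
    \<comment> \<open>Some letter \<open>c\<close> stays outside, so a run of the enlarged set is
      shorter than a full turn and meets \<open>i\<close> at most once.\<close>
    have "card (insert i C) < card {..k}" using assms(4) fin by (simp add: card_insert_if)
    moreover have "insert i C \<subseteq> {..k}" using assms(3) by (auto simp: i_def)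
    ultimately obtain c where c: "c \<le> k" "c \<notin> insert i C" by (metis atMost_iff card_mono finite_atMost finite_subset leD subset_eq)
    have uniq: "j1 = j2" if "j1 < m'" "j2 < m'" "letter (b + int j1) = i" "letter (b + int j2) = i" for j1 j2
    proof -
      have "\<not> j1 < j2" if j12: "j2 < m'" "letter (b + int j1) = i" "letter (b + int j2) = i" for j1 j2
      proof
        assume lt: "j1 < j2"
        have "cg (b + int j2) (b + int j1)" using j12 letter_cong by simp
        then have d: "N \<le> int j2 - int j1" using lt cg_near[of "b + int j2" "b + int j1"] by fastforce
        define e where "e = nat ((int c - (b + int j1)) mod N)"
        have e: "int e < N" "letter (b + int (j1 + e)) = c"
          using N_pos letter_reach[OF c(1), of "b + int j1"] by (auto simp: e_def add.assoc)
        then have "j1 + e < m'" using d j12(1) by simp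
        then show False using b(2) e c by metis
      qed
      then show ?thesis using that by (meson nat_neq_iff)
    qed
    have other: "letter (b + int j') \<in> C" if "j' < m'" "j' \<noteq> j" for j'
      using b(2) uniq[of j' j] that j by auto
    obtain d where d: "b + int j = a + int m + d * N"
      using j(2) letter_cong cg_E unfolding i_def by metis
    have per: "letter (a + z) = letter (b + (int j - int m) + z)" for z
    proof -
      have "b + (int j - int m) + z = a + z + d * N" using d by simp
      then show ?thesis using letter_add by metis
    qed
    \<comment> \<open>The enlarged run begins, up to translation, at \<open>a\<close>: otherwise
      \<open>C\<close> would contain the letter before one of the two starts.\<close>
    have "j = m"
    proof (rule linorder_cases[of j m])
      assume "j < m"
      then have "m - j - 1 < m" by simp
      then have "letter (a + int (m - j - 1)) \<in> C" by (rule a(2))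
      then have "letter (b - 1) \<in> C" using per[of "int (m - j - 1)"] \<open>j < m\<close> by (simp add: of_nat_diff)
      then show ?thesis using b by simp
    next
      assume "m < j"
      then have "letter (b + int (j - m - 1)) \<in> C" using other[of "j - m - 1"] j by simp
      then have "letter (a - 1) \<in> C" using per[of "-1"] \<open>m < j\<close> by (simp add: of_nat_diff algebra_simps)
      then show ?thesis using a by simp
    qed
    then have bd: "b = a + d * N" using d by simp
    have q1: "level w b < level w (b + int m + 1)"
      using lt level_add[OF assms(1), of a d] level_add[OF assms(1), of "a + int m + 1" d] by (simp add: bd add_ac)
    show ?thesis
    proof (cases "m' = Suc m")
      case True then show ?thesis using q1 by (simp add: add_ac)
    next
      case False
      define n where "n = m' - Suc m"
      have n: "0 < n" "m' = Suc m + n" using False j \<open>j = m\<close> by (auto simp: n_def)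
      have "letter ((b + int m + 1) - 1) \<notin> C" using a(3) bd letter_add[of "a + int m" d] by (simp add: add_ac)
      moreover have "letter ((b + int m + 1) + int j') \<in> C" if "j' < n" for j'
        using other[of "Suc m + j'"] that n \<open>j = m\<close> by (simp add: add_ac)
      ultimately have "level w (b + int m + 1) < level w (b + int m + 1 + int n)"
        using goodD[OF assms(2)] n(1) by blast
      then show ?thesis using q1 n(2) by (simp add: add_ac)
    qed
  qed
qed

text \<open>Otherwise the levels would weakly decrease from block to block, although they increase by one
  after a full turn.\<close>

lemma good_extend:
  assumes "w \<in> aff" "good w C" "C \<subset> {..k}" "card C < k"
  shows "\<exists>i\<le>k. i \<notin> C \<and> good w (insert i C)"
proof (rule ccontr)
  assume no: "\<not> ?thesis"
  \<comment> \<open>Both points are starts of possibly empty runs. By \<open>good_insert\<close>, a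
    rise of level between successive starts would give an admissible letter.\<close>
  have step: "level w a \<ge> level w b" if "a \<le> b" "letter (a - 1) \<notin> C" "letter (b - 1) \<notin> C" for a b
    using that
  proof (induction "nat (b - a)" arbitrary: a rule: less_induct)
    case less
    show ?case
    proof (cases "a = b")
      case False
      obtain m where m: "\<forall>j<m. letter (a + int j) \<in> C" "letter (a + int m) \<notin> C"
        using run_exists[OF assms(3)] .
      have "\<not> level w a < level w (a + int m + 1)"
        using good_insert[OF assms less.prems(2), of m] m no letter_le by blast
      moreover have "a + int m < b"
      proof (rule ccontr)
        assume "\<not> a + int m < b"
        then have "nat (b - 1 - a) < m" using False less.prems(1) by simp
        then have "letter (a + int (nat (b - 1 - a))) \<in> C" using m(1) by blast
        then show False using less.prems False by simp
      qed
      ultimately show ?thesis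
        using less.hyps[of "a + int m + 1"] less.prems m(2) by (smt (verit) add_diff_cancel_right' nat_mono_iff of_nat_0_le_iff)
    qed simp
  qed
  obtain c where "c \<le> k" "c \<notin> C" using assms(3) by auto
  then have "letter (int c + 1 - 1) \<notin> C" by simp
  moreover from this have "letter (int c + 1 + 1 * N - 1) \<notin> C" using letter_add[of "int c" 1] by (simp add: add_ac)
  ultimately have "level w (int c + 1 + 1 * N) \<le> level w (int c + 1)" using step N_pos by simp
  then show False using level_add[OF assms(1), of "int c + 1" 1] by simp
qed

lemma good_extend_card:
  assumes "w \<in> aff" "good w C" "C \<subset> {..k}" "card C \<le> r" "r \<le> k"
  shows "\<exists>D. C \<subseteq> D \<and> D \<subset> {..k} \<and> card D = r \<and> good w D"
  using assms
proof (induction "r - card C" arbitrary: C)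
  case 0 then show ?case by (intro exI[of _ C]) auto
next
  case (Suc d)
  have lt: "card C < r" using Suc.hyps(2) by simp
  then obtain i where i: "i \<le> k" "i \<notin> C" "good w (insert i C)"
    using good_extend[OF Suc.prems(1,2,3)] Suc.prems by auto
  have fin: "finite C" using Suc.prems(3) finite_subset by blast
  have card: "card (insert i C) = Suc (card C)" using fin i by simp
  then have "insert i C \<noteq> {..k}" using lt Suc.prems(5) by (metis Suc_leI card_atMost bruhat_le_trans not_less_eq_eq)
  then have "insert i C \<subset> {..k}" using Suc.prems(3) i by auto
  moreover have "d = r - card (insert i C)" "card (insert i C) \<le> r" using Suc.hyps(2) card lt by auto
  ultimately obtain D where "insert i C \<subseteq> D" "D \<subset> {..k}" "card D = r" "good w D"
    using Suc.hyps(1)[of "insert i C"] Suc.prems i by blast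
  then show ?case by blast
qed

text \<open>The strip found inside \<open>A\<close> may be smaller than \<open>r\<close>; enlarging
  its letter set to size \<open>r\<close> only enlarges the element in strong order.\<close>

lemma weak_strip_iff:
  assumes "w \<in> Gr" "u \<in> Gr" "r \<le> k"
  shows "(\<exists>A\<subset>{..k}. card A \<le> r \<and> bruhat_le u (dem_word (cyc_word A) w)) \<longleftrightarrow>
    (\<exists>A\<subset>{..k}. card A = r \<and> cyc_perm A \<circ> w \<in> Gr \<and> len (cyc_perm A \<circ> w) = r + len w \<and> bruhat_le u (cyc_perm A \<circ> w))"
proof
  have wa: "w \<in> aff" using assms by simp
  have dA_le: "bruhat_le (cyc_perm C \<circ> w) (dem_word (cyc_word A) w)" if "C \<subseteq> A" "A \<subset> {..k}" for A C
  proof -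
    have "cyc_perm C \<in> act ` set (subseqs (cyc_word A))" using act_subseqs_cyc[OF cyc_word(1)] cyc_word(2) that by auto
    then show ?thesis using dem_word_ge[of "cyc_word A" w _ w] that wa by auto
  qed
  show "\<exists>A\<subset>{..k}. card A = r \<and> cyc_perm A \<circ> w \<in> Gr \<and> len (cyc_perm A \<circ> w) = r + len w \<and> bruhat_le u (cyc_perm A \<circ> w)"
    if "\<exists>A\<subset>{..k}. card A \<le> r \<and> bruhat_le u (dem_word (cyc_word A) w)"
  proof -
    from that obtain A where A: "A \<subset> {..k}" "card A \<le> r" "bruhat_le u (dem_word (cyc_word A) w)" by blast
    from demazure_le_weak_strip[OF cyc_word(1)[OF A(1)] assms(1)] obtain y where y:
      "cyclically_decreasing k y" "set y \<subseteq> A" "good w (set y)" "bruhat_le u (act y \<circ> w)"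
      using A assms(2) cyc_word(2)[OF A(1)] by blast
    have "finite A" using A finite_subset by blast
    then have "card (set y) \<le> r" using card_mono[OF _ y(2)] A by simp
    then obtain D where D: "set y \<subseteq> D" "D \<subset> {..k}" "card D = r" "good w D"
      using good_extend_card[OF wa y(3) cyc_proper[OF y(1)]] assms(3) by blast
    have g: "cyc_perm D \<circ> w \<in> Gr" "len (cyc_perm D \<circ> w) = r + len w" "dem_word (cyc_word D) w = cyc_perm D \<circ> w"
      using good_weak_strip[OF cyc_word(1)[OF D(2)] assms(1)] D cyc_word(2)[OF D(2)] length_cyc_word[OF D(2)] by (auto simp: cyc_perm_def)
    have "bruhat_le u (cyc_perm D \<circ> w)" using y(4) dA_le[OF D(1,2)] g(3) act_cyc_cyc_perm[OF y(1)] bruhat_le_trans by simp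
    then show ?thesis using g D by blast
  qed
  show "\<exists>A\<subset>{..k}. card A \<le> r \<and> bruhat_le u (dem_word (cyc_word A) w)"
    if "\<exists>A\<subset>{..k}. card A = r \<and> cyc_perm A \<circ> w \<in> Gr \<and> len (cyc_perm A \<circ> w) = r + len w \<and> bruhat_le u (cyc_perm A \<circ> w)"
    using that dA_le bruhat_le_trans by (metis order_refl)
qed

text \<open>A descent of \<open>w\<close> at some \<open>j\<close> in \<open>{1..k}\<close> survives
  left Demazure steps, since a generator undoing it would shorten. Hence Grassmannian products arise
  only from Grassmannian elements of the lower ideal.\<close>

lemma dem_word_Gr_imp:
  assumes "w \<in> aff" "dem_word t w \<in> Gr" shows "w \<in> Gr"
proof -
  have "\<exists>j\<in>{1..int k}. dem_word t w (j + 1) < dem_word t w j" if "w \<notin> Gr"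
  proof (induction t rule: list.induct)
    case Nil
    show ?case using that GrI[OF assms(1)] aff_eq_iff[OF assms(1)]
      by simp (metis atLeastAtMost_iff less_add_one linorder_neqE_linordered_idom order_less_irrefl)
  next
    case (Cons i t)
    define v where "v = dem_word t w"
    have v: "v \<in> aff" using assms by (simp add: v_def)
    obtain j where j: "j \<in> {1..int k}" "v (j + 1) < v j" using Cons.IH by (auto simp: v_def)
    have "dem_step i v (j + 1) < dem_step i v j"
    proof (cases "len v < len (sg (int i) \<circ> v)")
      case True
      have "\<not> (cg (v (j + 1)) (int i) \<and> v j = v (j + 1) + 1)"
      proof
        assume *: "cg (v (j + 1)) (int i) \<and> v j = v (j + 1) + 1"
        then obtain c where c: "v (j + 1) = int i + c * N" using cg_E by blast
        have "pinv v (int i + c * N) = j + 1" using c by (intro pinv_eqI[OF v]) simp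
        moreover have "pinv v (int i + 1 + c * N) = j" using c * by (intro pinv_eqI[OF v]) simp
        ultimately have "pinv v (int i) + c * N = j + 1" "pinv v (int i + 1) + c * N = j"
          using aff_period[of "pinv v" "int i" c] aff_period[of "pinv v" "int i + 1" c] v by simp_all
        then show False using True len_up[OF v] by simp
      qed
      then show ?thesis using sg_mono[OF j(2)] True by (simp add: dem_step_def)
    qed (use j in \<open>simp add: dem_step_def\<close>)
    then have "\<exists>j\<in>{1..int k}. dem_word (i # t) w (j + 1) < dem_word (i # t) w j" using j by (auto simp: v_def)
    then show ?case .
  qed
  then show ?thesis using GrD[OF assms(2)] by (metis atLeastAtMost_iff not_less_iff_gr_or_eq)
qed

section \<open>Bounded partitions and the Pieri rule\<close>

text \<open>The residues, from right to left, of a row of \<open>p\<close> cells whose first cell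
  has residue \<open>a\<close>.\<close>

definition row :: "int \<Rightarrow> nat \<Rightarrow> nat list" where
  "row a p = map (\<lambda>j. letter (a + int j)) (rev [0..<p])"

lemma row_simps [simp]: "row a 0 = []" "row a (Suc p) = letter (a + int p) # row a p"
  by (simp_all add: row_def)

lemma set_row: "set (row a p) = (\<lambda>j. letter (a + int j)) ` {..<p}"
  by (simp add: row_def atLeast0LessThan)

lemma row_words [simp]: "row a p \<in> coxeter_words k"
  by (auto simp: row_def in_lists_conv_set)

lemma residue_letter: "residue k i j = letter (- int i + int j)"
  by (simp add: residue_def letter_def N_def add.commute)

text \<open>The last row is the shortest and is read first, so appending a part multiplies on the
  left.\<close>

lemma residue_word_snoc: "residue_word k (l @ [p]) = row (- int (length l)) p @ residue_word k l"
proof -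
  have "map (\<lambda>i. map (residue k i) (rev [0..<(l @ [p]) ! i])) (rev [0..<length l]) =
      map (\<lambda>i. map (residue k i) (rev [0..<l ! i])) (rev [0..<length l])"
    by (rule map_cong) (auto simp: nth_append)
  moreover have "residue k (length l) = (\<lambda>j. letter (- int (length l) + int j))"
    by (simp add: residue_letter fun_eq_iff)
  ultimately show ?thesis by (simp add: residue_word_def row_def del: map_eq_conv)
qed

definition part_perm :: "nat list \<Rightarrow> int \<Rightarrow> int" where
  "part_perm l = act (residue_word k l)"

lemma part_perm_Nil [simp]: "part_perm [] = id"
  by (simp add: part_perm_def residue_word_def)

lemma part_perm_snoc: "part_perm (l @ [p]) = act (row (- int (length l)) p) \<circ> part_perm l"
  by (simp add: part_perm_def residue_word_snoc act_append)

lemma residue_word_words: "residue_word k l \<in> coxeter_words k"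
  by (auto simp: residue_word_def residue_letter in_lists_conv_set)

lemma part_perm_aff [simp]: "part_perm l \<in> aff"
  by (simp add: part_perm_def residue_word_words)

lemma part_elem_words_of: "part_elem k l = words_of (part_perm l)"
  by (simp add: part_elem_def part_perm_def word_class_act residue_word_words)

lemma letter_shift_neq:
  assumes "0 < c" "c < N" shows "letter (a + c) \<noteq> letter a"
  using assms cg_off(1)[of a a c] letter_cong by auto

lemma letter_notin_row:
  assumes "int p \<le> b" "b < N" shows "letter (a + b) \<notin> set (row a p)"
proof
  assume "letter (a + b) \<in> set (row a p)"
  then obtain j where "j < p" "letter (a + b) = letter (a + int j)" by (auto simp: set_row)
  then show False using letter_shift_neq[of "b - int j" "a + int j"] assms by auto
qed

lemma letter_in_row: "0 \<le> b \<Longrightarrow> b < int p \<Longrightarrow> letter (a + b) \<in> set (row a p)"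
  unfolding set_row by (rule image_eqI[of _ _ "nat b"]) auto

lemma cyc_row: "p \<le> k \<Longrightarrow> cyclically_decreasing k (row a p)"
proof (induction p)
  case (Suc p)
  have "letter (int (letter (a + int p)) + 1) = letter (a + (int p + 1))"
    using letter_shift[of "int (letter (a + int p))" "a + int p" 1] by (simp add: add_ac)
  moreover have "letter (a + int p) \<notin> set (row a p)" "letter (a + (int p + 1)) \<notin> set (row a p)"
    using letter_notin_row[of p "int p" a] letter_notin_row[of p "int p + 1" a] Suc.prems by (auto simp: N_def)
  ultimately show ?case using Suc by (simp add: cyc_Cons)
qed simp

section \<open>Rows as moves on the abacus\<close>

context
  fixes a :: int and p :: nat
  assumes p: "p \<le> k"
begin

lemma letter_pred_notin_row: "letter (a - 1) \<notin> set (row a p)"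
proof -
  have "letter (a - 1) = letter (a + (N - 1))" using letter_add[of "a - 1" 1] by (simp add: algebra_simps)
  then show ?thesis using letter_notin_row[of p "N - 1" a] p by (simp add: N_def)
qed

lemma act_row_start: "act (row a p) a = a + int p"
proof (rule act_cyc_up[OF cyc_row[OF p] letter_pred_notin_row])
  show "\<forall>j<p. letter (a + int j) \<in> set (row a p)" using letter_in_row by simp
  show "letter (a + int p) \<notin> set (row a p)" using letter_notin_row[of p "int p" a] p by (simp add: N_def)
qed

lemma act_row_inner:
  assumes "1 \<le> j" "j \<le> int p" shows "act (row a p) (a + j) = a + j - 1"
  using act_cyc_down[OF cyc_row[OF p], of "a + j" a] letter_in_row[of "j - 1" p a] assms
  by (simp add: add_diff_eq)

text \<open>As \<open>p \<le> k\<close>, the letters of a row form a single run starting at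
  \<open>a\<close>.\<close>

lemma row_leader:
  assumes "letter (b - 1) \<notin> set (row a p)" "letter b \<in> set (row a p)"
  obtains c where "b = a + c * N"
proof -
  obtain j where j: "j < p" "letter b = letter (a + int j)" using assms(2) by (auto simp: set_row)
  have "j = 0"
  proof (rule ccontr)
    assume "j \<noteq> 0"
    moreover have "letter (b - 1) = letter (a + (int j - 1))" using letter_shift[OF j(2), of "-1"] by (simp add: add_diff_eq)
    ultimately show False using letter_in_row[of "int j - 1" p a] assms(1) j by simp
  qed
  then have "cg b a" using j letter_cong by simp
  then show ?thesis using that by (rule cg_E)
qed

text \<open>Only points congruent to \<open>a\<close> can move up, by \<open>p\<close>, and those to
  the left of \<open>a\<close> are at distance at least \<open>N > p\<close>.\<close>

lemma act_row_le: "x < a \<Longrightarrow> act (row a p) x < a"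
proof -
  assume x: "x < a"
  show ?thesis
  proof (cases "letter (x - 1) \<in> set (row a p)")
    case True then show ?thesis using act_cyc_down[OF cyc_row[OF p]] x by simp
  next
    case nin: False
    show ?thesis
    proof (cases "letter x \<in> set (row a p)")
      case True
      then obtain c where c: "x = a + c * N" using row_leader[OF nin] by blast
      then have "c * N < 0" using x by simp
      then have "c \<le> -1" using N_pos by (simp add: mult_less_0_iff)
      then have "c * N \<le> - 1 * N" using N_pos by (intro mult_right_mono) auto
      moreover have "act (row a p) x = a + int p + c * N"
        using c aff_period[of "act (row a p)" a c] act_row_start by simp
      ultimately show ?thesis using p by (simp add: N_def)
    next
      case False
      then show ?thesis using act_cyc_fix[OF cyc_row[OF p] nin] x by simp
    qed
  qed
qed

lemma good_row:
  assumes "f \<in> aff" "level f a < 0" "\<And>j. 1 \<le> j \<Longrightarrow> j \<le> int p \<Longrightarrow> 0 \<le> level f (a + j)"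
  shows "good f (set (row a p))"
  unfolding good_def
proof (intro allI impI)
  fix b m assume b: "letter (b - 1) \<notin> set (row a p)" "\<forall>j<m. letter (b + int j) \<in> set (row a p)" "0 < m"
  then have "letter b \<in> set (row a p)" by force
  then obtain c where c: "b = a + c * N" using row_leader[OF b(1)] by blast
  have per: "letter (b + z) = letter (a + z)" for z
  proof -
    have "b + z = a + z + c * N" using c by simp
    then show ?thesis using letter_add by metis
  qed
  have "m \<le> p"
  proof (rule ccontr)
    assume "\<not> m \<le> p"
    then have "letter (a + int p) \<in> set (row a p)" using b(2) per by simp
    then show False using letter_notin_row[of p "int p" a] p by (simp add: N_def)
  qed
  then have "level f a < level f (a + int m)" using assms(2) assms(3)[of "int m"] b(3) by simp
  moreover have "b + int m = a + int m + c * N" using c by simp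
  ultimately have "level f (b + int m) = level f (a + int m) + c" "level f b = level f a + c" "level f a < level f (a + int m)"
    using c level_add[OF assms(1), of a c] level_add[OF assms(1), of "a + int m" c] by metis+
  then show "level f b < level f (b + int m)" by simp
qed

end

lemma level_row: "f \<in> aff \<Longrightarrow> level (act (row a p) \<circ> f) (act (row a p) z) = level f z"
  by (intro level_comp_act) auto

lemma level_id: "level id x = (x - 1) div N"
  by (simp add: level_def)

lemma bp_Nil [simp]: "[] \<in> bounded_partitions k"
  by (simp add: bounded_partitions_def)

lemma bp_snoc: "l @ [p] \<in> bounded_partitions k \<longleftrightarrow>
    l \<in> bounded_partitions k \<and> 1 \<le> p \<and> p \<le> k \<and> (\<forall>a\<in>set l. p \<le> a)"
  by (auto simp: bounded_partitions_def sorted_wrt_append)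

lemma bp_snoc_one: "l \<in> bounded_partitions k \<Longrightarrow> l @ [1] \<in> bounded_partitions k"
  using k_pos unfolding bp_snoc by (auto simp: bounded_partitions_def)

lemma bp_snoc_last: "l @ [p] \<in> bounded_partitions k \<Longrightarrow> (l @ [p]) @ [p] \<in> bounded_partitions k"
  unfolding bp_snoc by auto

text \<open>Appending a part \<open>p\<close> moves the bead at \<open>- length l\<close> past
  \<open>p\<close> gaps. So the positions up to \<open>- length l\<close> are beads, then come as
  many gaps as the last part says, then a bead: length and last part can be read off. Membership of
  \<open>l @ [p]\<close> expresses that \<open>p\<close> is at most the last part.\<close>

lemma part_perm_beads:
  assumes "l \<in> bounded_partitions k"
  shows "part_perm l \<in> Gr"
    and "x \<le> - int (length l) \<Longrightarrow> level (part_perm l) x < 0"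
    and "l @ [p] \<in> bounded_partitions k \<Longrightarrow> 1 \<le> j \<Longrightarrow> j \<le> int p \<Longrightarrow> 0 \<le> level (part_perm l) (- int (length l) + j)"
    and "l = l' @ [p'] \<Longrightarrow> level (part_perm l) (- int (length l) + 1 + int p') < 0"
proof -
  have "part_perm l \<in> Gr \<and> (\<forall>x\<le>- int (length l). level (part_perm l) x < 0) \<and>
    (\<forall>p j. l @ [p] \<in> bounded_partitions k \<and> 1 \<le> j \<and> j \<le> int p \<longrightarrow> 0 \<le> level (part_perm l) (- int (length l) + j)) \<and>
    (\<forall>l' p'. l = l' @ [p'] \<longrightarrow> level (part_perm l) (- int (length l) + 1 + int p') < 0)"
    using assms
  proof (induction l rule: rev_induct)
    case Nil
    have "part_perm [] \<in> Gr" unfolding part_perm_Nil by (rule GrI) auto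
    moreover have "level (part_perm []) x < 0" if "x \<le> 0" for x
      using that N_pos pos_imp_zdiv_neg_iff by (simp add: level_id)
    moreover have "0 \<le> level (part_perm []) x" if "1 \<le> x" for x
      using that N_pos pos_imp_zdiv_nonneg_iff by (simp add: level_id)
    ultimately show ?case by (simp del: part_perm_Nil)
  next
    case (snoc p0 l)
    have l: "l \<in> bounded_partitions k" and p0: "1 \<le> p0" "p0 \<le> k" using snoc.prems by (auto simp: bp_snoc)
    define a f where "a = - int (length l)" and "f = part_perm l"
    have IH: "f \<in> Gr" "\<And>x. x \<le> a \<Longrightarrow> level f x < 0" "\<And>j. 1 \<le> j \<Longrightarrow> j \<le> int p0 \<Longrightarrow> 0 \<le> level f (a + j)"
      using snoc.IH[OF l] snoc.prems unfolding a_def f_def by blast+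
    have fa: "f \<in> aff" using IH by simp
    define g where "g = act (row a p0) \<circ> f"
    have e: "part_perm (l @ [p0]) = g" "- int (length (l @ [p0])) = a - 1" by (simp_all add: part_perm_snoc g_def a_def f_def)
    have "good f (set (row a p0))" using good_row[OF p0(2) fa] IH by simp
    then have G: "g \<in> Gr" using good_weak_strip[OF cyc_row[OF p0(2)] IH(1)] unfolding g_def by blast
    have low: "level g x < 0" if "x \<le> a - 1" for x
    proof -
      define z where "z = pinv (act (row a p0)) x"
      have z: "act (row a p0) z = x" by (simp add: z_def)
      then have "z \<le> a" using act_cyc_ge(1)[OF cyc_row[OF p0(2)], of z a] that by simp
      then show ?thesis using IH(2)[of z] level_row[OF fa, of a p0 z] z by (simp add: g_def)
    qed
    have high: "0 \<le> level g (a - 1 + j)" if "1 \<le> j" "j \<le> int p0" for j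
      using level_row[OF fa, of a p0 "a + j"] act_row_inner[OF p0(2) that] IH(3)[OF that]
      by (simp add: g_def algebra_simps)
    have last: "level g (a - 1 + 1 + int p0) < 0"
      using level_row[OF fa, of a p0 a] act_row_start[OF p0(2)] IH(2)[of a] by (simp add: g_def)
    have "p \<le> p0" if "(l @ [p0]) @ [p] \<in> bounded_partitions k" for p
      using that unfolding bp_snoc[of "l @ [p0]"] by simp
    then show ?case unfolding e using G low high last by fastforce
  qed
  then show "part_perm l \<in> Gr"
    "x \<le> - int (length l) \<Longrightarrow> level (part_perm l) x < 0"
    "l @ [p] \<in> bounded_partitions k \<Longrightarrow> 1 \<le> j \<Longrightarrow> j \<le> int p \<Longrightarrow> 0 \<le> level (part_perm l) (- int (length l) + j)"
    "l = l' @ [p'] \<Longrightarrow> level (part_perm l) (- int (length l) + 1 + int p') < 0" by blast+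
qed

lemma part_perm_first_gap:
  assumes "l \<in> bounded_partitions k" "\<And>x. x \<le> - int m \<Longrightarrow> level (part_perm l) x < 0" "0 \<le> level (part_perm l) (- int m + 1)"
  shows "length l = m"
proof (rule linorder_cases[of "length l" m])
  assume "length l < m"
  then show ?thesis using assms(3) part_perm_beads(2)[OF assms(1), of "- int m + 1"]
      part_perm_beads(3)[OF assms(1) bp_snoc_one[OF assms(1)], of 1] assms(2)[of "- int (length l) + 1"]
    by (smt (verit) of_nat_1 of_nat_less_iff)
next
  assume "m < length l"
  then show ?thesis using assms(3)
      part_perm_beads(3)[OF assms(1) bp_snoc_one[OF assms(1)], of 1] assms(2)[of "- int (length l) + 1"] by force
qed

text \<open>The first gap gives the length and the next bead the last part; cancelling the last row
  leaves shorter partitions.\<close>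

lemma part_perm_inj:
  assumes "l \<in> bounded_partitions k" "l' \<in> bounded_partitions k" "part_perm l = part_perm l'"
  shows "l = l'"
  using assms
proof (induction l arbitrary: l' rule: rev_induct)
  case Nil
  have e: "part_perm l' = part_perm []" using Nil.prems(3) by (rule HOL.sym)
  have "length l' = length ([] :: nat list)"
    using part_perm_beads(2)[OF Nil(1)] part_perm_beads(3)[OF Nil(1) bp_snoc_one[OF Nil(1)], of 1]
    by (intro part_perm_first_gap[OF Nil(2)]; unfold e) (simp_all del: part_perm_Nil)
  then show ?case by simp
next
  case (snoc p l)
  have "length l' = length (l @ [p])"
    using part_perm_beads(2)[OF snoc.prems(1)] part_perm_beads(3)[OF snoc.prems(1) bp_snoc_one[OF snoc.prems(1)], of 1] snoc.prems(3)
    by (intro part_perm_first_gap[OF snoc.prems(2)]) simp_all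
  then obtain l2 p2 where l': "l' = l2 @ [p2]" "length l2 = length l"
    by (cases l' rule: rev_cases) auto
  have "\<not> p1 < p2'" if "s1 @ [p1] \<in> bounded_partitions k" "s2 @ [p2'] \<in> bounded_partitions k"
    "length s1 = length s2" "part_perm (s1 @ [p1]) = part_perm (s2 @ [p2'])" for s1 s2 p1 p2'
  proof
    assume "p1 < p2'"
    then have "0 \<le> level (part_perm (s2 @ [p2'])) (- int (length (s2 @ [p2'])) + (1 + int p1))"
      using part_perm_beads(3)[OF that(2) bp_snoc_last[OF that(2)], of "1 + int p1"] by simp
    moreover have "level (part_perm (s1 @ [p1])) (- int (length (s1 @ [p1])) + 1 + int p1) < 0"
      using part_perm_beads(4)[OF that(1)] by blast
    ultimately show False using that(3,4) by (simp add: algebra_simps)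
  qed
  then have p: "p2 = p" using snoc.prems l' by (metis linorder_neqE_nat)
  have "act (row (- int (length l)) p) \<circ> part_perm l = act (row (- int (length l)) p) \<circ> part_perm l2"
    using snoc.prems(3) l' p by (simp add: part_perm_snoc del: comp_apply)
  then have "pinv (act (row (- int (length l)) p)) \<circ> act (row (- int (length l)) p) \<circ> part_perm l =
      pinv (act (row (- int (length l)) p)) \<circ> act (row (- int (length l)) p) \<circ> part_perm l2"
    by (simp only: comp_assoc)
  then have "part_perm l = part_perm l2" by simp
  then have "l = l2" using snoc.IH[of l2] snoc.prems l' by (simp add: bp_snoc)
  then show ?case using l' p by simp
qed

section \<open>Charge of the abacus and surjectivity\<close>

lemma sum_level_shift:
  assumes "f \<in> aff" shows "(\<Sum>z\<in>{c+1..c+N}. level f z) - c = (\<Sum>z\<in>{1..N}. level f z)"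
proof -
  let ?Q = "\<lambda>c. (\<Sum>z\<in>{c+1..c+N}. level f z) - c"
  have step: "?Q (c + 1) = ?Q c" for c
  proof -
    have "{c+1..c+N} = insert (c+1) {c+2..c+N}" "{c+1+1..c+1+N} = insert (c+1+N) {c+2..c+N}"
      using N_pos by auto
    moreover have "level f (c + 1 + N) = level f (c + 1) + 1" using level_add[OF assms, of "c + 1" 1] by simp
    ultimately show ?thesis by simp
  qed
  have "?Q c = ?Q 0"
  proof (induction c rule: int_induct[of _ 0])
    case (step1 i)
    then show ?case using step[of i] by simp
  next
    case (step2 i)
    then show ?case using step[of "i - 1"] by simp
  qed simp
  then show ?thesis by simp
qed

text \<open>The charge of the abacus is \<open>0\<close>: this holds for the identity, and the
  generator \<open>i\<close> permutes the window of length \<open>N\<close> starting at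
  \<open>i\<close>, so the charge never changes.\<close>

lemma sum_level:
  assumes "f \<in> aff" shows "(\<Sum>z\<in>{c+1..c+N}. level f z) = c"
proof -
  have Q: "(\<Sum>z\<in>{1..N}. level (act x) z) = 0" if "x \<in> coxeter_words k" for x
    using that
  proof (induction x rule: list.induct)
    case Nil
    have "level id z = 0" if "z \<in> {1..N}" for z using that by (simp add: level_id)
    then show ?case by (simp add: id_def)
  next
    case (Cons i x)
    have w: "x \<in> coxeter_words k" "act x \<in> aff" using Cons.prems by auto
    define c where "c = int i - 1"
    have "(\<Sum>z\<in>{c+1..c+N}. level (sg (int i) \<circ> act x) z) = (\<Sum>z\<in>{c+1..c+N}. level (act x) (sg (int i) z))"
      using w by (simp add: level_comp)
    also have "\<dots> = (\<Sum>z\<in>{c+1..c+N}. level (act x) z)"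
    proof (rule sum.reindex_bij_witness[where i = "sg (int i)" and j = "sg (int i)"])
      fix z assume z: "z \<in> {c+1..c+N}"
      show "sg (int i) z \<in> {c+1..c+N}"
      proof (cases "z = int i \<or> z = int i + 1")
        case True
        then show ?thesis using sg_up[of "int i" "int i"] sg_down[of "int i + 1" "int i"] N_ge2 by (auto simp: c_def)
      next
        case False
        then have "\<not> cg z (int i)" "\<not> cg z (int i + 1)"
          using z cg_near[of z "int i"] cg_near[of z "int i + 1"] by (auto simp: c_def)
        then show ?thesis using z by (simp add: sg_fix)
      qed
      then show "sg (int i) z \<in> {c+1..c+N}" .
    qed simp_all
    finally have "(\<Sum>z\<in>{1..N}. level (sg (int i) \<circ> act x) z) = (\<Sum>z\<in>{1..N}. level (act x) z)"
      using sum_level_shift[of "sg (int i) \<circ> act x" c] sum_level_shift[of "act x" c] w by simp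
    then have "(\<Sum>z\<in>{1..N}. level (act (i # x)) z) = 0" using Cons.IH[OF w(1)] by simp
    then show ?case .
  qed
  obtain x where "x \<in> coxeter_words k" "act x = f" using assms by (rule aff_E)
  then have "(\<Sum>z\<in>{1..N}. level f z) = 0" using Q by blast
  then show ?thesis using sum_level_shift[OF assms, of c] by simp
qed

text \<open>The levels on \<open>{1..N}\<close> are at most \<open>0\<close> and sum to
  \<open>0\<close>, so they vanish and \<open>f\<close> permutes the window; an increasing
  permutation of an interval is trivial.\<close>

lemma Gr_no_beads:
  assumes "f \<in> Gr" "\<And>x. x \<le> 0 \<Longrightarrow> level f x < 0" shows "f = id"
proof -
  have f: "f \<in> aff" using assms by simp
  have neg: "level f z \<le> 0" if "z \<in> {1..N}" for z
    using assms(2)[of "z - N"] level_add[OF f, of "z - N" 1] that by simp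
  have "(\<Sum>z\<in>{1..N}. - level f z) = 0" using sum_level[OF f, of 0] by (simp add: sum_negf)
  then have q0: "level f z = 0" if "z \<in> {1..N}" for z
    using sum_nonneg_eq_0_iff[of "{1..N}" "\<lambda>z. - level f z"] neg that by auto
  have win: "pinv f z \<in> {1..N}" if "z \<in> {1..N}" for z
  proof -
    have "(pinv f z - 1) div N = 0" using q0[OF that] by (simp add: level_def)
    then have "0 \<le> pinv f z - 1" "pinv f z - 1 < N" using N_pos zdiv_eq_0_iff[of "pinv f z - 1" N] by auto
    then show ?thesis by simp
  qed
  have "inj_on (pinv f) {1..N}" using f by (auto intro!: inj_onI)
  then have surj: "pinv f ` {1..N} = {1..N}" using win by (intro endo_inj_surj) auto
  have fw: "f z \<in> {1..N}" if z: "z \<in> {1..N}" for z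
  proof -
    obtain y where "y \<in> {1..N}" "z = pinv f y" using z surj by blast
    then show ?thesis using f by simp
  qed
  have lo: "1 + int j \<le> f (1 + int j)" if "j \<le> k" for j
    using that
  proof (induction j)
    case 0 then show ?case using fw[of 1] N_pos by simp
  next
    case (Suc j)
    then show ?case using GrD[OF assms(1), of "1 + int j"] by (simp add: add_ac)
  qed
  have hi: "f (N - int j) \<le> N - int j" if "j \<le> k" for j
    using that
  proof (induction j)
    case 0 then show ?case using fw[of N] N_pos by simp
  next
    case (Suc j)
    then show ?case using GrD[OF assms(1), of "N - int (Suc j)"] by (simp add: N_def algebra_simps)
  qed
  have fix_win: "f z = z" if "z \<in> {1..N}" for z
  proof -
    have "nat (z - 1) \<le> k" "nat (N - z) \<le> k" using that by (auto simp: N_def)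
    then show ?thesis using lo[of "nat (z - 1)"] hi[of "nat (N - z)"] that by simp
  qed
  show ?thesis
  proof
    fix z
    have "f ((z - 1) mod N + 1) = (z - 1) mod N + 1"
      using pos_mod_bound[OF N_pos, of "z - 1"] pos_mod_sign[OF N_pos, of "z - 1"]
      by (intro fix_win, unfold atLeastAtMost_iff) linarith
    then show "f z = id z" using aff_period[OF f, of "(z - 1) mod N + 1" "(z - 1) div N"]
      by (metis add.commute add.left_commute diff_add_cancel div_mult_mod_eq id_apply)
  qed
qed

text \<open>The bead at \<open>a + p\<close> passes the gaps on its left one by one; each exchange
  of a gap with a bead on its right shortens, so \<open>Gr_down\<close> applies.\<close>

lemma Gr_remove_row:
  assumes "f \<in> Gr" "p \<le> k" "\<And>j. j < p \<Longrightarrow> 0 \<le> level f (a + int j)" "level f (a + int p) < 0"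
  shows "pinv (act (row a p)) \<circ> f \<in> Gr"
  using assms
proof (induction p arbitrary: f)
  case 0 then show ?case by simp
next
  case (Suc p)
  have f: "f \<in> aff" using Suc.prems by simp
  let ?s = "sg (a + int p)"
  have qs: "level (?s \<circ> f) z = level f (?s z)" for z using f by (simp add: level_comp)
  have "level f (a + int p + 1) < level f (a + int p)"
    using Suc.prems(3)[of p] Suc.prems(4) by (simp add: add_ac)
  then have "len (?s \<circ> f) < len f" using len_down[OF f] level_less by blast
  then have g: "?s \<circ> f \<in> Gr" using Gr_down Suc.prems by blast
  have "pinv (act (row a p)) \<circ> (?s \<circ> f) \<in> Gr"
  proof (rule Suc.IH[OF g])
    show "p \<le> k" using Suc.prems by simp
    show "level (?s \<circ> f) (a + int p) < 0" unfolding qs using Suc.prems(4) by (simp add: sg_up add_ac)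
    fix j assume j: "j < p"
    have "\<not> cg (a + int j) (a + int p)" "\<not> cg (a + int j) (a + int p + 1)"
      using cg_near[of "a + int j" "a + int p"] cg_near[of "a + int j" "a + int p + 1"] j Suc.prems(2)
      by (auto simp: N_def)
    then show "0 \<le> level (?s \<circ> f) (a + int j)" unfolding qs using Suc.prems(3)[of j] j by (simp add: sg_fix)
  qed
  moreover have "pinv (act (row a (Suc p))) = pinv (act (row a p)) \<circ> ?s"
    by (simp add: pinv_o sg_letter)
  ultimately show ?case by (simp add: comp_assoc del: row_simps comp_apply)
qed

text \<open>Induction on how far to the left gaps may occur: moving the next bead back into the
  first gap removes the last part.\<close>

lemma part_perm_surj_aux:
  assumes "f \<in> Gr" "\<And>x. x \<le> - int m \<Longrightarrow> level f x < 0"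
  shows "\<exists>l\<in>bounded_partitions k. part_perm l = f"
  using assms
proof (induction m arbitrary: f)
  case 0
  then have "f = id" using Gr_no_beads by simp
  then show ?case using bp_Nil part_perm_Nil by metis
next
  case (Suc m)
  have f: "f \<in> aff" using Suc.prems by simp
  define a where "a = - int m"
  have low: "level f x < 0" if "x < a" for x using Suc.prems(2)[of x] that by (simp add: a_def)
  show ?case
  proof (cases "level f a < 0")
    case True
    then have "level f x < 0" if "x \<le> - int m" for x using low[of x] that by (cases "x = a") (auto simp: a_def)
    then show ?thesis using Suc.IH Suc.prems by blast
  next
    case False
    \<comment> \<open>By charge \<open>0\<close> the levels of this window sum to
      \<open>a - 1 < 0\<close>. The bead found in it bounds the new part by
      \<open>k\<close>.\<close>
    have "\<exists>z\<in>{a..a + N - 1}. level f z < 0"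
    proof (rule ccontr)
      assume "\<not> ?thesis"
      then have "0 \<le> (\<Sum>z\<in>{a - 1 + 1..a - 1 + N}. level f z)" by (intro sum_nonneg) (auto simp: not_less)
      then show False using sum_level[OF f, of "a - 1"] by (simp add: a_def)
    qed
    then obtain z where z: "z \<in> {a..a + N - 1}" "level f z < 0" by blast
    define p where "p = (LEAST p. level f (a + int p) < 0)"
    have zn: "level f (a + int (nat (z - a))) < 0" using z by simp
    have p: "level f (a + int p) < 0" unfolding p_def by (rule LeastI[of "\<lambda>p. level f (a + int p) < 0", OF zn])
    have pmin: "0 \<le> level f (a + int j)" if "j < p" for j
      using not_less_Least[of j "\<lambda>p. level f (a + int p) < 0"] that by (simp add: p_def not_less)
    have "p \<le> nat (z - a)" unfolding p_def using zn by (rule Least_le)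
    then have pk: "p \<le> k" using z(1) by (simp add: N_def) linarith
    have p1: "1 \<le> p" using p False by (cases p) auto
    define g where "g = pinv (act (row a p)) \<circ> f"
    have g: "g \<in> Gr" unfolding g_def using Gr_remove_row[OF Suc.prems(1) pk pmin p] .
    have qg: "level g x = level f (act (row a p) x)" for x unfolding g_def using f by (simp add: level_comp)
    have ga: "level g a < 0" using qg[of a] act_row_start[OF pk] p by simp
    have glow: "level g x < 0" if "x \<le> - int m" for x
      using that ga qg[of x] low act_row_le[OF pk, of x a] by (cases "x = a") (auto simp: a_def)
    have ghigh: "0 \<le> level g (a + j)" if "1 \<le> j" "j \<le> int p" for j
      using qg[of "a + j"] act_row_inner[OF pk that] pmin[of "nat (j - 1)"] that by (simp add: add_diff_eq)
    obtain l where l: "l \<in> bounded_partitions k" "part_perm l = g" using Suc.IH[OF g glow] by blast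
    have len: "length l = m"
      using part_perm_first_gap[OF l(1), of m] glow ghigh[of 1] l p1 by (simp add: a_def)
    have "l @ [p] \<in> bounded_partitions k"
    proof (cases l rule: rev_cases)
      case Nil then show ?thesis using p1 pk bp_snoc[of "[]" p] by simp
    next
      case (snoc l0 p0)
      have "p \<le> p0"
      proof (rule ccontr)
        assume "\<not> p \<le> p0"
        then have "0 \<le> level g (a + (1 + int p0))" by (intro ghigh) auto
        moreover have "level g (a + 1 + int p0) < 0" using part_perm_beads(4)[OF l(1) snoc] l len by (simp add: a_def)
        ultimately show False by (simp add: add_ac)
      qed
      then show ?thesis using l(1) snoc p1 pk unfolding bp_snoc by (auto simp: bounded_partitions_def sorted_wrt_append)
    qed
    moreover have "part_perm (l @ [p]) = f"
    proof -
      have "part_perm (l @ [p]) = act (row a p) \<circ> pinv (act (row a p)) \<circ> f"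
        by (simp only: part_perm_snoc len l(2) a_def[symmetric] g_def comp_assoc)
      then show ?thesis by simp
    qed
    ultimately show ?thesis by blast
  qed
qed

lemma act_displacement: "\<bar>act x z - z\<bar> \<le> int (length x)"
proof (induction x)
  case (Cons i x)
  have "\<bar>sg (int i) y - y\<bar> \<le> 1" for y by (simp add: sg_def)
  from this[of "act x z"] Cons show ?case by simp
qed simp

lemma part_perm_surj:
  assumes "f \<in> Gr" shows "\<exists>l\<in>bounded_partitions k. part_perm l = f"
proof -
  obtain x where x: "act x = f" using aff_E[OF Gr_aff[OF assms]] by metis
  have "level f z < 0" if "z \<le> - int (length x)" for z
  proof -
    have "pinv f z \<le> 0" using act_displacement[of "rev x" z] inv_act[of x] x that by simp
    then show ?thesis using N_pos by (simp add: level_def pos_imp_zdiv_neg_iff)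
  qed
  then show ?thesis using part_perm_surj_aux[OF assms] by blast
qed

lemma bij_part_perm: "bij_betw part_perm (bounded_partitions k) Gr"
  unfolding bij_betw_def using part_perm_inj part_perm_surj part_perm_beads(1) by (force intro!: inj_onI)

section \<open>The Pieri rule and the product\<close>

lemma part_le_iff: "part_le k m l \<longleftrightarrow> bruhat_le (part_perm m) (part_perm l)"
  by (simp add: part_le_def part_elem_words_of strong_le_words_of)

lemma weak_strip_part_perm: "weak_strip k r \<kappa> l \<longleftrightarrow>
    (\<exists>A\<subset>{..k}. card A = r \<and> part_perm \<kappa> = cyc_perm A \<circ> part_perm l \<and> len (cyc_perm A \<circ> part_perm l) = r + len (part_perm l))"
proof -
  have "words_of (part_perm \<kappa>) = cyc_elem k A \<otimes>\<^bsub>affine_sym k\<^esub> words_of (part_perm l) \<and> left_weak_le k (words_of (part_perm l)) (words_of (part_perm \<kappa>)) \<longleftrightarrow>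
      part_perm \<kappa> = cyc_perm A \<circ> part_perm l \<and> len (cyc_perm A \<circ> part_perm l) = card A + len (part_perm l)" if A: "A \<subset> {..k}" for A
  proof -
    have 1: "words_of (part_perm \<kappa>) = cyc_elem k A \<otimes>\<^bsub>affine_sym k\<^esub> words_of (part_perm l) \<longleftrightarrow> part_perm \<kappa> = cyc_perm A \<circ> part_perm l"
      using A words_of_inj[of "part_perm \<kappa>" "cyc_perm A \<circ> part_perm l"] by (simp add: cyc_elem_words_of mult_words_of)
    have "cyc_perm A \<circ> part_perm l \<circ> pinv (part_perm l) = cyc_perm A" by (simp add: comp_assoc)
    then have "left_weak_le k (words_of (part_perm l)) (words_of (cyc_perm A \<circ> part_perm l)) \<longleftrightarrow>
        len (cyc_perm A) + len (part_perm l) = len (cyc_perm A \<circ> part_perm l)"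
      using A by (simp add: left_weak_le_def inv_words_of mult_words_of len_def[symmetric])
    then show ?thesis unfolding 1 using len_cyc_perm[OF A] by metis
  qed
  then show ?thesis unfolding weak_strip_def part_elem_words_of by metis
qed

lemma hsym_0: "hsym 0 = 1"
  by transfer (simp add: fun_eq_iff)

text \<open>The case \<open>r = 0\<close>, where only the empty set contributes, is included so that
  all summands of \<open>htilde r\<close> are alike. The difference in the exponent becomes a sum of
  the same parity, matching \<open>hecke_coeff\<close>.\<close>

lemma K_k_Schur_pieri:
  assumes "K_k_Schur k g" "w \<in> Gr" "r \<le> k"
  shows "hsym r * g (words_of w) = (\<Sum>A | A \<subset> {..k} \<and> card A = r \<and> dem_word (cyc_word A) w \<in> Gr.
    of_int ((- 1) ^ (r + len w + len (dem_word (cyc_word A) w))) * g (words_of (dem_word (cyc_word A) w)))"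
proof (cases "r = 0")
  case True
  have "cyc_word {} = []" using cyc_word(2)[of "{}"] by auto
  moreover have "{A. A \<subset> {..k} \<and> card A = 0 \<and> dem_word (cyc_word A) w \<in> Gr} = {{}}"
    using \<open>cyc_word {} = []\<close> assms(2) by (auto dest: finite_subset[of _ "{..k}"])
  ultimately show ?thesis using True by (simp add: hsym_0 mult_2[symmetric])
next
  case False
  have w: "w \<in> aff" using assms by simp
  have parity: "(- 1) ^ (r + len w - len (dem_word (cyc_word A) w)) = ((- 1) ^ (r + len w + len (dem_word (cyc_word A) w)) :: int)"
    if "A \<subset> {..k}" "card A = r" for A
  proof -
    have "len (dem_word t w) \<le> length t + len w" for t
    proof (induction t)
      case (Cons i t)
      have "len (dem_step i (dem_word t w)) \<le> len (dem_word t w) + 1"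
        using len_sg_cases[of "dem_word t w" "int i"] w by (auto simp: dem_step_def)
      then show ?case using Cons by simp
    qed simp
    then have "len (dem_word (cyc_word A) w) \<le> r + len w" using that length_cyc_word by metis
    then show ?thesis by (simp add: minus_one_power_iff)
  qed
  have set: "{A. A \<subset> {..k} \<and> card A = r \<and> demazure k (cyc_elem k A) (words_of w) \<in> affine_grassmannian k} =
      {A. A \<subset> {..k} \<and> card A = r \<and> dem_word (cyc_word A) w \<in> Gr}"
    using w by (intro Collect_cong conj_cong HOL.refl) (simp add: demazure_cyc_elem words_of_Gr_iff)
  have "words_of w \<in> affine_grassmannian k" "r \<in> {1..k}" using assms False w by (auto simp: words_of_Gr_iff)
  then have "hsym r * g (words_of w) =
      (\<Sum>A | A \<subset> {..k} \<and> card A = r \<and> demazure k (cyc_elem k A) (words_of w) \<in> affine_grassmannian k.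
         (- 1) ^ (r + cox_length (words_of w) - cox_length (demazure k (cyc_elem k A) (words_of w)))
               * g (demazure k (cyc_elem k A) (words_of w)))"
    using assms(1) unfolding K_k_Schur_def by blast
  also have "\<dots> = (\<Sum>A | A \<subset> {..k} \<and> card A = r \<and> dem_word (cyc_word A) w \<in> Gr.
    of_int ((- 1) ^ (r + len w + len (dem_word (cyc_word A) w))) * g (words_of (dem_word (cyc_word A) w)))"
    unfolding set
  proof (rule sum.cong)
    fix A assume "A \<in> {A. A \<subset> {..k} \<and> card A = r \<and> dem_word (cyc_word A) w \<in> Gr}"
    then have A: "A \<subset> {..k}" "card A = r" by auto
    have "((- 1) ^ (r + len w - len (dem_word (cyc_word A) w)) :: power_series) = of_int ((- 1) ^ (r + len w - len (dem_word (cyc_word A) w)))"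
      by simp
    also have "\<dots> = of_int ((- 1) ^ (r + len w + len (dem_word (cyc_word A) w)))" by (simp only: parity[OF A])
    finally show "(- 1) ^ (r + cox_length (words_of w) - cox_length (demazure k (cyc_elem k A) (words_of w)))
        * g (demazure k (cyc_elem k A) (words_of w)) =
        of_int ((- 1) ^ (r + len w + len (dem_word (cyc_word A) w))) * g (words_of (dem_word (cyc_word A) w))"
      using demazure_cyc_elem[OF A(1) w] by (simp add: len_def)
  qed simp
  finally show ?thesis .
qed

lemma sum_ideal_times_htilde:
  assumes "K_k_Schur k g" "lam \<in> Gr" "r \<le> k"
  shows "(\<Sum>w | w \<in> Gr \<and> bruhat_le w lam. g (words_of w)) * htilde r =
    (\<Sum>u | u \<in> Gr \<and> (\<exists>A\<subset>{..k}. card A \<le> r \<and> bruhat_le u (dem_word (cyc_word A) lam)). g (words_of u))"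
proof -
  have lam: "lam \<in> aff" using assms by simp
  define W where "W = {w. w \<in> Gr \<and> bruhat_le w lam}"
  define P where "P = {A. A \<subset> {..k} \<and> card A \<le> r}"
  \<comment> \<open>Monotonicity of the Demazure action puts every Grassmannian product of some
    \<open>A \<in> P\<close> with some \<open>w \<in> W\<close> into \<open>U\<close>, so all terms
    can be collected over this finite set.\<close>
  define U where "U = {u \<in> Gr. \<exists>A\<in>P. bruhat_le u (dem_word (cyc_word A) lam)}"
  define s where "s A w = ((- 1) ^ (card A + len w + len (dem_word (cyc_word A) w)) :: int)" for A w
  have finW: "finite W" unfolding W_def using finite_bruhat_le[OF lam] by (rule rev_finite_subset) auto
  have finP: "finite P" unfolding P_def by (rule finite_subset[of _ "Pow {..k}"]) auto
  have "U \<subseteq> (\<Union>A\<in>P. {u. bruhat_le u (dem_word (cyc_word A) lam)})" by (auto simp: U_def)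
  then have finU: "finite U" by (rule finite_subset) (use finP finite_bruhat_le lam in auto)
  have "(\<Sum>w\<in>W. g (words_of w)) * htilde r = (\<Sum>w\<in>W. \<Sum>i\<le>r. hsym i * g (words_of w))"
    by (simp add: htilde_def sum_distrib_right sum_distrib_left mult.commute)
  also have "\<dots> = (\<Sum>w\<in>W. \<Sum>A\<in>P. if dem_word (cyc_word A) w \<in> Gr then of_int (s A w) * g (words_of (dem_word (cyc_word A) w)) else 0)"
  proof (rule sum.cong[OF HOL.refl])
    fix w assume "w \<in> W"
    then have w: "w \<in> Gr" by (simp add: W_def)
    have "(\<Sum>i\<le>r. hsym i * g (words_of w)) = (\<Sum>i\<le>r. \<Sum>A | A \<subset> {..k} \<and> card A = i \<and> dem_word (cyc_word A) w \<in> Gr.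
        of_int (s A w) * g (words_of (dem_word (cyc_word A) w)))"
      using K_k_Schur_pieri[OF assms(1) w] assms(3) by (intro sum.cong) (auto simp: s_def)
    also have "\<dots> = (\<Sum>i\<le>r. \<Sum>A\<in>{A\<in>{A\<in>P. dem_word (cyc_word A) w \<in> Gr}. card A = i}. of_int (s A w) * g (words_of (dem_word (cyc_word A) w)))"
      by (intro sum.cong) (auto simp: P_def)
    also have "\<dots> = (\<Sum>A\<in>{A\<in>P. dem_word (cyc_word A) w \<in> Gr}. of_int (s A w) * g (words_of (dem_word (cyc_word A) w)))"
    proof (rule sum.group)
      show "finite {A \<in> P. dem_word (cyc_word A) w \<in> Gr}" using finP by simp
    qed (auto simp: P_def)
    also have "\<dots> = (\<Sum>A\<in>P. if dem_word (cyc_word A) w \<in> Gr then of_int (s A w) * g (words_of (dem_word (cyc_word A) w)) else 0)"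
      using finP by (simp add: sum.inter_filter)
    finally show "(\<Sum>i\<le>r. hsym i * g (words_of w)) =
      (\<Sum>A\<in>P. if dem_word (cyc_word A) w \<in> Gr then of_int (s A w) * g (words_of (dem_word (cyc_word A) w)) else 0)" .
  qed
  also have "\<dots> = (\<Sum>w\<in>W. \<Sum>A\<in>P. \<Sum>u\<in>U. of_int (if dem_word (cyc_word A) w = u then s A w else 0) * g (words_of u))"
  proof (intro sum.cong HOL.refl)
    fix w A assume wA: "w \<in> W" "A \<in> P"
    have "dem_word (cyc_word A) w \<in> U" if "dem_word (cyc_word A) w \<in> Gr"
      using that wA dem_word_mono[of "cyc_word A" lam w] lam by (auto simp: U_def W_def P_def)
    moreover have "(\<Sum>u\<in>U. of_int (if dem_word (cyc_word A) w = u then s A w else 0) * g (words_of u)) =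
      (\<Sum>u\<in>U. if dem_word (cyc_word A) w = u then of_int (s A w) * g (words_of u) else 0)"
      by (intro sum.cong) auto
    moreover have "dem_word (cyc_word A) w \<in> Gr" if "dem_word (cyc_word A) w \<in> U" using that by (simp add: U_def)
    ultimately show "(if dem_word (cyc_word A) w \<in> Gr then of_int (s A w) * g (words_of (dem_word (cyc_word A) w)) else 0) =
      (\<Sum>u\<in>U. of_int (if dem_word (cyc_word A) w = u then s A w else 0) * g (words_of u))"
      using finU by auto
  qed
  also have "\<dots> = (\<Sum>u\<in>U. of_int (\<Sum>A\<in>P. \<Sum>w\<in>W. if dem_word (cyc_word A) w = u then s A w else 0) * g (words_of u))"
  proof -
    have "(\<Sum>u\<in>U. of_int (\<Sum>A\<in>P. \<Sum>w\<in>W. F A w u) * g (words_of u)) =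
        (\<Sum>w\<in>W. \<Sum>A\<in>P. \<Sum>u\<in>U. of_int (F A w u) * g (words_of u))" for F :: "nat set \<Rightarrow> (int \<Rightarrow> int) \<Rightarrow> (int \<Rightarrow> int) \<Rightarrow> int"
    proof -
      have "(\<Sum>u\<in>U. of_int (\<Sum>A\<in>P. \<Sum>w\<in>W. F A w u) * g (words_of u)) =
          (\<Sum>u\<in>U. \<Sum>w\<in>W. \<Sum>A\<in>P. of_int (F A w u) * g (words_of u))"
        by (simp only: of_int_sum sum_distrib_right sum.swap[of _ W P])
      also have "\<dots> = (\<Sum>w\<in>W. \<Sum>u\<in>U. \<Sum>A\<in>P. of_int (F A w u) * g (words_of u))" by (rule sum.swap)
      also have "\<dots> = (\<Sum>w\<in>W. \<Sum>A\<in>P. \<Sum>u\<in>U. of_int (F A w u) * g (words_of u))"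
        by (intro sum.cong HOL.refl) (rule sum.swap)
      finally show ?thesis .
    qed
    then show ?thesis by (rule HOL.sym)
  qed
  also have "\<dots> = (\<Sum>u\<in>U. g (words_of u))"
  proof (intro sum.cong HOL.refl)
    fix u assume u: "u \<in> U"
    then have uG: "u \<in> Gr" "u \<in> aff" by (auto simp: U_def)
    have "(\<Sum>A\<in>P. \<Sum>w\<in>W. if dem_word (cyc_word A) w = u then s A w else 0) = (\<Sum>A\<in>P. hecke_coeff lam (cyc_word A) u)"
    proof (intro sum.cong HOL.refl)
      fix A assume "A \<in> P"
      then have A: "A \<subset> {..k}" by (simp add: P_def)
      \<comment> \<open>Since \<open>u\<close> is Grassmannian, the restriction to Grassmannian
        \<open>w\<close> disappears, and the coefficient becomes the 0-Hecke one.\<close>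
      have "{w \<in> W. dem_word (cyc_word A) w = u} = {w. bruhat_le w lam \<and> dem_word (cyc_word A) w = u}"
      proof -
        have "w \<in> Gr" if "bruhat_le w lam" "dem_word (cyc_word A) w = u" for w
          using dem_word_Gr_imp[OF bruhat_le_aff[OF that(1) lam], of "cyc_word A"] that(2) uG(1) by metis
        then show ?thesis unfolding W_def by blast
      qed
      then have "(\<Sum>w\<in>W. if dem_word (cyc_word A) w = u then s A w else 0) = (\<Sum>w | bruhat_le w lam \<and> dem_word (cyc_word A) w = u. s A w)"
        using finW by (simp add: sum.inter_filter[symmetric])
      also have "\<dots> = hecke_coeff lam (cyc_word A) u"
        unfolding hecke_coeff_def by (intro sum.cong) (auto simp: s_def length_cyc_word[OF A])
      finally show "(\<Sum>w\<in>W. if dem_word (cyc_word A) w = u then s A w else 0) = hecke_coeff lam (cyc_word A) u" .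
    qed
    also have "\<dots> = 1"
      using sum_card_hecke_coeff[OF lam uG(2), of r] u by (auto simp: P_def U_def)
    finally show "of_int (\<Sum>A\<in>P. \<Sum>w\<in>W. if dem_word (cyc_word A) w = u then s A w else 0) * g (words_of u) = g (words_of u)"
      by simp
  qed
  also have "U = {u. u \<in> Gr \<and> (\<exists>A\<subset>{..k}. card A \<le> r \<and> bruhat_le u (dem_word (cyc_word A) lam))}"
    by (auto simp: U_def P_def)
  finally show ?thesis unfolding W_def .
qed

end

theorem theorem1p2:
  fixes k r :: nat and l :: "nat list" and g :: "affine_perm \<Rightarrow> power_series"
  assumes "1 \<le> k"
    and "K_k_Schur k g"
    and "l \<in> bounded_partitions k"
    and "1 \<le> r" and "r \<le> k"
  shows "g_tilde k g l * htilde r =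
    (\<Sum>\<mu> | \<mu> \<in> bounded_partitions k \<and>
         (\<exists>\<kappa>\<in>bounded_partitions k. weak_strip k r \<kappa> l \<and> part_le k \<mu> \<kappa>).
       g_part k g \<mu>)"
proof -
  interpret affine_action k using assms(1) by unfold_locales
  have reindex: "(\<Sum>\<mu> | \<mu> \<in> bounded_partitions k \<and> P (part_perm \<mu>). g_part k g \<mu>) =
      (\<Sum>u | u \<in> Gr \<and> P u. g (words_of u))" for P
  proof (rule sum.reindex_bij_betw[of part_perm, THEN HOL.trans[rotated]])
    show "bij_betw part_perm {\<mu> \<in> bounded_partitions k. P (part_perm \<mu>)} {u \<in> Gr. P u}"
      using bij_part_perm unfolding bij_betw_def by (auto intro: inj_on_subset)
  qed (simp add: g_part_def part_elem_words_of)
  have lam: "part_perm l \<in> Gr" using part_perm_beads(1)[OF assms(3)] .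
  have strip: "(\<exists>\<kappa>\<in>bounded_partitions k. weak_strip k r \<kappa> l \<and> part_le k \<mu> \<kappa>) \<longleftrightarrow>
      (\<exists>A\<subset>{..k}. card A \<le> r \<and> bruhat_le (part_perm \<mu>) (dem_word (cyc_word A) (part_perm l)))" if \<mu>: "\<mu> \<in> bounded_partitions k" for \<mu>
  proof -
    have "(\<exists>\<kappa>\<in>bounded_partitions k. weak_strip k r \<kappa> l \<and> part_le k \<mu> \<kappa>) \<longleftrightarrow>
        (\<exists>A\<subset>{..k}. card A = r \<and> cyc_perm A \<circ> part_perm l \<in> Gr \<and> len (cyc_perm A \<circ> part_perm l) = r + len (part_perm l) \<and>
          bruhat_le (part_perm \<mu>) (cyc_perm A \<circ> part_perm l))"
      unfolding weak_strip_part_perm part_le_iff using part_perm_surj part_perm_beads(1) by metis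
    then show ?thesis using weak_strip_iff[OF lam part_perm_beads(1)[OF \<mu>] assms(5)] by simp
  qed
  have "g_tilde k g l = (\<Sum>w | w \<in> Gr \<and> bruhat_le w (part_perm l). g (words_of w))"
    unfolding g_tilde_def part_le_iff by (rule reindex)
  then have "g_tilde k g l * htilde r =
      (\<Sum>u | u \<in> Gr \<and> (\<exists>A\<subset>{..k}. card A \<le> r \<and> bruhat_le u (dem_word (cyc_word A) (part_perm l))). g (words_of u))"
    using sum_ideal_times_htilde[OF assms(2) lam assms(5)] by simp
  also have "\<dots> = (\<Sum>\<mu> | \<mu> \<in> bounded_partitions k \<and>
      (\<exists>A\<subset>{..k}. card A \<le> r \<and> bruhat_le (part_perm \<mu>) (dem_word (cyc_word A) (part_perm l))). g_part k g \<mu>)"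
    by (rule reindex[symmetric])
  also have "\<dots> = (\<Sum>\<mu> | \<mu> \<in> bounded_partitions k \<and>
         (\<exists>\<kappa>\<in>bounded_partitions k. weak_strip k r \<kappa> l \<and> part_le k \<mu> \<kappa>). g_part k g \<mu>)"
    using strip by (intro sum.cong) auto
  finally show ?thesis .
qed

end
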